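(* Assume $(\mathbf A_1)$ and let $\vartheta\in\mathcal P_1(\mathbb{R}^n)$. Let $(\nu,\alpha,\beta)$ be a control process of the reduced system $(\hat S)$. Then the pair $(\mu,\mathfrak U)$ defined by $$\mu_t=\nu_{\xi^\leftarrow(t)},\qquad \mathfrak U(t)=\int_0^{\xi^\leftarrow(t)}\beta(s)\,ds,\qquad t\in[0,T],$$ where $\xi(s)=\int_0^s\alpha(\varsigma)\,d\varsigma$, is a limit point of some sequence $(\mu^k,u^k)$ of control processes of $(S)$, where convergence $(\mu^k,u^k)\to(\mu,\mathfrak U)$ is understood in the sense that $\mu^k\rightharpoondown\mu$ and $F_{u^k}\rightharpoondown\mathfrak U$.
   Context: $|\cdot|$ is the Manhattan norm. $\mathcal P_1=\mathcal P_1(\mathbb{R}^n)$ is the set of Borel probability measures on $\mathbb{R}^n$ with finite first moment, with the Wasserstein distance $W_1(\mu,\nu)=\sup\{\int\varphi\,d(\mu-\nu)\colon\varphi\ 1\text{-Lipschitz}\}$. $(g*\mu)(x)=\int g(x-y)\,d\mu(y)$. Assumption $(\mathbf A_1)$ on $f_0,\dots,f_m,g\colon\mathbb{R}^n\to\mathbb{R}^n$: there exist $C,L>0$ with $\sum_{i=0}^m|f_i(x)|+|g(x)|\le C$ for all $x$ and $\sum_{i=0}^m|f_i(x^1)-f_i(x^2)|+|g(x^1)-g(x^2)|\le L|x^1-x^2|$ for all $x^1,x^2$. System $(S)$, with given $T,M>0$: $\partial_t\mu_t+\nabla\cdot(v_t\mu_t)=0$ on $[0,T]$, $\mu_0=\vartheta$,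 $v_t(x)=f_0(x)+\sum_{i=1}^m u_i(t)f_i(x)+(g*\mu_t)(x)$, where controls $u\in\mathcal U$ are Borel measurable essentially bounded functions $[0,T]\to\mathbb{R}^m$ with $\int_0^T\sum_i|u_i(t)|\,dt=M$. A control process of $(S)$ is a pair $(\mu,u)$ with $u\in\mathcal U$ and $\mu$ the corresponding solution. Reduced system $(\hat S)$, with $S=T+M$: $\partial_s\nu_s+\nabla\cdot(w_s\nu_s)=0$ on $[0,S]$, $\nu_0=\vartheta$, $w_s(x)=\alpha(s)\left(f_0(x)+(g*\nu_s)(x)\right)+\sum_{i=1}^m\beta_i(s)f_i(x)$, with controls $(\alpha,\beta)\in\hat{\mathcal U}=\{(\alpha,\beta)\in L^\infty([0,S];A)\colon\int_0^S\alpha\,ds=T\}$, $A=\{(a,b)\in\mathbb{R}^{1+m}\colon a\ge0,\ a+\sum_{j=1}^m|b_j|\le1\}$. A control process of $(\hat S)$ is a triple $(\nu,\alpha,\beta)$ with $(\alpha,\beta)\in\hat{\mathcal U}$ and $\nu$ the corresponding solution. Both equations are understood in the weak sense (absolutely continuous curves in $\mathcal P_1$, satisfying the continuity equation in the sense of distributions, together with the initial condition), and under $(\mathbf A_1)$ solutions are unique. $F_f(t)=\int_0^tf(s)\,ds$. $BV_+([0,T];\mathcal X)$ is the set of functions of bounded variation $[0,T]\to\mathcal X$ that are right continuous on $[0,T)$. In $BV_+([0,T];\mathcal X)$, $F_k\rightharpoondown F$ means $F_k(t)\to F(t)$ at all continuity points $t$ of $F$ and at $t\in\{0,T\}$. The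 pseudo-inverse of $\xi$ is $\xi^\leftarrow(t)=\inf\{s\in[0,S]\colon\xi(s)>t\}$ for $t\in[0,T)$ and $\xi^\leftarrow(T)=S$.
   Formalization: Convergence at t=0 is required of μ^k only if μ_0=ϑ, and of F_{u^k} only if 𝔘(0)=0: otherwise it fails, since μ^k_0=ϑ and F_{u^k}(0)=0 for all k, while ξ^←(0)>0 may make the limit jump at 0. Also n,m≥1 (for m=0, (S) has no controls). *)

theory Defs
  imports "HOL-Probability.Probability"
begin

definition manhattan :: "real ^ 'n \<Rightarrow> real"
  where "manhattan x = (\<Sum>i\<in>UNIV. \<bar>x $ i\<bar>)"

definition P1 :: "(real ^ 'n) measure set"
  where "P1 = {\<mu>. prob_space \<mu> \<and> sets \<mu> = sets borel \<and> integrable \<mu> manhattan}"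

definition W1 :: "(real ^ 'n) measure \<Rightarrow> (real ^ 'n) measure \<Rightarrow> real"
  where "W1 \<mu> \<nu> =
    (SUP \<phi> \<in> {\<phi> :: real ^ 'n \<Rightarrow> real. \<forall>x y. \<bar>\<phi> x - \<phi> y\<bar> \<le> manhattan (x - y)}.
      (LINT x|\<mu>. \<phi> x) - (LINT x|\<nu>. \<phi> x))"

definition convol :: "(real ^ 'n \<Rightarrow> real ^ 'n) \<Rightarrow> (real ^ 'n) measure \<Rightarrow> real ^ 'n \<Rightarrow> real ^ 'n"
  where "convol g \<mu> x = (LINT y|\<mu>. g (x - y))"

definition assumption_A1 ::
  "(real ^ 'n \<Rightarrow> real ^ 'n) \<Rightarrow> ('m::finite \<Rightarrow> real ^ 'n \<Rightarrow> real ^ 'n) \<Rightarrow> (real ^ 'n \<Rightarrow> real ^ 'n) \<Rightarrow> bool"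
  where "assumption_A1 f\<^sub>0 f g \<longleftrightarrow>
    (\<exists>C>0. \<exists>L>0.
      (\<forall>x. manhattan (f\<^sub>0 x) + (\<Sum>i\<in>UNIV. manhattan (f i x)) + manhattan (g x) \<le> C) \<and>
      (\<forall>x y. manhattan (f\<^sub>0 x - f\<^sub>0 y) + (\<Sum>i\<in>UNIV. manhattan (f i x - f i y))
               + manhattan (g x - g y) \<le> L * manhattan (x - y)))"


subsection \<open>Weak solutions of the continuity equation\<close>

definition ac_curve :: "real \<Rightarrow> (real \<Rightarrow> (real ^ 'n) measure) \<Rightarrow> bool"
  where "ac_curve T \<mu> \<longleftrightarrow>
    (\<forall>t\<in>{0..T}. \<mu> t \<in> P1) \<and>
    (\<exists>h :: real \<Rightarrow> real. integrable (lebesgue_on {0..T}) h \<and>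
       (\<forall>s t. 0 \<le> s \<and> s \<le> t \<and> t \<le> T \<longrightarrow> W1 (\<mu> s) (\<mu> t) \<le> (LINT r|lebesgue_on {s..t}. h r)))"

primrec C_k :: "nat \<Rightarrow> ('a::euclidean_space \<Rightarrow> 'b::real_normed_vector) \<Rightarrow> bool"
  where
    "C_k 0 \<phi> \<longleftrightarrow> continuous_on UNIV \<phi>"
  | "C_k (Suc k) \<phi> \<longleftrightarrow>
       (\<forall>x. \<phi> differentiable (at x)) \<and> (\<forall>h. C_k k (\<lambda>x. frechet_derivative \<phi> (at x) h))"

definition test_functions :: "real \<Rightarrow> (real \<times> (real ^ 'n) \<Rightarrow> real) set"
  where "test_functions T =
    {\<phi>. (\<forall>k. C_k k \<phi>) \<and> (\<exists>K. compact K \<and> K \<subseteq> {0<..<T} \<times> UNIV \<and> (\<forall>z. z \<notin> K \<longrightarrow> \<phi> z = 0))}"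

text \<open>The derivative of a test function at \<open>(t, x)\<close> in direction \<open>(1, v t x)\<close> is the time
  derivative plus the scalar product of the spatial gradient with \<open>v t x\<close>.\<close>

definition solves_continuity_eq ::
  "real \<Rightarrow> (real \<Rightarrow> real ^ 'n \<Rightarrow> real ^ 'n) \<Rightarrow> (real ^ 'n) measure \<Rightarrow> (real \<Rightarrow> (real ^ 'n) measure) \<Rightarrow> bool"
  where "solves_continuity_eq T v \<theta> \<mu> \<longleftrightarrow>
    ac_curve T \<mu> \<and> \<mu> 0 = \<theta> \<and>
    (\<forall>\<phi>\<in>test_functions T.
       (LINT t|lebesgue_on {0..T}. LINT x|\<mu> t. frechet_derivative \<phi> (at (t, x)) (1, v t x)) = 0)"


subsection \<open>Control processes\<close>

definition controls :: "real \<Rightarrow> real \<Rightarrow> (real \<Rightarrow> real ^ 'm) set"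
  where "controls T M =
    {u. u \<in> borel_measurable (restrict_space borel {0..T}) \<and>
        (\<exists>B. AE t in lebesgue_on {0..T}. manhattan (u t) \<le> B) \<and>
        (LINT t|lebesgue_on {0..T}. manhattan (u t)) = M}"

definition control_process ::
  "real \<Rightarrow> real \<Rightarrow> (real ^ 'n \<Rightarrow> real ^ 'n) \<Rightarrow> ('m::finite \<Rightarrow> real ^ 'n \<Rightarrow> real ^ 'n) \<Rightarrow> (real ^ 'n \<Rightarrow> real ^ 'n)
    \<Rightarrow> (real ^ 'n) measure \<Rightarrow> (real \<Rightarrow> (real ^ 'n) measure) \<Rightarrow> (real \<Rightarrow> real ^ 'm) \<Rightarrow> bool"
  where "control_process T M f\<^sub>0 f g \<theta> \<mu> u \<longleftrightarrow>
    u \<in> controls T M \<and>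
    solves_continuity_eq T
      (\<lambda>t x. f\<^sub>0 x + (\<Sum>i\<in>UNIV. (u t $ i) *\<^sub>R f i x) + convol g (\<mu> t) x) \<theta> \<mu>"

definition control_set :: "(real \<times> (real ^ 'm)) set"
  where "control_set = {(a, b). a \<ge> 0 \<and> a + manhattan b \<le> 1}"

text \<open>Essential boundedness is implied, since \<open>control_set\<close> is bounded. Representatives of
  classes in \<open>L\<^sup>\<infinity>\<close> are only required to be Lebesgue measurable.\<close>

definition reduced_controls :: "real \<Rightarrow> real \<Rightarrow> ((real \<Rightarrow> real) \<times> (real \<Rightarrow> real ^ 'm)) set"
  where "reduced_controls T M =
    {(\<alpha>, \<beta>). \<alpha> \<in> borel_measurable (lebesgue_on {0..T + M}) \<and>
              \<beta> \<in> borel_measurable (lebesgue_on {0..T + M}) \<and>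
              (AE s in lebesgue_on {0..T + M}. (\<alpha> s, \<beta> s) \<in> control_set) \<and>
              (LINT s|lebesgue_on {0..T + M}. \<alpha> s) = T}"

definition reduced_control_process ::
  "real \<Rightarrow> real \<Rightarrow> (real ^ 'n \<Rightarrow> real ^ 'n) \<Rightarrow> ('m::finite \<Rightarrow> real ^ 'n \<Rightarrow> real ^ 'n) \<Rightarrow> (real ^ 'n \<Rightarrow> real ^ 'n)
    \<Rightarrow> (real ^ 'n) measure \<Rightarrow> (real \<Rightarrow> (real ^ 'n) measure) \<Rightarrow> (real \<Rightarrow> real) \<Rightarrow> (real \<Rightarrow> real ^ 'm) \<Rightarrow> bool"
  where "reduced_control_process T M f\<^sub>0 f g \<theta> \<nu> \<alpha> \<beta> \<longleftrightarrow>
    (\<alpha>, \<beta>) \<in> reduced_controls T M \<and>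
    solves_continuity_eq (T + M)
      (\<lambda>s x. \<alpha> s *\<^sub>R (f\<^sub>0 x + convol g (\<nu> s) x) + (\<Sum>i\<in>UNIV. (\<beta> s $ i) *\<^sub>R f i x)) \<theta> \<nu>"


subsection \<open>Functions of bounded variation\<close>

definition primitive :: "(real \<Rightarrow> 'a::euclidean_space) \<Rightarrow> real \<Rightarrow> 'a"
  where "primitive f t = (LINT s|lebesgue_on {0..t}. f s)"

definition pseudo_inverse :: "real \<Rightarrow> real \<Rightarrow> (real \<Rightarrow> real) \<Rightarrow> real \<Rightarrow> real"
  where "pseudo_inverse T S \<xi> t = (if t < T then Inf {s \<in> {0..S}. \<xi> s > t} else S)"

text \<open>Here \<open>d\<close> is a distance on the carrier \<open>X\<close>.\<close>

definition BV_plus :: "'x set \<Rightarrow> ('x \<Rightarrow> 'x \<Rightarrow> real) \<Rightarrow> real \<Rightarrow> (real \<Rightarrow> 'x) set"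
  where "BV_plus X d T =
    {F. (\<forall>t\<in>{0..T}. F t \<in> X) \<and>
        (\<exists>B. \<forall>(N::nat) \<tau>. mono_on {..N} \<tau> \<and> \<tau> ` {..N} \<subseteq> {0..T} \<longrightarrow>
               (\<Sum>i<N. d (F (\<tau> i)) (F (\<tau> (Suc i)))) \<le> B) \<and>
        (\<forall>t\<in>{0..<T}. ((\<lambda>s. d (F s) (F t)) \<longlongrightarrow> 0) (at_right t))}"

text \<open>
  Elements of \<open>BV_plus\<close> are right continuous at \<open>0\<close>, so a jump at the initial time is visible only
  through the left limit \<open>F(0-)\<close>. The point \<open>p\<close> is this left limit; for trajectories of a control
  system it is the prescribed initial datum. A function is continuous at \<open>0\<close> iff in addition
  \<open>F 0 = p\<close>.
\<close>

definition continuity_point :: "('x \<Rightarrow> 'x \<Rightarrow> real) \<Rightarrow> real \<Rightarrow> 'x \<Rightarrow> (real \<Rightarrow> 'x) \<Rightarrow> real \<Rightarrow> bool"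
  where "continuity_point d T p F t \<longleftrightarrow>
    ((\<lambda>s. d (F s) (F t)) \<longlongrightarrow> 0) (at t within {0..T}) \<and> (t = 0 \<longrightarrow> F 0 = p)"

text \<open>
  Convergence in \<open>BV_plus\<close> of functions with common left limit \<open>p\<close> at \<open>0\<close>: pointwise convergence
  at the continuity points of the limit and at the end points, where at the left end point the
  values at \<open>0-\<close> are meant (these agree and contribute no condition).
  Convergence of the values at \<open>0\<close> itself cannot be demanded when the limit jumps there: the
  trajectories of the control system all start at \<open>p\<close>, but if \<open>\<alpha>\<close> vanishes on \<open>[0, h]\<close> with
  \<open>h > 0\<close>, then the pseudo-inverse of the primitive of \<open>\<alpha>\<close> is at least \<open>h\<close> at \<open>0\<close>, and the limit has
  in general already left \<open>p\<close> at time \<open>0\<close>.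
\<close>

definition BV_converges ::
  "'x set \<Rightarrow> ('x \<Rightarrow> 'x \<Rightarrow> real) \<Rightarrow> real \<Rightarrow> 'x \<Rightarrow> (nat \<Rightarrow> real \<Rightarrow> 'x) \<Rightarrow> (real \<Rightarrow> 'x) \<Rightarrow> bool"
  where "BV_converges X d T p Fs F \<longleftrightarrow>
    (\<forall>k. Fs k \<in> BV_plus X d T) \<and> F \<in> BV_plus X d T \<and>
    (\<forall>t\<in>{0..T}. continuity_point d T p F t \<or> t = T \<longrightarrow> (\<lambda>k. d (Fs k t) (F t)) \<longlonglongrightarrow> 0)"

end

theory Submission
  imports Defs
begin

text \<open>
  The given weak solution \<open>\<nu>\<close> is compared with laws of explicit flows. Cut \<open>[0, S]\<close> into small blocks and
  perturb the clock \<open>\<xi>\<close> to a strictly increasing one. Since \<open>\<alpha> + |\<beta>| \<le> 1\<close>, on the image of each block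
  there is a two-valued control \<open>u\<close> whose integral is (almost) that of \<open>\<beta>\<close> and whose cost uses up exactly
  the remaining length of the block; the total cost is then \<open>S - T = M\<close>. For this \<open>u\<close> the nonlocal
  characteristics exist by a fixed point argument, and the law of the flow solves the system.

  To compare, let \<open>\<phi>\<close> be a 1-Lipschitz test function and mollify it at scale \<open>\<epsilon>\<close>. Testing the equation of \<open>\<nu>\<close>
  with the mollified function and freezing the velocity over a block of length \<open>h\<close> produces an error
  \<open>h (o(1) + O(\<epsilon>))\<close> as \<open>h\<close> tends to 0 with \<open>\<epsilon>\<close> fixed: mollification commutes with the frozen
  transport up to \<open>O(\<epsilon> h)\<close> because the velocity is Lipschitz. A discrete Gronwall argument sums the errors;
  then \<open>\<epsilon>\<close> tends to 0. No uniqueness theorem for the continuity equation is needed.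

  A continuity point of \<open>\<nu>\<close> composed with the pseudo-inverse of \<open>\<xi>\<close> may be a jump of this pseudo-inverse during which \<open>\<nu>\<close> runs through a loop, so the
  perturbed clocks have to be delayed in order that their inverses converge to the pseudo-inverse at every point
  of \<open>(0, T)\<close>.
\<close>

subsection \<open>The Wasserstein distance\<close>

text \<open>The pull-back of a test function along one frozen step is \<phi> (y + V y) with V merely
  Lipschitz, so smoothness is lost at every block. The class that survives is that of Lipschitz
  functions with bounded support, whose constant grows by a factor 1 + O(h). The recursion therefore
  runs over all of them at once, and one fixed kernel supplies the smoothness that the weak
  formulation demands. The price is the second derivative of the mollified function, which grows as
  \<epsilon> decreases and multiplies both h and the oscillation of \<nu> over a block. For this
  reason the approximating processes are built with no reference to \<epsilon>, and their error
  bound is stated for all kernels simultaneously. Shrinking \<beta> by the weight that \<xi> carries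
  in the perturbed clock keeps every block affordable: the length left over by the clock is at least
  that fraction of the length left over by \<xi>, which in turn bounds the integral of |\<beta>|.
  The clock has to be strictly increasing because a block whose image has length zero could carry no
  control with a nonzero integral.\<close>

lemma norm_le_manhattan: "norm x \<le> manhattan x"
  unfolding manhattan_def by (rule norm_le_l1_cart)

lemma manhattan_le_norm: "manhattan (x :: real ^ 'n) \<le> CARD('n) * norm x"
  unfolding manhattan_def
  using sum_bounded_above[of UNIV "\<lambda>i. \<bar>x $ i\<bar>" "norm x"] component_le_norm_cart[of x] by simp

lemma manhattan_nonneg [simp]: "0 \<le> manhattan x"
  unfolding manhattan_def by (simp add: sum_nonneg)

lemma manhattan_0 [simp]: "manhattan 0 = 0"
  unfolding manhattan_def by simp

lemma manhattan_minus_commute: "manhattan (x - y) = manhattan (y - x)"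
  unfolding manhattan_def by (simp add: abs_minus_commute)

lemma manhattan_scaleR: "manhattan (c *\<^sub>R x) = \<bar>c\<bar> * manhattan x"
  unfolding manhattan_def by (simp add: abs_mult sum_distrib_left)

lemma manhattan_add: "manhattan (x + y) \<le> manhattan x + manhattan y"
  unfolding manhattan_def by (simp add: sum.distrib[symmetric] sum_mono)

lemma manhattan_triangle: "manhattan (x - z) \<le> manhattan (x - y) + manhattan (y - z)"
  using manhattan_add[of "x - y" "y - z"] by simp

lemma continuous_on_manhattan [continuous_intros]:
  "continuous_on S h \<Longrightarrow> continuous_on S (\<lambda>x. manhattan (h x))"
  unfolding manhattan_def by (intro continuous_intros)

lemma borel_measurable_manhattan [measurable]: "manhattan \<in> borel_measurable borel"
  by (intro borel_measurable_continuous_onI continuous_intros)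

lemma P1_prob_space: "\<mu> \<in> P1 \<Longrightarrow> prob_space \<mu>"
  and P1_sets: "\<mu> \<in> P1 \<Longrightarrow> sets \<mu> = sets borel"
  and P1_integrable: "\<mu> \<in> P1 \<Longrightarrow> integrable \<mu> manhattan"
  by (auto simp: P1_def)

lemma P1_borel_measurable: "\<mu> \<in> P1 \<Longrightarrow> borel_measurable \<mu> = borel_measurable borel"
  by (rule measurable_cong_sets[OF P1_sets refl])

lemma P1_integrable_norm:
  assumes "\<mu> \<in> P1" shows "integrable \<mu> norm"
  by (rule Bochner_Integration.integrable_bound[OF P1_integrable[OF assms]])
     (auto simp: P1_borel_measurable[OF assms] norm_le_manhattan)

lemma lipschitz_measurable:
  fixes \<phi> :: "'a::euclidean_space \<Rightarrow> 'b::euclidean_space"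
  assumes "L-lipschitz_on UNIV \<phi>" shows "\<phi> \<in> borel_measurable borel"
  using assms by (intro borel_measurable_continuous_onI lipschitz_on_continuous_on)

lemma P1_lipschitz_integrable:
  fixes \<phi> :: "real ^ 'n \<Rightarrow> 'b::euclidean_space"
  assumes \<mu>: "\<mu> \<in> P1" and \<phi>: "L-lipschitz_on UNIV \<phi>"
  shows "integrable \<mu> \<phi>"
proof -
  interpret prob_space \<mu> using \<mu> by (rule P1_prob_space)
  have "norm (\<phi> x) \<le> norm (\<phi> 0) + L * norm x" for x
    using lipschitz_onD[OF \<phi>, of x 0] norm_triangle_ineq2[of "\<phi> x" "\<phi> 0"]
    by (simp add: dist_norm)
  moreover have "0 \<le> L" using \<phi> by (rule lipschitz_on_nonneg)
  ultimately show ?thesis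
    by (intro Bochner_Integration.integrable_bound[where g = \<phi> and f = "\<lambda>x. norm (\<phi> 0) + L * norm x"])
       (auto simp: P1_borel_measurable[OF \<mu>] lipschitz_measurable[OF \<phi>] P1_integrable_norm[OF \<mu>])
qed

text \<open>The estimates below run in the Euclidean norm, where mean value and Taylor bounds are at
  hand. Passing from the Manhattan class to Euclidean Lipschitz functions is one source of the
  factors \<open>CARD('n)\<close>.\<close>

lemma manhattan_lipschitz_norm:
  assumes "\<forall>x y. \<bar>\<phi> x - \<phi> y\<bar> \<le> manhattan (x - y)"
  shows "CARD('n)-lipschitz_on UNIV (\<phi> :: real ^ 'n \<Rightarrow> real)"
proof (rule lipschitz_onI)
  fix x y
  show "dist (\<phi> x) (\<phi> y) \<le> CARD('n) * dist x y"
    using assms[rule_format, of x y] manhattan_le_norm[of "x - y"] by (simp add: dist_norm)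
qed simp

lemma lipschitz_manhattan:
  assumes "1-lipschitz_on UNIV (\<phi> :: real ^ 'n \<Rightarrow> real)"
  shows "\<bar>\<phi> x - \<phi> y\<bar> \<le> manhattan (x - y)"
  using lipschitz_onD[OF assms, of x y] norm_le_manhattan[of "x - y"] by (simp add: dist_norm)

text \<open>\<open>SUP\<close> over the reals is meaningful only on a bounded set. After subtracting
  \<phi> 0, which cancels between two probability measures, an admissible function is dominated by
  \<open>manhattan\<close>, and first moments are finite.\<close>

lemma W1_bdd_above:
  assumes \<mu>: "\<mu> \<in> P1" and \<nu>: "\<nu> \<in> P1"
  shows "bdd_above ((\<lambda>\<phi>. (LINT x|\<mu>. \<phi> x) - (LINT x|\<nu>. \<phi> x)) `
    {\<phi> :: real ^ 'n \<Rightarrow> real. \<forall>x y. \<bar>\<phi> x - \<phi> y\<bar> \<le> manhattan (x - y)})"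
proof (rule bdd_aboveI2)
  fix \<phi> :: "real ^ 'n \<Rightarrow> real"
  assume "\<phi> \<in> {\<phi>. \<forall>x y. \<bar>\<phi> x - \<phi> y\<bar> \<le> manhattan (x - y)}"
  then have \<phi>: "\<forall>x y. \<bar>\<phi> x - \<phi> y\<bar> \<le> manhattan (x - y)" by simp
  interpret \<mu>: prob_space \<mu> using \<mu> by (rule P1_prob_space)
  interpret \<nu>: prob_space \<nu> using \<nu> by (rule P1_prob_space)
  note int = P1_lipschitz_integrable[OF _ manhattan_lipschitz_norm[OF \<phi>]]
  have b: "\<bar>\<phi> x - \<phi> 0\<bar> \<le> manhattan x" for x using \<phi>[rule_format, of x 0] by simp
  have 1: "(LINT x|\<mu>. \<phi> x - \<phi> 0) \<le> (LINT x|\<mu>. manhattan x)"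
    using b abs_le_D1 by (intro integral_mono Bochner_Integration.integrable_diff int[OF \<mu>] P1_integrable \<mu>) auto
  have 2: "(LINT x|\<nu>. - manhattan x) \<le> (LINT x|\<nu>. \<phi> x - \<phi> 0)"
    using b by (intro integral_mono Bochner_Integration.integrable_diff Bochner_Integration.integrable_minus
         int[OF \<nu>] P1_integrable \<nu>) (auto simp: abs_le_iff, smt (verit))
  show "(LINT x|\<mu>. \<phi> x) - (LINT x|\<nu>. \<phi> x) \<le> (LINT x|\<mu>. manhattan x) + (LINT x|\<nu>. manhattan x)"
    using 1 2 int[OF \<mu>] int[OF \<nu>] by (simp add: \<mu>.prob_space \<nu>.prob_space)
qed

lemma W1_upper:
  assumes "\<mu> \<in> P1" "\<nu> \<in> P1" "\<forall>x y. \<bar>\<phi> x - \<phi> y\<bar> \<le> manhattan (x - y)"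
  shows "(LINT x|\<mu>. \<phi> x) - (LINT x|\<nu>. \<phi> x) \<le> W1 \<mu> \<nu>"
  unfolding W1_def using assms by (intro cSUP_upper2[OF W1_bdd_above]) auto

lemma W1_least:
  assumes "\<And>\<phi>. \<forall>x y. \<bar>\<phi> x - \<phi> y\<bar> \<le> manhattan (x - y) \<Longrightarrow> (LINT x|\<mu>. \<phi> x) - (LINT x|\<nu>. \<phi> x) \<le> c"
  shows "W1 \<mu> \<nu> \<le> c"
  unfolding W1_def using assms by (intro cSUP_least) (auto intro!: exI[of _ "\<lambda>x. 0"])

text \<open>Negation permutes the admissible functions and exchanges the two integrals; this needs
  no finiteness, so symmetry holds for arbitrary measures.\<close>

lemma W1_commute: "W1 \<mu> \<nu> = W1 \<nu> (\<mu> :: (real ^ 'n) measure)"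
proof -
  let ?A = "{\<phi> :: real ^ 'n \<Rightarrow> real. \<forall>x y. \<bar>\<phi> x - \<phi> y\<bar> \<le> manhattan (x - y)}"
  have "?A = (\<lambda>\<phi> x. - \<phi> x) ` ?A"
  proof safe
    fix \<phi> :: "real ^ 'n \<Rightarrow> real" assume "\<forall>x y. \<bar>\<phi> x - \<phi> y\<bar> \<le> manhattan (x - y)"
    then show "\<phi> \<in> (\<lambda>\<phi> x. - \<phi> x) ` ?A"
      by (intro image_eqI[of _ _ "\<lambda>x. - \<phi> x"]) (auto simp: abs_minus_commute)
  qed (auto simp: abs_minus_commute)
  then have "W1 \<mu> \<nu> = (SUP \<phi> \<in> (\<lambda>\<phi> x. - \<phi> x) ` ?A. (LINT x|\<mu>. \<phi> x) - (LINT x|\<nu>. \<phi> x))"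
    unfolding W1_def by simp
  also have "\<dots> = W1 \<nu> \<mu>"
    unfolding W1_def image_image by simp
  finally show ?thesis .
qed

lemma W1_nonneg: "\<mu> \<in> P1 \<Longrightarrow> \<nu> \<in> P1 \<Longrightarrow> 0 \<le> W1 \<mu> \<nu>"
  using W1_upper[of \<mu> \<nu> "\<lambda>x. 0"] by simp

lemma W1_refl: "\<mu> \<in> P1 \<Longrightarrow> W1 \<mu> \<mu> = 0"
  using W1_least[of \<mu> \<mu> 0] W1_nonneg[of \<mu> \<mu>] by simp

lemma W1_triangle:
  fixes \<mu> \<nu> \<pi> :: "(real ^ 'n) measure"
  assumes "\<mu> \<in> P1" "\<nu> \<in> P1" "\<pi> \<in> P1"
  shows "W1 \<mu> \<pi> \<le> W1 \<mu> \<nu> + W1 \<nu> \<pi>"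
proof (rule W1_least)
  fix \<phi> :: "real ^ 'n \<Rightarrow> real"
  assume "\<forall>x y. \<bar>\<phi> x - \<phi> y\<bar> \<le> manhattan (x - y)"
  from W1_upper[OF assms(1,2) this] W1_upper[OF assms(2,3) this]
  show "(LINT x|\<mu>. \<phi> x) - (LINT x|\<pi>. \<phi> x) \<le> W1 \<mu> \<nu> + W1 \<nu> \<pi>" by simp
qed

lemma lipschitz_on_divide:
  fixes \<phi> :: "'a::metric_space \<Rightarrow> real"
  assumes "K-lipschitz_on UNIV \<phi>" "K > 0"
  shows "1-lipschitz_on UNIV (\<lambda>x. \<phi> x / K)"
proof (rule lipschitz_onI)
  fix x y
  have "dist (\<phi> x / K) (\<phi> y / K) = dist (\<phi> x) (\<phi> y) / K"
    using assms(2) by (simp add: dist_real_def diff_divide_distrib[symmetric])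
  then show "dist (\<phi> x / K) (\<phi> y / K) \<le> 1 * dist x y"
    using lipschitz_onD[OF assms(1), of x y] assms(2) by (simp add: pos_divide_le_eq mult.commute)
qed simp

lemma W1_lipschitz_bound:
  fixes \<phi> :: "real ^ 'n \<Rightarrow> real"
  assumes \<mu>: "\<mu> \<in> P1" and \<nu>: "\<nu> \<in> P1" and \<phi>: "K-lipschitz_on UNIV \<phi>"
  shows "\<bar>(LINT x|\<mu>. \<phi> x) - (LINT x|\<nu>. \<phi> x)\<bar> \<le> K * W1 \<mu> \<nu>"
proof (cases "K > 0")
  case True
  have l: "\<forall>x y. \<bar>\<phi> x / K - \<phi> y / K\<bar> \<le> manhattan (x - y)"
    using lipschitz_manhattan[OF lipschitz_on_divide[OF \<phi> True]] by blast
  from W1_upper[OF \<mu> \<nu> l] W1_upper[OF \<nu> \<mu> l] show ?thesis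
    using True by (simp add: W1_commute[of \<nu> \<mu>] diff_divide_distrib[symmetric] pos_divide_le_eq mult.commute abs_le_iff)
next
  case False
  then have "K = 0" using lipschitz_on_nonneg[OF \<phi>] by simp
  then have "\<phi> x = \<phi> 0" for x using lipschitz_onD[OF \<phi>, of x 0] by simp
  then have "(LINT x|\<pi>. \<phi> x) = \<phi> 0" if "\<pi> \<in> P1" for \<pi>
    using Bochner_Integration.integral_cong[of \<pi> \<pi> \<phi> "\<lambda>x. \<phi> 0"]
      prob_space.prob_space[OF P1_prob_space[OF that]] by simp
  then show ?thesis using \<mu> \<nu> \<open>K = 0\<close> by simp
qed

text \<open>Clipping \<phi> between plus and minus the tent max 0 (R - |x|) keeps the Lipschitz
  constant 1, because maxima and minima do; multiplying by a cutoff would not. The normalisation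
  \<phi> 0 = 0 gives |\<phi> x| \<le> |x|, so nothing is clipped where 2 |x| \<le> R.\<close>

lemma lipschitz_truncate:
  fixes \<phi> :: "'a::euclidean_space \<Rightarrow> real"
  assumes \<phi>: "1-lipschitz_on UNIV \<phi>" and "\<phi> 0 = 0"
  defines "\<phi>' \<equiv> \<lambda>R x. max (- max 0 (R - norm x)) (min (\<phi> x) (max 0 (R - norm x)))"
  shows "1-lipschitz_on UNIV (\<phi>' R)" "R < norm x \<Longrightarrow> \<phi>' R x = 0"
    "\<bar>\<phi>' R x\<bar> \<le> norm x" "2 * norm x \<le> R \<Longrightarrow> \<phi>' R x = \<phi> x"
proof -
  have d: "\<bar>\<phi> x - \<phi> y\<bar> \<le> norm (x - y)" for x y
    using lipschitz_onD[OF \<phi>, of x y] by (simp add: dist_norm)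
  have d0: "\<bar>\<phi> x\<bar> \<le> norm x" for x using d[of x 0] assms(2) by simp
  show "1-lipschitz_on UNIV (\<phi>' R)"
  proof (rule lipschitz_onI)
    fix x y
    define c where "c z = max 0 (R - norm z)" for z :: 'a
    have c: "\<bar>c x - c y\<bar> \<le> norm (x - y)"
      using norm_triangle_ineq3[of x y] unfolding c_def by linarith
    then have "\<bar>min (\<phi> x) (c x) - min (\<phi> y) (c y)\<bar> \<le> norm (x - y)"
      using d[of x y] by linarith
    then have "\<bar>max (- c x) (min (\<phi> x) (c x)) - max (- c y) (min (\<phi> y) (c y))\<bar> \<le> norm (x - y)"
      using c by linarith
    then show "dist (\<phi>' R x) (\<phi>' R y) \<le> 1 * dist x y"
      unfolding \<phi>'_def c_def by (simp only: dist_norm real_norm_def mult_1)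
  qed simp
  define c where "c = max 0 (R - norm x)"
  have \<phi>'_eq: "\<phi>' R x = max (- c) (min (\<phi> x) c)"
    unfolding \<phi>'_def c_def ..
  have "0 \<le> c" unfolding c_def by simp
  then show "\<bar>\<phi>' R x\<bar> \<le> norm x"
    using d0[of x] unfolding \<phi>'_eq by linarith
  show "\<phi>' R x = 0" if "R < norm x"
  proof -
    have "c = 0" using that unfolding c_def by simp
    then show ?thesis unfolding \<phi>'_eq by simp
  qed
  show "\<phi>' R x = \<phi> x" if "2 * norm x \<le> R"
  proof -
    have "norm x \<le> c" using that unfolding c_def by linarith
    then show ?thesis using d0[of x] unfolding \<phi>'_eq by linarith
  qed
qed

text \<open>The truncations converge pointwise and are dominated by the norm, which is integrable
  for measures in \<open>P1\<close>. Both measures have mass one, so normalising \<phi> at the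
  origin does not change the difference.\<close>

lemma integral_diff_le_of_bounded_support:
  fixes \<phi> :: "real ^ 'n \<Rightarrow> real"
  assumes \<mu>: "\<mu> \<in> P1" and \<nu>: "\<nu> \<in> P1" and \<phi>: "1-lipschitz_on UNIV \<phi>"
    and c: "\<And>\<psi> R. 1-lipschitz_on UNIV \<psi> \<Longrightarrow> (\<forall>x. R < norm x \<longrightarrow> \<psi> x = 0) \<Longrightarrow>
      (LINT x|\<mu>. \<psi> x) - (LINT x|\<nu>. \<psi> x) \<le> c"
  shows "(LINT x|\<mu>. \<phi> x) - (LINT x|\<nu>. \<phi> x) \<le> c"
proof -
  interpret \<mu>: prob_space \<mu> using \<mu> by (rule P1_prob_space)
  interpret \<nu>: prob_space \<nu> using \<nu> by (rule P1_prob_space)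
  define \<phi>0 where "\<phi>0 x = \<phi> x - \<phi> 0" for x
  have \<phi>0: "1-lipschitz_on UNIV \<phi>0" "\<phi>0 0 = 0"
    using \<phi> unfolding \<phi>0_def lipschitz_on_def by (auto simp: dist_norm)
  define \<psi> where "\<psi> R x = max (- max 0 (R - norm x)) (min (\<phi>0 x) (max 0 (R - norm x)))" for R x
  note tr = lipschitz_truncate[OF \<phi>0, folded \<psi>_def]
  have lim: "(\<lambda>k. LINT x|\<pi>. \<psi> (real k) x) \<longlonglongrightarrow> (LINT x|\<pi>. \<phi>0 x)" if \<pi>: "\<pi> \<in> P1" for \<pi>
  proof (rule integral_dominated_convergence[where w = norm])
    show "AE x in \<pi>. (\<lambda>k. \<psi> (real k) x) \<longlonglongrightarrow> \<phi>0 x"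
    proof (rule AE_I2)
      fix x :: "real ^ 'n"
      obtain k0 :: nat where k0: "2 * norm x \<le> real k0" using real_arch_simple by blast
      show "(\<lambda>k. \<psi> (real k) x) \<longlonglongrightarrow> \<phi>0 x"
        by (rule tendsto_eventually, rule eventually_sequentiallyI[of k0]) (use k0 tr(4) in auto)
    qed
  qed (use tr(3) in \<open>auto simp: P1_borel_measurable[OF \<pi>] lipschitz_measurable[OF tr(1)]
      lipschitz_measurable[OF \<phi>0(1)] P1_integrable_norm[OF \<pi>]\<close>)
  have "(LINT x|\<mu>. \<phi>0 x) - (LINT x|\<nu>. \<phi>0 x) \<le> c"
    by (rule LIMSEQ_le_const2[OF tendsto_diff[OF lim[OF \<mu>] lim[OF \<nu>]]])
       (use c[OF tr(1)] tr(2) in blast)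
  then show ?thesis
    unfolding \<phi>0_def using P1_lipschitz_integrable[OF \<mu> \<phi>] P1_lipschitz_integrable[OF \<nu> \<phi>]
    by (simp add: \<mu>.prob_space \<nu>.prob_space)
qed

lemma W1_le_of_bounded_support:
  fixes \<mu> \<nu> :: "(real ^ 'n) measure" and c :: real
  assumes \<mu>: "\<mu> \<in> P1" and \<nu>: "\<nu> \<in> P1"
    and c: "\<And>\<psi> R. 1-lipschitz_on UNIV \<psi> \<Longrightarrow> (\<forall>x. R < norm x \<longrightarrow> \<psi> x = 0) \<Longrightarrow>
      (LINT x|\<mu>. \<psi> x) - (LINT x|\<nu>. \<psi> x) \<le> c"
  shows "W1 \<mu> \<nu> \<le> CARD('n) * c"
proof (rule W1_least)
  fix \<phi> :: "real ^ 'n \<Rightarrow> real"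
  assume "\<forall>x y. \<bar>\<phi> x - \<phi> y\<bar> \<le> manhattan (x - y)"
  then have "1-lipschitz_on UNIV (\<lambda>x. \<phi> x / CARD('n))"
    using lipschitz_on_divide[OF manhattan_lipschitz_norm] by simp
  from integral_diff_le_of_bounded_support[OF \<mu> \<nu> this c]
  show "(LINT x|\<mu>. \<phi> x) - (LINT x|\<nu>. \<phi> x) \<le> CARD('n) * c"
    by (simp add: diff_divide_distrib[symmetric] pos_divide_le_eq mult.commute)
qed

text \<open>The pair (X, Y) under \<theta> is a coupling of the two laws, and its cost is bounded
  pointwise by c.\<close>

lemma W1_distr_le:
  fixes X Y :: "real ^ 'n \<Rightarrow> real ^ 'n" and c :: real
  assumes \<theta>: "\<theta> \<in> P1" and X: "X \<in> borel_measurable borel" "distr \<theta> borel X \<in> P1"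
    and Y: "Y \<in> borel_measurable borel" "distr \<theta> borel Y \<in> P1"
    and c: "\<And>x. norm (X x - Y x) \<le> c"
  shows "W1 (distr \<theta> borel X) (distr \<theta> borel Y) \<le> CARD('n) * c"
proof (rule W1_le_of_bounded_support[OF X(2) Y(2)])
  fix \<psi> :: "real ^ 'n \<Rightarrow> real" and R
  assume \<psi>: "1-lipschitz_on UNIV \<psi>"
  interpret prob_space \<theta> using \<theta> by (rule P1_prob_space)
  note [measurable] = lipschitz_measurable[OF \<psi>]
  have m: "X \<in> measurable \<theta> borel" "Y \<in> measurable \<theta> borel" using X(1) Y(1) by (simp_all add: P1_borel_measurable[OF \<theta>])
  have i: "integrable \<theta> (\<lambda>x. \<psi> (X x))" "integrable \<theta> (\<lambda>x. \<psi> (Y x))"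
    using P1_lipschitz_integrable[OF X(2) \<psi>] P1_lipschitz_integrable[OF Y(2) \<psi>] m
    by (simp_all add: integrable_distr_eq)
  have "(LINT x|\<theta>. \<psi> (X x)) - (LINT x|\<theta>. \<psi> (Y x)) = (LINT x|\<theta>. \<psi> (X x) - \<psi> (Y x))"
    using i by simp
  also have "\<dots> \<le> (LINT x|\<theta>. c)"
  proof (intro integral_mono)
    fix x
    show "\<psi> (X x) - \<psi> (Y x) \<le> c"
      using lipschitz_onD[OF \<psi>, of "X x" "Y x"] c[of x] by (simp add: dist_norm)
  qed (use i in auto)
  finally show "(LINT x|distr \<theta> borel X. \<psi> x) - (LINT x|distr \<theta> borel Y. \<psi> x) \<le> c"
    using m by (simp add: integral_distr prob_space)
qed

subsection \<open>Smooth functions and mollification\<close>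

definition C_inf :: "('a::euclidean_space \<Rightarrow> real) \<Rightarrow> bool"
  where "C_inf \<phi> \<longleftrightarrow> (\<forall>k. C_k k \<phi>)"

definition bounded_support :: "('a::real_normed_vector \<Rightarrow> real) \<Rightarrow> bool"
  where "bounded_support \<phi> \<longleftrightarrow> (\<exists>R. \<forall>x. R < norm x \<longrightarrow> \<phi> x = 0)"

section \<open>Closure properties of the classes \<open>C_k\<close>\<close>

lemma C_k_SucI:
  assumes "\<And>x. (\<phi> has_derivative \<phi>' x) (at x)" and "\<And>h. C_k k (\<lambda>x. \<phi>' x h)"
  shows "C_k (Suc k) \<phi>"
proof -
  have "frechet_derivative \<phi> (at x) = \<phi>' x" for x
    using frechet_derivative_at[OF assms(1)] by simp
  then show ?thesis using assms by (auto simp: differentiable_def)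
qed

lemma C_k_SucD: "C_k (Suc k) \<phi> \<Longrightarrow> C_k k \<phi>"
proof (induction k arbitrary: \<phi>)
  case 0
  then show ?case by (simp add: continuous_at_imp_continuous_on differentiable_imp_continuous_within)
next
  case (Suc k)
  have "\<phi> differentiable at x" "C_k k (\<lambda>x. frechet_derivative \<phi> (at x) h)" for x h
    using Suc.prems by (auto intro!: Suc.IH simp del: C_k.simps simp: C_k.simps(2)[of "Suc k"])
  then show ?case by simp
qed

lemma C_k_differentiable:
  "C_k (Suc k) \<phi> \<Longrightarrow> (\<phi> has_derivative frechet_derivative \<phi> (at x)) (at x)"
  by (simp add: frechet_derivative_works)

lemma C_k_const: "C_k k (\<lambda>x. c)"
  by (induction k arbitrary: c) (auto simp: frechet_derivative_const)

lemma C_k_add: "C_k k \<phi> \<Longrightarrow> C_k k \<psi> \<Longrightarrow> C_k k (\<lambda>x. \<phi> x + \<psi> x)"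
proof (induction k arbitrary: \<phi> \<psi>)
  case (Suc k)
  show ?case
    by (rule C_k_SucI[OF has_derivative_add[OF Suc.prems[THEN C_k_differentiable]]])
       (use Suc in auto)
qed (auto intro: continuous_intros)

lemma C_k_mult:
  fixes \<phi> \<psi> :: "'a::euclidean_space \<Rightarrow> real"
  shows "C_k k \<phi> \<Longrightarrow> C_k k \<psi> \<Longrightarrow> C_k k (\<lambda>x. \<phi> x * \<psi> x)"
proof (induction k arbitrary: \<phi> \<psi>)
  case (Suc k)
  show ?case
    by (rule C_k_SucI[OF has_derivative_mult[OF Suc.prems[THEN C_k_differentiable]]])
       (use Suc C_k_SucD in \<open>auto intro!: C_k_add Suc.IH\<close>)
qed (auto intro: continuous_intros)

lemma C_k_affine:
  fixes A :: "'a::euclidean_space \<Rightarrow> 'b::euclidean_space"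
  assumes "bounded_linear A"
  shows "C_k k \<phi> \<Longrightarrow> C_k k (\<lambda>x. \<phi> (c + A x))"
proof (induction k arbitrary: \<phi>)
  case 0
  then show ?case
    by (auto intro!: continuous_on_compose2[of UNIV \<phi>] continuous_intros linear_continuous_on[OF assms])
next
  case (Suc k)
  have A: "((\<lambda>x. c + A x) has_derivative A) (at x)" for x
    using bounded_linear_imp_has_derivative[OF assms] by (auto intro!: derivative_eq_intros)
  have "((\<lambda>x. \<phi> (c + A x)) has_derivative (\<lambda>h. frechet_derivative \<phi> (at (c + A x)) (A h))) (at x)" for x
    using diff_chain_at[OF A[of x] C_k_differentiable[OF Suc.prems]] by (simp add: o_def)
  then show ?case
    by (rule C_k_SucI) (use Suc in auto)
qed

lemma C_k_prod: 
  fixes \<phi> :: "'i \<Rightarrow> 'a::euclidean_space \<Rightarrow> real"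
  shows "finite I \<Longrightarrow> (\<And>i. i \<in> I \<Longrightarrow> C_k k (\<phi> i)) \<Longrightarrow> C_k k (\<lambda>x. \<Prod>i\<in>I. \<phi> i x)"
  by (induction I rule: finite_induct) (auto intro: C_k_const C_k_mult)

section \<open>A smooth kernel with bounded support\<close>

lemma has_derivative_of_quadratic_bound:
  assumes "bounded_linear D" and "\<And>v. norm (f (x + v) - f x - D v) \<le> K * (norm v)\<^sup>2"
  shows "(f has_derivative D) (at x)"
  unfolding has_derivative_at
proof (intro conjI assms(1))
  have "((\<lambda>h. norm (f (x + h) - f x - D h) / norm h) \<longlongrightarrow> 0) (at 0)"
  proof (rule Lim_null_comparison)
    show "\<forall>\<^sub>F h in at 0. norm (norm (f (x + h) - f x - D h) / norm h) \<le> K * norm h"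
      unfolding eventually_at_filter
      using assms(2) by (intro always_eventually) (auto simp: divide_simps power2_eq_square mult.assoc)
    show "((\<lambda>h. K * norm h) \<longlongrightarrow> 0) (at 0)"
      by (auto intro!: tendsto_eq_intros)
  qed
  then show "(\<lambda>h. norm (f (x + h) - f x - D h) / norm h) \<midarrow>0\<rightarrow> 0" .
qed

text \<open>The power x ^ m in the denominator closes the family under differentiation: the
  derivative at index m is a combination of the members m + 1 and m + 2. Smoothness is then an
  induction on the order with m arbitrary.\<close>

definition bump_fun :: "nat \<Rightarrow> real \<Rightarrow> real"
  where "bump_fun m x = (if 0 < x then exp (- 1 / x) / x ^ m else 0)"

lemma bump_fun_nonneg: "0 \<le> bump_fun m x"
  by (simp add: bump_fun_def)

text \<open>The single term of degree m + 2 of the exponential series at 1 / x already beats the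
  denominator by two orders, which is what a vanishing derivative at the origin requires.\<close>

lemma bump_fun_quadratic: "bump_fun m x \<le> fact (m + 2) * x\<^sup>2"
proof (cases "0 < x")
  case True
  have "(1 / x) ^ (m + 2) / fact (m + 2) \<le> exp (1 / x)"
    using True sum_le_suminf[OF summable_exp_generic[of "1 / x"], of "{m + 2}"]
    by (simp add: exp_def divide_inverse mult.commute)
  then have "(1 / x) ^ (m + 2) \<le> exp (1 / x) * fact (m + 2)"
    by (simp only: pos_divide_le_eq fact_gt_zero)
  then have "(1 / x) ^ (m + 2) * x ^ (m + 2) \<le> exp (1 / x) * fact (m + 2) * x ^ (m + 2)"
    using True by (intro mult_right_mono) auto
  then have "1 \<le> exp (1 / x) * fact (m + 2) * x ^ (m + 2)"
    using True by (simp add: power_divide del: power_Suc fact_Suc)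
  then have "exp (- 1 / x) \<le> fact (m + 2) * x ^ (m + 2)"
    using True by (simp add: exp_minus divide_simps mult_ac del: power_Suc fact_Suc)
  then show ?thesis using True by (simp add: bump_fun_def divide_simps power_add mult_ac power2_eq_square)
qed (simp add: bump_fun_def)

lemma bump_fun_has_derivative:
  "(bump_fun m has_real_derivative (bump_fun (m + 2) x - m * bump_fun (m + 1) x)) (at x)"
proof -
  consider "x < 0" | "x = 0" | "x > 0" by linarith
  then show ?thesis
  proof cases
    case 1
    have "((\<lambda>x. 0) has_real_derivative 0) (at x)" by simp
    then have "(bump_fun m has_real_derivative 0) (at x)"
      by (rule DERIV_cong_ev[THEN iffD1, rotated -1, OF _ refl _ refl])
         (use 1 in \<open>auto intro!: eventually_mono[OF eventually_nhds_in_open[of "{..<0}"]] simp: bump_fun_def\<close>)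
    then show ?thesis using 1 by (simp add: bump_fun_def)
  next
    case 2
    have "(bump_fun m has_derivative (\<lambda>h. 0)) (at 0)"
      by (rule has_derivative_of_quadratic_bound[where K = "fact (m + 2)"])
         (use bump_fun_quadratic[of m] bump_fun_nonneg[of m] in \<open>auto simp: bump_fun_def[of m 0]\<close>)
    then show ?thesis using 2 by (simp add: bump_fun_def has_field_derivative_def mult_zero_left[abs_def])
  next
    case 3
    have "((\<lambda>x. exp (- 1 / x) / x ^ m) has_real_derivative
       exp (- 1 / x) / x ^ (m + 2) - m * (exp (- 1 / x) / x ^ (m + 1))) (at x)"
      using 3 by (auto intro!: derivative_eq_intros simp: divide_simps power_add power2_eq_square)
         (cases m; simp add: algebra_simps)
    then have "(bump_fun m has_real_derivative
       exp (- 1 / x) / x ^ (m + 2) - m * (exp (- 1 / x) / x ^ (m + 1))) (at x)"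
      by (rule DERIV_cong_ev[THEN iffD1, rotated -1, OF _ refl _ refl])
         (use 3 in \<open>auto intro!: eventually_mono[OF eventually_nhds_in_open[of "{0<..}"]] simp: bump_fun_def\<close>)
    then show ?thesis using 3 by (simp add: bump_fun_def)
  qed
qed

lemma C_k_bump_fun: "C_k k (bump_fun m)"
proof (induction k arbitrary: m)
  case 0
  show ?case
    using DERIV_isCont[OF bump_fun_has_derivative] by (simp add: continuous_at_imp_continuous_on)
next
  case (Suc k)
  show ?case
  proof (rule C_k_SucI)
    show "(bump_fun m has_derivative (\<lambda>h. (bump_fun (m + 2) x + (- real m) * bump_fun (m + 1) x) * h)) (at x)" for x
      using bump_fun_has_derivative[of m x] by (simp add: has_field_derivative_def)
  qed (intro C_k_mult C_k_add C_k_const Suc.IH)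
qed

lemma mollifier_exists:
  assumes "0 < \<epsilon>"
  obtains \<kappa> :: "'a::euclidean_space \<Rightarrow> real"
  where "C_inf \<kappa>" "\<And>z. 0 \<le> \<kappa> z" "\<And>z. \<epsilon> < norm z \<Longrightarrow> \<kappa> z = 0" "integrable lborel \<kappa>" "(LINT z|lborel. \<kappa> z) = 1"
proof -
  \<comment> \<open>The kernel is a product over coordinates and lives on a cube of half side
    \<delta>; by the bound of the norm through its coordinates this cube lies in the ball of radius
    \<epsilon>.\<close>
  define \<delta> where "\<delta> = \<epsilon> / DIM('a)"
  have \<delta>: "0 < \<delta>" using assms by (simp add: \<delta>_def)
  define \<kappa>0 :: "'a \<Rightarrow> real"
    where "\<kappa>0 z = (\<Prod>b\<in>Basis. bump_fun 0 (\<delta> + z \<bullet> (- b)) * bump_fun 0 (\<delta> + z \<bullet> b))" for z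
  have C: "C_k k \<kappa>0" for k
    unfolding \<kappa>0_def[abs_def]
    by (intro C_k_prod C_k_mult C_k_affine C_k_bump_fun bounded_linear_inner_left) auto
  have nonneg: "0 \<le> \<kappa>0 z" for z
    unfolding \<kappa>0_def by (intro prod_nonneg) (simp add: bump_fun_nonneg)
  have supp: "\<kappa>0 z = 0" if "\<epsilon> < norm z" for z
  proof (rule ccontr)
    assume "\<kappa>0 z \<noteq> 0"
    then have "\<bar>z \<bullet> b\<bar> \<le> \<delta>" if "b \<in> Basis" for b
      using that unfolding \<kappa>0_def by (force simp: bump_fun_def split: if_splits)
    then have "norm z \<le> (\<Sum>b\<in>(Basis::'a set). \<delta>)"
      by (intro order_trans[OF norm_le_l1] sum_mono)
    then show False using that by (simp add: \<delta>_def)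
  qed
  have cont: "continuous_on UNIV \<kappa>0" using C[of 0] by simp
  then have [measurable]: "\<kappa>0 \<in> borel_measurable borel" by (rule borel_measurable_continuous_onI)
  have int: "integrable lborel \<kappa>0"
  proof -
    have "integrable lborel (\<lambda>z. indicator (cball 0 \<epsilon>) z *\<^sub>R \<kappa>0 z)"
      by (intro borel_integrable_compact continuous_on_subset[OF cont]) auto
    moreover have "(\<lambda>z. indicator (cball 0 \<epsilon>) z *\<^sub>R \<kappa>0 z) = \<kappa>0"
      using supp by (auto simp: indicator_def fun_eq_iff)
    ultimately show ?thesis by simp
  qed
  define I where "I = (LINT z|lborel. \<kappa>0 z)"
  \<comment> \<open>The product does not vanish anywhere on the open cube of half side \<delta>,
    whose measure is positive, so a vanishing integral is impossible.\<close>
  have "I \<noteq> 0"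
  proof
    assume "I = 0"
    then have ae: "AE z in lborel. \<kappa>0 z = 0"
      using integral_nonneg_eq_0_iff_AE[OF int] nonneg unfolding I_def by auto
    define u :: 'a where "u = \<delta> *\<^sub>R One"
    have u: "u \<bullet> b = \<delta>" if "b \<in> Basis" for b using that by (simp add: u_def)
    have ne: "\<kappa>0 z \<noteq> 0" if "z \<in> box (- u) u" for z
      using that u unfolding \<kappa>0_def by (auto simp: bump_fun_def mem_box)
    have "AE z in lborel. z \<notin> box (- u) u"
      using ae by (rule eventually_mono) (use ne in blast)
    then have "emeasure lborel (box (- u) u) = 0"
      by (subst (asm) AE_iff_measurable[OF _ refl]) auto
    moreover have "emeasure lborel (box (- u) u) = ennreal (\<Prod>b\<in>(Basis::'a set). 2 * \<delta>)"
      by (subst emeasure_lborel_box)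
        (use \<delta> u in \<open>auto simp: inner_diff_left inner_add_left simp del: prod_constant intro!: arg_cong[of _ _ ennreal] prod.cong\<close>)
    moreover have "0 < (\<Prod>b\<in>(Basis::'a set). 2 * \<delta>)" using \<delta> by (intro prod_pos) auto
    ultimately show False by (metis ennreal_eq_0_iff not_less)
  qed
  moreover have "0 \<le> I" unfolding I_def using nonneg by simp
  ultimately have I: "0 < I" by simp
  show ?thesis
  proof (rule that[of "\<lambda>z. \<kappa>0 z * (1 / I)"])
    show "C_inf (\<lambda>z. \<kappa>0 z * (1 / I))"
      unfolding C_inf_def by (intro allI C_k_mult C C_k_const)
    show "(LINT z|lborel. \<kappa>0 z * (1 / I)) = 1"
      using I by (simp add: I_def)
  qed (use nonneg supp I int in auto)
qed

section \<open>Derivative bounds under bounded support\<close>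

lemma C_infD:
  assumes "C_inf \<phi>"
  shows "(\<phi> has_derivative frechet_derivative \<phi> (at x)) (at x)"
    and "C_inf (\<lambda>x. frechet_derivative \<phi> (at x) h)"
    and "continuous_on S \<phi>"
proof -
  have C: "C_k k \<phi>" for k using assms by (simp add: C_inf_def)
  show "(\<phi> has_derivative frechet_derivative \<phi> (at x)) (at x)"
    by (rule C_k_differentiable[OF C])
  show "C_inf (\<lambda>x. frechet_derivative \<phi> (at x) h)"
    unfolding C_inf_def using C[of "Suc k" for k] by simp
  show "continuous_on S \<phi>" using C[of 0] continuous_on_subset by auto
qed

lemma C_inf_linear_deriv: "C_inf \<phi> \<Longrightarrow> linear (frechet_derivative \<phi> (at x))"
  using C_infD(1) has_derivative_linear by blast

lemma bounded_support_deriv: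
  assumes "bounded_support \<phi>"
  shows "bounded_support (\<lambda>x. frechet_derivative \<phi> (at x) h)"
proof -
  obtain R where R: "\<And>x. R < norm x \<Longrightarrow> \<phi> x = 0" using assms unfolding bounded_support_def by blast
  have "frechet_derivative \<phi> (at x) h = 0" if "R < norm x" for x
  proof -
    have 0: "((\<lambda>x. 0) has_derivative (\<lambda>h. 0)) (at x)" by simp
    have "open {x::'a. R < norm x}" by (intro open_Collect_less continuous_intros)
    then have "(\<phi> has_derivative (\<lambda>h. 0)) (at x)"
      by (rule has_derivative_transform_within_open[OF 0]) (use that R in auto)
    then show ?thesis using frechet_derivative_at by metis
  qed
  then show ?thesis unfolding bounded_support_def by blast
qed

lemma bounded_support_bounded:
  fixes \<phi> :: "'a::euclidean_space \<Rightarrow> real"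
  assumes "continuous_on UNIV \<phi>" "bounded_support \<phi>"
  obtains B where "\<And>x. \<bar>\<phi> x\<bar> \<le> B"
proof -
  obtain R where R: "\<And>x. R < norm x \<Longrightarrow> \<phi> x = 0" using assms unfolding bounded_support_def by blast
  have "bounded (\<phi> ` cball 0 R)"
    using assms(1) by (intro compact_imp_bounded compact_continuous_image)
      (auto intro: continuous_on_subset)
  then obtain B where "\<forall>x\<in>cball 0 R. \<bar>\<phi> x\<bar> \<le> B" unfolding bounded_iff by auto
  then have B: "\<bar>\<phi> x\<bar> \<le> B" if "norm x \<le> R" for x using that by simp
  have "\<bar>\<phi> x\<bar> \<le> max 0 B" for x using B[of x] R[of x] by (cases "norm x \<le> R") auto
  then show ?thesis by (rule that)
qed

lemma bounded_support_integrable: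
  fixes \<phi> :: "'a::euclidean_space \<Rightarrow> real"
  assumes "continuous_on UNIV \<phi>" "bounded_support \<phi>"
  shows "integrable lborel \<phi>"
proof -
  obtain R where R: "\<And>x. R < norm x \<Longrightarrow> \<phi> x = 0" using assms unfolding bounded_support_def by blast
  have "integrable lborel (\<lambda>z. indicator (cball 0 R) z *\<^sub>R \<phi> z)"
    by (intro borel_integrable_compact continuous_on_subset[OF assms(1)]) auto
  moreover have "(\<lambda>z. indicator (cball 0 R) z *\<^sub>R \<phi> z) = \<phi>"
    using R by (auto simp: indicator_def fun_eq_iff)
  ultimately show ?thesis by simp
qed

lemma linear_basis_bound:
  fixes D :: "'a::euclidean_space \<Rightarrow> real"
  assumes "linear D" and "\<And>b. b \<in> Basis \<Longrightarrow> \<bar>D b\<bar> \<le> B b"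
  shows "\<bar>D v\<bar> \<le> (\<Sum>b\<in>Basis. B b) * norm v"
proof -
  have "D v = (\<Sum>b\<in>Basis. (v \<bullet> b) * D b)"
    using Linear_Algebra.linear_componentwise[OF assms(1), of v 1] by simp
  also have "\<bar>\<dots>\<bar> \<le> (\<Sum>b\<in>Basis. norm v * B b)"
    using assms(2) Basis_le_norm[of _ v]
    by (intro order_trans[OF sum_abs] sum_mono) (auto simp: abs_mult intro!: mult_mono)
  finally show ?thesis by (simp add: sum_distrib_left mult.commute)
qed

lemma C_inf_deriv_bounded:
  fixes \<phi> :: "'a::euclidean_space \<Rightarrow> real"
  assumes "C_inf \<phi>" "bounded_support \<phi>"
  obtains K where "0 \<le> K" "\<And>x v. \<bar>frechet_derivative \<phi> (at x) v\<bar> \<le> K * norm v"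
proof -
  have "\<exists>B. \<forall>x. \<bar>frechet_derivative \<phi> (at x) b\<bar> \<le> B" for b
    using bounded_support_bounded[OF C_infD(3)[OF C_infD(2)[OF assms(1)]] bounded_support_deriv[OF assms(2)], of b] by metis
  then obtain B where B: "\<And>b x. \<bar>frechet_derivative \<phi> (at x) b\<bar> \<le> B b" by metis
  have "\<bar>frechet_derivative \<phi> (at x) v\<bar> \<le> (\<Sum>b\<in>Basis. B b) * norm v" for x v
    by (rule linear_basis_bound[OF C_inf_linear_deriv[OF assms(1)] B])
  moreover have "0 \<le> B b" for b using B[of _ b] abs_ge_zero order_trans by blast
  ultimately show ?thesis using that by (meson sum_nonneg)
qed

lemma lipschitz_of_deriv_bound:
  fixes \<phi> :: "'a::euclidean_space \<Rightarrow> real"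
  assumes "\<And>x. (\<phi> has_derivative D x) (at x)" "\<And>x v. \<bar>D x v\<bar> \<le> K * norm v"
  shows "\<bar>\<phi> x - \<phi> y\<bar> \<le> K * norm (x - y)"
proof -
  have "norm (\<phi> x - \<phi> y) \<le> K * norm (x - y)"
    by (rule differentiable_bound[where S = UNIV and f' = D])
       (use assms in \<open>auto intro!: onorm_le\<close>)
  then show ?thesis by simp
qed

lemma C_inf_deriv_lipschitz:
  fixes \<phi> :: "'a::euclidean_space \<Rightarrow> real"
  assumes "C_inf \<phi>" "bounded_support \<phi>"
  obtains K where "0 \<le> K"
    "\<And>x y v. \<bar>frechet_derivative \<phi> (at x) v - frechet_derivative \<phi> (at y) v\<bar> \<le> K * norm (x - y) * norm v"
proof -
  have "\<exists>B\<ge>0. \<forall>x y. \<bar>frechet_derivative \<phi> (at x) b - frechet_derivative \<phi> (at y) b\<bar> \<le> B * norm (x - y)" for b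
  proof -
    note 1 = C_infD(2)[OF assms(1), of b]
    obtain K where "0 \<le> K" "\<And>x v. \<bar>frechet_derivative (\<lambda>x. frechet_derivative \<phi> (at x) b) (at x) v\<bar> \<le> K * norm v"
      using C_inf_deriv_bounded[OF 1 bounded_support_deriv[OF assms(2)]] by metis
    with lipschitz_of_deriv_bound[OF C_infD(1)[OF 1]] show ?thesis by blast
  qed
  then obtain B where B: "\<And>b. 0 \<le> B b"
    "\<And>b x y. \<bar>frechet_derivative \<phi> (at x) b - frechet_derivative \<phi> (at y) b\<bar> \<le> B b * norm (x - y)" by metis
  have "\<bar>frechet_derivative \<phi> (at x) v - frechet_derivative \<phi> (at y) v\<bar> \<le> (\<Sum>b\<in>Basis. B b) * norm (x - y) * norm v" for x y v
    using linear_basis_bound[OF linear_compose_sub[OF C_inf_linear_deriv[OF assms(1), of x] C_inf_linear_deriv[OF assms(1), of y]],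
       of "\<lambda>b. B b * norm (x - y)"] B(2) by (simp add: sum_distrib_right)
  moreover have "0 \<le> (\<Sum>b\<in>(Basis::'a set). B b)" using B(1) by (simp add: sum_nonneg)
  ultimately show ?thesis using that by blast
qed

text \<open>Mean value inequality for y \<mapsto> \<phi> y - D x y on the ball of radius |v| about
  x, where the derivative of this function has norm at most K |v|.\<close>

lemma taylor_quadratic:
  fixes \<phi> :: "'a::euclidean_space \<Rightarrow> real"
  assumes D: "\<And>x. (\<phi> has_derivative D x) (at x)"
    and K: "\<And>x y v. \<bar>D x v - D y v\<bar> \<le> K * norm (x - y) * norm v" "0 \<le> K"
  shows "\<bar>\<phi> (x + v) - \<phi> x - D x v\<bar> \<le> K * (norm v)\<^sup>2"
proof -
  have bl: "bounded_linear (D x)" using D by (rule has_derivative_bounded_linear)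
  have "norm ((\<lambda>y. \<phi> y - D x y) (x + v) - (\<lambda>y. \<phi> y - D x y) x) \<le> (K * norm v) * norm ((x + v) - x)"
  proof (rule differentiable_bound[where S = "cball x (norm v)" and f' = "\<lambda>y h. D y h - D x h"])
    fix y assume y: "y \<in> cball x (norm v)"
    show "((\<lambda>y. \<phi> y - D x y) has_derivative (\<lambda>h. D y h - D x h)) (at y within cball x (norm v))"
      by (intro has_derivative_diff has_derivative_at_withinI[OF D] bounded_linear_imp_has_derivative bl)
    show "onorm (\<lambda>h. D y h - D x h) \<le> K * norm v"
    proof (rule onorm_le)
      fix h
      have "\<bar>D y h - D x h\<bar> \<le> K * norm (y - x) * norm h" by (rule K(1))
      also have "\<dots> \<le> K * norm v * norm h"
        using y K(2) by (intro mult_right_mono mult_left_mono) (auto simp: dist_norm norm_minus_commute)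
      finally show "norm (D y h - D x h) \<le> K * norm v * norm h" by simp
    qed
  qed (auto simp: dist_norm)
  moreover have "D x (x + v) = D x x + D x v" using bl by (simp add: linear_simps)
  ultimately show ?thesis by (simp add: power2_eq_square algebra_simps)
qed

section \<open>Convolution with a smooth kernel\<close>

definition fun_convolution :: "('a::euclidean_space \<Rightarrow> real) \<Rightarrow> ('a \<Rightarrow> real) \<Rightarrow> 'a \<Rightarrow> real"
  where "fun_convolution \<phi> \<kappa> x = (LINT y|lborel. \<phi> y * \<kappa> (x - y))"

lemma fun_convolution_integrable:
  fixes \<phi> \<kappa> :: "'a::euclidean_space \<Rightarrow> real"
  assumes \<phi>: "integrable lborel \<phi>" and \<kappa>: "continuous_on UNIV \<kappa>" "bounded_support \<kappa>"
  shows "integrable lborel (\<lambda>y. \<phi> y * \<kappa> (x - y))"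
proof -
  obtain B where B: "\<And>x. \<bar>\<kappa> x\<bar> \<le> B" using bounded_support_bounded[OF \<kappa>] by blast
  have [measurable]: "\<kappa> \<in> borel_measurable borel" using \<kappa>(1) by (rule borel_measurable_continuous_onI)
  have [measurable]: "\<phi> \<in> borel_measurable borel" using borel_measurable_integrable[OF \<phi>] by simp
  show ?thesis
    by (rule Bochner_Integration.integrable_bound[of _ "\<lambda>y. \<bar>\<phi> y\<bar> * B"])
       (use \<phi> B in \<open>auto simp: abs_mult intro!: mult_left_mono order_trans[OF B] \<close>)
qed

text \<open>The Taylor remainder of \<kappa> is quadratic in v uniformly in the base point, so it
  can be integrated against |\<phi>|. The derivative is again a convolution, now with a directional
  derivative of \<kappa>, which is what lets smoothness follow by induction.\<close>

lemma fun_convolution_has_derivative: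
  fixes \<phi> \<kappa> :: "'a::euclidean_space \<Rightarrow> real"
  assumes \<phi>: "integrable lborel \<phi>" and \<kappa>: "C_inf \<kappa>" "bounded_support \<kappa>"
  shows "(fun_convolution \<phi> \<kappa> has_derivative (\<lambda>h. fun_convolution \<phi> (\<lambda>z. frechet_derivative \<kappa> (at z) h) x)) (at x)"
proof -
  obtain K where K: "0 \<le> K" "\<And>x y v. \<bar>frechet_derivative \<kappa> (at x) v - frechet_derivative \<kappa> (at y) v\<bar> \<le> K * norm (x - y) * norm v"
    using C_inf_deriv_lipschitz[OF \<kappa>] by blast
  let ?D = "\<lambda>h z. frechet_derivative \<kappa> (at z) h"
  note int = fun_convolution_integrable[OF \<phi> C_infD(3)[OF \<kappa>(1)] \<kappa>(2)]
  note intD = fun_convolution_integrable[OF \<phi> C_infD(3)[OF C_infD(2)[OF \<kappa>(1)]] bounded_support_deriv[OF \<kappa>(2)]]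
  note lin = C_inf_linear_deriv[OF \<kappa>(1)]
  show ?thesis
  proof (rule has_derivative_of_quadratic_bound)
    have "linear (\<lambda>h. fun_convolution \<phi> (?D h) x)"
      using intD[of x]
      by (intro linearI) (simp_all add: fun_convolution_def linear_add[OF lin] linear_scale[OF lin] distrib_left mult.left_commute)
    then show "bounded_linear (\<lambda>h. fun_convolution \<phi> (?D h) x)" by (rule linear_linear[THEN iffD2])
  next
    fix v
    have "fun_convolution \<phi> \<kappa> (x + v) - fun_convolution \<phi> \<kappa> x - fun_convolution \<phi> (?D v) x =
       (LINT y|lborel. \<phi> y * (\<kappa> ((x - y) + v) - \<kappa> (x - y) - ?D v (x - y)))"
      using int[of "x + v"] int[of x] intD[of x v] unfolding fun_convolution_def
      by (simp add: right_diff_distrib add_diff_eq[symmetric] diff_add_eq)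
    also have "norm \<dots> \<le> (LINT y|lborel. \<bar>\<phi> y\<bar> * (K * (norm v)\<^sup>2))"
    proof (rule Bochner_Integration.integral_norm_bound_integral)
      show "integrable lborel (\<lambda>y. \<phi> y * (\<kappa> ((x - y) + v) - \<kappa> (x - y) - ?D v (x - y)))"
        using int[of "x + v"] int[of x] intD[of x v]
        by (simp add: right_diff_distrib diff_add_eq)
      show "norm (\<phi> y * (\<kappa> ((x - y) + v) - \<kappa> (x - y) - ?D v (x - y))) \<le> \<bar>\<phi> y\<bar> * (K * (norm v)\<^sup>2)" for y
        using taylor_quadratic[OF C_infD(1)[OF \<kappa>(1)] K(2,1), of "x - y" v]
        by (auto simp: abs_mult intro!: mult_left_mono)
    qed (use \<phi> in auto)
    also have "\<dots> = (LINT y|lborel. \<bar>\<phi> y\<bar>) * K * (norm v)\<^sup>2" by simp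
    finally show "norm (fun_convolution \<phi> \<kappa> (x + v) - fun_convolution \<phi> \<kappa> x - fun_convolution \<phi> (?D v) x) \<le> (LINT y|lborel. \<bar>\<phi> y\<bar>) * K * (norm v)\<^sup>2" .
  qed
qed

lemma C_inf_fun_convolution:
  fixes \<phi> \<kappa> :: "'a::euclidean_space \<Rightarrow> real"
  assumes \<phi>: "integrable lborel \<phi>" and \<kappa>: "C_inf \<kappa>" "bounded_support \<kappa>"
  shows "C_inf (fun_convolution \<phi> \<kappa>)"
proof -
  have "C_k k (fun_convolution \<phi> \<kappa>)" for k
    using \<kappa>
  proof (induction k arbitrary: \<kappa>)
    case 0
    show ?case
      using has_derivative_continuous[OF fun_convolution_has_derivative[OF \<phi> 0]] by (simp add: continuous_at_imp_continuous_on)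
  next
    case (Suc k)
    show ?case
      by (rule C_k_SucI[OF fun_convolution_has_derivative[OF \<phi> Suc.prems]])
         (intro Suc.IH C_infD(2) bounded_support_deriv Suc.prems)
  qed
  then show ?thesis by (simp add: C_inf_def)
qed

lemma bounded_support_fun_convolution:
  assumes "bounded_support \<phi>" "bounded_support \<kappa>"
  shows "bounded_support (fun_convolution \<phi> \<kappa>)"
proof -
  obtain R where R: "\<And>x. R < norm x \<Longrightarrow> \<phi> x = 0" using assms unfolding bounded_support_def by blast
  obtain R' where R': "\<And>x. R' < norm x \<Longrightarrow> \<kappa> x = 0" using assms unfolding bounded_support_def by blast
  have "fun_convolution \<phi> \<kappa> x = 0" if "R + R' < norm x" for x
  proof -
    have "(\<lambda>y. \<phi> y * \<kappa> (x - y)) = (\<lambda>y. 0)"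
    proof
      fix y show "\<phi> y * \<kappa> (x - y) = 0" using R[of y] R'[of "x - y"] norm_triangle_sub[of x y] that by (cases "R < norm y") auto
    qed
    then show ?thesis unfolding fun_convolution_def by (simp only: Bochner_Integration.integral_zero)
  qed
  then show ?thesis unfolding bounded_support_def by blast
qed

lemma fun_convolution_commute:
  fixes \<phi> \<kappa> :: "'a::euclidean_space \<Rightarrow> real"
  assumes [measurable]: "\<phi> \<in> borel_measurable borel" "\<kappa> \<in> borel_measurable borel"
  shows "fun_convolution \<phi> \<kappa> x = (LINT z|lborel. \<phi> (x - z) * \<kappa> z)"
proof -
  have "fun_convolution \<phi> \<kappa> x = (LINT y|distr lborel borel (\<lambda>z. x + (- 1) *\<^sub>R z). \<phi> y * \<kappa> (x - y))"
    unfolding fun_convolution_def using lborel_affine[of "- 1" x] by (simp add: density_1)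
  also have "\<dots> = (LINT z|lborel. \<phi> (x - z) * \<kappa> z)"
    by (subst integral_distr) (use assms in \<open>auto simp: borel_measurable_times\<close>)
  finally show ?thesis .
qed

subsection \<open>Weak solutions tested with smooth observables\<close>

lemma lebesgue_on_integral_eq:
  fixes h :: "real \<Rightarrow> 'a::euclidean_space"
  assumes "integrable (lebesgue_on {a..b}) h"
  shows "(LINT r|lebesgue_on {a..b}. h r) = integral {a..b} h"
  using assms by (intro lebesgue_integral_eq_integral) auto

lemma lebesgue_on_integrable_sub:
  fixes h :: "real \<Rightarrow> 'a::euclidean_space"
  assumes "integrable (lebesgue_on {a..b}) h" "a \<le> s" "t \<le> b"
  shows "integrable (lebesgue_on {s..t}) h"
  by (rule integrable_subinterval[OF assms(1)]) (use assms in auto)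

lemma lebesgue_on_integral_combine:
  fixes h :: "real \<Rightarrow> 'a::euclidean_space"
  assumes h: "integrable (lebesgue_on {a..b}) h" and st: "a \<le> r" "r \<le> s" "s \<le> t" "t \<le> b"
  shows "(LINT r|lebesgue_on {r..t}. h r) = (LINT r|lebesgue_on {r..s}. h r) + (LINT r|lebesgue_on {s..t}. h r)"
  by (rule integral_combine[OF lebesgue_on_integrable_sub[OF h] st(2,3)]) (use st in auto)

lemma continuous_on_lebesgue_primitive:
  fixes h :: "real \<Rightarrow> 'a::euclidean_space"
  assumes h: "integrable (lebesgue_on {a..b}) h"
  shows "continuous_on {a..b} (\<lambda>t. LINT r|lebesgue_on {a..t}. h r)"
proof -
  have "continuous_on {a..b} (\<lambda>t. integral {a..t} h)"
    by (rule indefinite_integral_continuous_1) (use integrable_on_lebesgue_on[OF h] in auto)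
  then show ?thesis
    by (rule continuous_on_eq) (simp add: lebesgue_on_integral_eq lebesgue_on_integrable_sub[OF h])
qed

text \<open>The primitive of the density carries all that is used of absolute continuity:
  compactness makes it a uniform modulus, and its differences telescope along partitions, also after
  a change of time.\<close>

lemma ac_curve_modulus:
  assumes "ac_curve S \<nu>" "0 \<le> S"
  obtains H where "continuous_on {0..S} H"
    "\<And>s t. 0 \<le> s \<Longrightarrow> s \<le> t \<Longrightarrow> t \<le> S \<Longrightarrow> W1 (\<nu> s) (\<nu> t) \<le> H t - H s"
proof -
  obtain h where h: "integrable (lebesgue_on {0..S}) h"
    "\<And>s t. 0 \<le> s \<Longrightarrow> s \<le> t \<Longrightarrow> t \<le> S \<Longrightarrow> W1 (\<nu> s) (\<nu> t) \<le> (LINT r|lebesgue_on {s..t}. h r)"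
    using assms(1) unfolding ac_curve_def by blast
  show ?thesis
  proof (rule that[OF continuous_on_lebesgue_primitive[OF h(1)]])
    fix s t :: real assume st: "0 \<le> s" "s \<le> t" "t \<le> S"
    show "W1 (\<nu> s) (\<nu> t) \<le> (LINT r|lebesgue_on {0..t}. h r) - (LINT r|lebesgue_on {0..s}. h r)"
      using h(2)[OF st] lebesgue_on_integral_combine[OF h(1) _ st(1,2,3)] by simp
  qed
qed

lemma ac_curve_uniform:
  assumes "ac_curve S \<nu>" "0 \<le> S" "0 < e"
  obtains d where "0 < d" "\<And>s t. s \<in> {0..S} \<Longrightarrow> t \<in> {0..S} \<Longrightarrow> \<bar>s - t\<bar> < d \<Longrightarrow> W1 (\<nu> s) (\<nu> t) < e"
proof -
  obtain H where H: "continuous_on {0..S} H"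
    "\<And>s t. 0 \<le> s \<Longrightarrow> s \<le> t \<Longrightarrow> t \<le> S \<Longrightarrow> W1 (\<nu> s) (\<nu> t) \<le> H t - H s"
    using ac_curve_modulus[OF assms(1,2)] by blast
  have "uniformly_continuous_on {0..S} H"
    using H(1) by (rule compact_uniformly_continuous) auto
  then obtain d where d: "0 < d" "\<And>s t. s \<in> {0..S} \<Longrightarrow> t \<in> {0..S} \<Longrightarrow> \<bar>s - t\<bar> < d \<Longrightarrow> \<bar>H s - H t\<bar> < e"
    using assms(3) unfolding uniformly_continuous_on_def dist_real_def by metis
  show ?thesis
  proof (rule that[OF d(1)])
    fix s t :: real assume st: "s \<in> {0..S}" "t \<in> {0..S}" "\<bar>s - t\<bar> < d"
    consider "s \<le> t" | "t \<le> s" by linarith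
    then show "W1 (\<nu> s) (\<nu> t) < e"
    proof cases
      case 1 then show ?thesis using d(2)[OF st] H(2)[of s t] st by auto
    next
      case 2 then show ?thesis using d(2)[OF st] H(2)[of t s] st by (simp add: W1_commute[of "\<nu> s"])
    qed
  qed
qed

lemma ac_curve_P1: "ac_curve S \<nu> \<Longrightarrow> t \<in> {0..S} \<Longrightarrow> \<nu> t \<in> P1"
  by (simp add: ac_curve_def)

lemma W1_continuous_imp_continuous_on:
  fixes P :: "real \<Rightarrow> real"
  assumes "ac_curve S \<nu>" "0 \<le> S" "0 \<le> K"
    and "\<And>r s. r \<in> {0..S} \<Longrightarrow> s \<in> {0..S} \<Longrightarrow> \<bar>P r - P s\<bar> \<le> K * W1 (\<nu> r) (\<nu> s)"
  shows "continuous_on {0..S} P"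
  unfolding continuous_on_iff
proof (intro ballI allI impI)
  fix s e :: real assume s: "s \<in> {0..S}" and e: "0 < e"
  \<comment> \<open>The denominator is K + 1 because K may be zero.\<close>
  obtain d where d: "0 < d" "\<And>s t. s \<in> {0..S} \<Longrightarrow> t \<in> {0..S} \<Longrightarrow> \<bar>s - t\<bar> < d \<Longrightarrow> W1 (\<nu> s) (\<nu> t) < e / (K + 1)"
    by (rule ac_curve_uniform[OF assms(1,2), of "e / (K + 1)"]) (use e assms(3) in auto)
  have "dist (P r) (P s) < e" if "r \<in> {0..S}" "dist r s < d" for r
  proof -
    have w: "W1 (\<nu> r) (\<nu> s) < e / (K + 1)" using d(2)[OF that(1) s] that(2) by (simp add: dist_real_def)
    have "0 \<le> W1 (\<nu> r) (\<nu> s)" using that(1) s assms(1) by (intro W1_nonneg) (auto intro: ac_curve_P1)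
    then have "K * W1 (\<nu> r) (\<nu> s) \<le> (K + 1) * W1 (\<nu> r) (\<nu> s)" by (simp add: distrib_right)
    also have "\<dots> < e" using w assms(3) by (simp add: pos_less_divide_eq mult.commute)
    finally show ?thesis using assms(4)[OF that(1) s] by (simp add: dist_real_def)
  qed
  then show "\<exists>d>0. \<forall>r\<in>{0..S}. dist r s < d \<longrightarrow> dist (P r) (P s) < e" using d(1) by blast
qed

text \<open>Separated functions are enough: with them the weak equation says that the derivative of
  t \<mapsto> \<integral>\<psi> d\<nu>_t, in the sense of distributions, is the pairing of \<psi>
  with the velocity.\<close>

lemma product_test_function:
  fixes \<psi> :: "real ^ 'n \<Rightarrow> real"
  assumes \<eta>: "C_inf \<eta>" "\<And>t. t \<notin> {a..b} \<Longrightarrow> \<eta> t = 0" "0 < a" "b < S"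
    and \<psi>: "C_inf \<psi>" "bounded_support \<psi>"
  shows "(\<lambda>z. \<eta> (fst z) * \<psi> (snd z)) \<in> test_functions S"
    and "frechet_derivative (\<lambda>z. \<eta> (fst z) * \<psi> (snd z)) (at (t, x)) (1, v) =
      frechet_derivative \<eta> (at t) 1 * \<psi> x + \<eta> t * frechet_derivative \<psi> (at x) v"
proof -
  obtain R where R: "\<And>x. R < norm x \<Longrightarrow> \<psi> x = 0" using \<psi>(2) unfolding bounded_support_def by blast
  have *: "C_k k (\<lambda>z :: real \<times> (real ^ 'n). \<eta> (0 + fst z) * \<psi> (0 + snd z))" for k
    using \<eta>(1) \<psi>(1) unfolding C_inf_def
    by (intro C_k_mult C_k_affine[OF bounded_linear_fst, of _ \<eta> 0] C_k_affine[OF bounded_linear_snd, of _ \<psi> 0]) auto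
  show "(\<lambda>z. \<eta> (fst z) * \<psi> (snd z)) \<in> test_functions S"
    unfolding test_functions_def
  proof (intro CollectI conjI exI[of _ "{a..b} \<times> cball (0 :: real ^ 'n) R"] allI impI)
    show "compact ({a..b} \<times> cball (0 :: real ^ 'n) R)" by (intro compact_Times) auto
    show "{a..b} \<times> cball 0 R \<subseteq> {0<..<S} \<times> (UNIV :: (real ^ 'n) set)" using \<eta>(3,4) by auto
    show "\<eta> (fst z) * \<psi> (snd z) = 0" if "z \<notin> {a..b} \<times> cball 0 R" for z
      using that \<eta>(2)[of "fst z"] R[of "snd z"] by (cases z) (auto simp: not_le)
  qed (use * in simp)
  have 1: "((\<lambda>z :: real \<times> (real ^ 'n). \<eta> (fst z)) has_derivative (\<lambda>h. frechet_derivative \<eta> (at t) (fst h))) (at (t, x))"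
    by (rule has_derivative_compose[OF has_derivative_fst[OF has_derivative_ident]]) (simp add: C_infD(1)[OF \<eta>(1)])
  have 2: "((\<lambda>z :: real \<times> (real ^ 'n). \<psi> (snd z)) has_derivative (\<lambda>h. frechet_derivative \<psi> (at x) (snd h))) (at (t, x))"
    by (rule has_derivative_compose[OF has_derivative_snd[OF has_derivative_ident]]) (simp add: C_infD(1)[OF \<psi>(1)])
  show "frechet_derivative (\<lambda>z. \<eta> (fst z) * \<psi> (snd z)) (at (t, x)) (1, v) =
      frechet_derivative \<eta> (at t) 1 * \<psi> x + \<eta> t * frechet_derivative \<psi> (at x) v"
    by (subst frechet_derivative_at[OF has_derivative_mult[OF 1 2], symmetric]) simp
qed

text \<open>A smoothed indicator of [s, s'] differentiates to two opposite bumps at s and s'. Used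
  as a cutoff in time it turns the weak equation into a comparison of averages around these two
  times.\<close>

lemma fun_convolution_indicator:
  fixes \<omega> :: "real \<Rightarrow> real"
  assumes \<omega>: "C_inf \<omega>" "bounded_support \<omega>" and "s \<le> s'"
  shows "C_inf (fun_convolution (indicator {s..s'}) \<omega>)"
    and "frechet_derivative (fun_convolution (indicator {s..s'}) \<omega>) (at t) 1 = \<omega> (t - s) - \<omega> (t - s')"
proof -
  have i: "integrable lborel (indicator {s..s'} :: real \<Rightarrow> real)"
    by (intro integrable_real_indicator) (auto simp: emeasure_lborel_Icc_eq)
  show "C_inf (fun_convolution (indicator {s..s'}) \<omega>)" by (rule C_inf_fun_convolution[OF i \<omega>])
  have "frechet_derivative (fun_convolution (indicator {s..s'}) \<omega>) (at t) 1 =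
     (LINT y|lborel. indicator {s..s'} y * frechet_derivative \<omega> (at (t - y)) 1)"
    by (simp add: frechet_derivative_at[OF fun_convolution_has_derivative[OF i \<omega>], symmetric] fun_convolution_def)
  also have "\<dots> = (- \<omega> (t - s')) - (- \<omega> (t - s))"
  proof -
    have D: "((\<lambda>y. - \<omega> (t - y)) has_real_derivative frechet_derivative \<omega> (at (t - y)) 1) (at y)" for y
    proof -
      have "(\<omega> has_derivative frechet_derivative \<omega> (at (t - y))) (at (t - y))" by (rule C_infD(1)[OF \<omega>(1)])
      moreover have "frechet_derivative \<omega> (at (t - y)) = (*) (frechet_derivative \<omega> (at (t - y)) 1)"
      proof
        fix h show "frechet_derivative \<omega> (at (t - y)) h = frechet_derivative \<omega> (at (t - y)) 1 * h"
          using linear_scale[OF C_inf_linear_deriv[OF \<omega>(1), of "t - y"], of h 1] by (simp add: mult.commute)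
      qed
      ultimately have "(\<omega> has_real_derivative frechet_derivative \<omega> (at (t - y)) 1) (at (t - y))"
        by (simp add: has_field_derivative_def)
      moreover have "((\<lambda>y. t - y) has_real_derivative - 1) (at y)"
        by (auto intro!: derivative_eq_intros)
      ultimately have "((\<lambda>y. \<omega> (t - y)) has_real_derivative frechet_derivative \<omega> (at (t - y)) 1 * - 1) (at y)"
        by (rule DERIV_chain2)
      from DERIV_minus[OF this] show ?thesis by simp
    qed
    have "continuous_on UNIV (\<lambda>y. frechet_derivative \<omega> (at (t - y)) 1)"
      by (intro continuous_on_compose2[OF C_infD(3)[OF C_infD(2)[OF \<omega>(1)], of UNIV]] continuous_intros) auto
    then show ?thesis
      using integral_FTC_Icc_real[OF assms(3), of "\<lambda>y. - \<omega> (t - y)" "\<lambda>y. frechet_derivative \<omega> (at (t - y)) 1"] D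
      by (simp add: mult.commute continuous_on_eq_continuous_at)
  qed
  finally show "frechet_derivative (fun_convolution (indicator {s..s'}) \<omega>) (at t) 1 = \<omega> (t - s) - \<omega> (t - s')" by simp
qed

lemma finite_measure_lebesgue_on_Icc: "finite_measure (lebesgue_on {a..b::real})"
  by (rule finite_measure_lebesgue_on) auto

lemma lebesgue_on_integrable_const: "integrable (lebesgue_on {a..b::real}) (\<lambda>t. c)"
  by (rule finite_measure.integrable_const[OF finite_measure_lebesgue_on_Icc])

lemma lebesgue_on_integrable_bounded:
  fixes h :: "real \<Rightarrow> 'a::euclidean_space"
  assumes "h \<in> borel_measurable (lebesgue_on {a..b})" "AE t in lebesgue_on {a..b}. norm (h t) \<le> B"
  shows "integrable (lebesgue_on {a..b}) h"
  by (rule finite_measure.integrable_const_bound[OF finite_measure_lebesgue_on_Icc assms(2,1)])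

lemma mollifier_limit:
  fixes a :: "real \<Rightarrow> real"
  assumes a: "continuous_on {0..S} a" and s: "0 < s" "s < S"
    and \<delta>: "\<delta> \<longlonglongrightarrow> 0" 
    and \<omega>: "\<And>k. C_inf (\<omega> k)" "\<And>k z. 0 \<le> \<omega> k z" "\<And>k z. \<delta> k < norm z \<Longrightarrow> \<omega> k z = 0"
      "\<And>k. integrable lborel (\<omega> k)" "\<And>k. (LINT z|lborel. \<omega> k z) = 1"
    and le: "\<And>k. \<delta> k \<le> s" "\<And>k. \<delta> k \<le> S - s"
  shows "(\<lambda>k. LINT t|lebesgue_on {0..S}. \<omega> k (t - s) * a t) \<longlonglongrightarrow> a s"
proof -
  \<comment> \<open>Constant continuation beyond the interval gives a continuous function on the
    whole line. The bounds on \<delta> k keep the support of the shifted kernel inside {0..S}, so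
    the integral does not notice the change.\<close>
  define a' where "a' t = a (max 0 (min S t))" for t
  have a': "continuous_on UNIV a'"
    unfolding a'_def by (intro continuous_on_compose2[OF a] continuous_intros) (use s in auto)
  have [measurable]: "a' \<in> borel_measurable borel" using a' by (rule borel_measurable_continuous_onI)
  have [measurable]: "\<omega> k \<in> borel_measurable borel" for k
    using C_infD(3)[OF \<omega>(1)] by (rule borel_measurable_continuous_onI)
  have eq: "(LINT t|lebesgue_on {0..S}. \<omega> k (t - s) * a t) = (LINT z|lborel. \<omega> k z * a' (s + z))" for k
  proof -
    have "(LINT t|lebesgue_on {0..S}. \<omega> k (t - s) * a t) = (LINT t|lebesgue. indicator {0..S} t *\<^sub>R (\<omega> k (t - s) * a t))"
      by (rule integral_restrict_space) auto
    also have "\<dots> = (LINT t|lebesgue. \<omega> k (t - s) * a' t)"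
    proof (rule Bochner_Integration.integral_cong[OF refl])
      fix t
      have "\<omega> k (t - s) = 0" if "t \<notin> {0..S}" using that le[of k] by (intro \<omega>(3)) auto
      then show "indicator {0..S} t *\<^sub>R (\<omega> k (t - s) * a t) = \<omega> k (t - s) * a' t"
        by (cases "t \<in> {0..S}") (auto simp: a'_def)
    qed
    also have "\<dots> = (LINT t|lborel. \<omega> k (t - s) * a' t)"
      by (rule integral_completion) measurable
    also have "\<dots> = (LINT z|lborel. \<omega> k z * a' (s + z))"
      using lborel_integral_real_affine[of 1 "\<lambda>t. \<omega> k (t - s) * a' t" s] by simp
    finally show ?thesis .
  qed
  have "(\<lambda>k. LINT z|lborel. \<omega> k z * a' (s + z)) \<longlonglongrightarrow> a' s"
  proof (rule LIMSEQ_I)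
    fix e :: real assume e: "0 < e"
    obtain d where d: "0 < d" "\<And>z. \<bar>z\<bar> < d \<Longrightarrow> \<bar>a' (s + z) - a' s\<bar> < e / 2"
    proof -
      obtain d where "0 < d" "\<And>t. dist t s < d \<Longrightarrow> dist (a' t) (a' s) < e / 2"
        using a' e half_gt_zero unfolding continuous_on_iff by (metis UNIV_I)
      then show ?thesis using that[of d] by (auto simp: dist_real_def)
    qed
    obtain k0 where k0: "\<And>k. k0 \<le> k \<Longrightarrow> \<delta> k < d"
      using order_tendstoD(2)[OF \<delta> d(1)] unfolding eventually_sequentially by blast
    have "norm ((LINT z|lborel. \<omega> k z * a' (s + z)) - a' s) < e" if k: "k0 \<le> k" for k
    proof -
      have b: "\<bar>\<omega> k z * (a' (s + z) - a' s)\<bar> \<le> \<omega> k z * (e / 2)" for z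
      proof (cases "\<bar>z\<bar> < d")
        case True
        then show ?thesis
          using mult_left_mono[OF less_imp_le[OF d(2)] \<omega>(2)[of k z]] \<omega>(2)[of k z] by (simp add: abs_mult)
      next
        case False
        then show ?thesis using k0[OF k] \<omega>(3)[of k z] by simp
      qed
      have i: "integrable lborel (\<lambda>z. \<omega> k z * (a' (s + z) - a' s))"
        by (rule Bochner_Integration.integrable_bound[of _ "\<lambda>z. \<omega> k z * (e / 2)"])
           (use \<omega>(4)[of k] order_trans[OF b abs_ge_self] in auto)
      then have i': "integrable lborel (\<lambda>z. \<omega> k z * (a' (s + z) - a' s) + \<omega> k z * a' s)"
        using \<omega>(4)[of k] by (intro Bochner_Integration.integrable_add) auto
      have "(LINT z|lborel. \<omega> k z * a' (s + z)) - a' s = (LINT z|lborel. \<omega> k z * (a' (s + z) - a' s))"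
        using i i' \<omega>(4,5)[of k] by (simp add: algebra_simps)
      also have "norm \<dots> \<le> (LINT z|lborel. \<omega> k z * (e / 2))"
        by (rule Bochner_Integration.integral_norm_bound_integral[OF i]) (use \<omega>(4)[of k] b in auto)
      also have "\<dots> = e / 2" using \<omega>(5)[of k] by simp
      finally show ?thesis using e by simp
    qed
    then show "\<exists>k0. \<forall>k\<ge>k0. norm ((LINT z|lborel. \<omega> k z * a' (s + z)) - a' s) < e" by blast
  qed
  moreover have "a' s = a s" using s by (simp add: a'_def)
  ultimately show ?thesis by (simp add: eq)
qed

text \<open>Smoothed indicators of [s, s'] times \<psi> are tested and the smoothing width tends to
  zero. The times must be interior because test functions vanish near both ends of the time
  interval.\<close>

lemma weak_identity_interior:
  fixes \<psi> :: "real ^ 'n \<Rightarrow> real"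
  assumes sol: "solves_continuity_eq S w \<theta> \<nu>" and \<psi>: "C_inf \<psi>" "bounded_support \<psi>"
    and a_cont: "continuous_on {0..S} (\<lambda>t. LINT x|\<nu> t. \<psi> x)"
    and int: "\<And>t. t \<in> {0..S} \<Longrightarrow> integrable (\<nu> t) (\<lambda>x. frechet_derivative \<psi> (at x) (w t x))"
    and b_int: "integrable (lebesgue_on {0..S}) (\<lambda>t. LINT x|\<nu> t. frechet_derivative \<psi> (at x) (w t x))"
    and s: "0 < s" "s \<le> s'" "s' < S"
  shows "(LINT x|\<nu> s'. \<psi> x) - (LINT x|\<nu> s. \<psi> x) =
    (LINT t|lebesgue_on {s..s'}. LINT x|\<nu> t. frechet_derivative \<psi> (at x) (w t x))"
proof -
  have ac: "ac_curve S \<nu>" using sol by (simp add: solves_continuity_eq_def)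
  define a where "a t = (LINT x|\<nu> t. \<psi> x)" for t
  define b where "b t = (LINT x|\<nu> t. frechet_derivative \<psi> (at x) (w t x))" for t
  note a_cont = a_cont[folded a_def] and b_int = b_int[folded b_def]
  have [measurable]: "b \<in> borel_measurable (lebesgue_on {0..S})" using b_int by (rule borel_measurable_integrable)
  \<comment> \<open>Smoothing by at most half the distance to the ends keeps the widened interval
    [s - \<delta> k, s' + \<delta> k] inside the open interval (0, S).\<close>
  define d0 where "d0 = min s (S - s') / 2"
  have d0: "0 < d0" "d0 < s" "d0 < S - s'" using s unfolding d0_def by auto
  define \<delta> where "\<delta> k = d0 / real (Suc k)" for k :: nat
  have \<delta>: "0 < \<delta> k" "\<delta> k \<le> d0" for k
    using d0(1) by (auto simp: \<delta>_def divide_simps intro: mult_left_mono)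
  have \<delta>0: "\<delta> \<longlonglongrightarrow> 0" unfolding \<delta>_def by (rule lim_const_over_n[THEN LIMSEQ_Suc])
  have "\<exists>\<omega> :: real \<Rightarrow> real. C_inf \<omega> \<and> (\<forall>z. 0 \<le> \<omega> z) \<and> (\<forall>z. \<delta> k < norm z \<longrightarrow> \<omega> z = 0) \<and>
      integrable lborel \<omega> \<and> (LINT z|lborel. \<omega> z) = 1" for k
    using mollifier_exists[OF \<delta>(1)[of k], where 'a = real] by metis
  then obtain \<omega> :: "nat \<Rightarrow> real \<Rightarrow> real" where \<omega>: "\<And>k. C_inf (\<omega> k)" "\<And>k z. 0 \<le> \<omega> k z"
      "\<And>k z. \<delta> k < norm z \<Longrightarrow> \<omega> k z = 0" "\<And>k. integrable lborel (\<omega> k)" "\<And>k. (LINT z|lborel. \<omega> k z) = 1"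
    by metis
  have \<omega>_supp: "bounded_support (\<omega> k)" for k using \<omega>(3) unfolding bounded_support_def by blast
  have \<omega>_meas: "\<omega> k \<in> borel_measurable borel" for k
    using C_infD(3)[OF \<omega>(1)] by (rule borel_measurable_continuous_onI)
  define \<eta> where "\<eta> k = fun_convolution (indicator {s..s'}) (\<omega> k)" for k
  note \<eta>' = fun_convolution_indicator[OF \<omega>(1) \<omega>_supp s(2), folded \<eta>_def]
  have \<eta>_eq: "\<eta> k t = (LINT z|lborel. indicator {s..s'} (t - z) * \<omega> k z)" for k t
    unfolding \<eta>_def by (rule fun_convolution_commute) (use \<omega>_meas in auto)
  have \<eta>_int: "integrable lborel (\<lambda>z. indicator {s..s'} (t - z) * \<omega> k z)" for k t
    by (rule Bochner_Integration.integrable_bound[OF \<omega>(4)[of k]])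
       (use \<omega>_meas \<omega>(2) in \<open>auto simp: indicator_def\<close>)
  have \<eta>_0: "\<eta> k t = 0" if "t \<notin> {s - \<delta> k..s' + \<delta> k}" for k t
  proof -
    have "(\<lambda>z. indicator {s..s'} (t - z) * \<omega> k z) = (\<lambda>z. 0)"
      using that \<omega>(3)[of k] by (force simp: indicator_def fun_eq_iff)
    then show ?thesis unfolding \<eta>_eq by (simp only: Bochner_Integration.integral_zero)
  qed
  have \<eta>_1: "\<eta> k t = 1" if "s + \<delta> k \<le> t" "t \<le> s' - \<delta> k" for k t
  proof -
    have "(\<lambda>z. indicator {s..s'} (t - z) * \<omega> k z) = \<omega> k"
      using that \<omega>(3)[of k] by (force simp: indicator_def fun_eq_iff)
    then show ?thesis unfolding \<eta>_eq by (simp only: \<omega>(5))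
  qed
  have \<eta>_bound: "\<bar>\<eta> k t\<bar> \<le> 1" for k t
  proof -
    have "0 \<le> \<eta> k t" unfolding \<eta>_eq by (intro Bochner_Integration.integral_nonneg) (simp add: \<omega>(2))
    moreover have "\<eta> k t \<le> (LINT z|lborel. \<omega> k z)"
      unfolding \<eta>_eq by (intro integral_mono \<eta>_int \<omega>(4)) (simp add: \<omega>(2) indicator_def)
    ultimately show ?thesis by (simp add: \<omega>(5))
  qed
  have \<eta>_cont: "continuous_on A (\<eta> k)" for k A by (rule C_infD(3)[OF \<eta>'(1)])
  have \<eta>_lim: "(\<lambda>k. \<eta> k t) \<longlonglongrightarrow> indicator {s..s'} t" if "t \<noteq> s" "t \<noteq> s'" for t
  proof (rule tendsto_eventually)
    have pos: "0 < min \<bar>t - s\<bar> \<bar>t - s'\<bar>" using that by auto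
    have "\<forall>\<^sub>F k in sequentially. \<delta> k < min \<bar>t - s\<bar> \<bar>t - s'\<bar>"
      by (rule order_tendstoD(2)[OF \<delta>0 pos])
    then show "\<forall>\<^sub>F k in sequentially. \<eta> k t = indicator {s..s'} t"
    proof (rule eventually_mono)
      fix k assume k: "\<delta> k < min \<bar>t - s\<bar> \<bar>t - s'\<bar>"
      show "\<eta> k t = indicator {s..s'} t"
      proof (cases "t \<in> {s..s'}")
        case True
        then show ?thesis using k by (subst \<eta>_1) auto
      next
        case False
        then show ?thesis using k by (subst \<eta>_0) auto
      qed
    qed
  qed
  have i1: "integrable (lebesgue_on {0..S}) (\<lambda>t. \<omega> k (t - r) * a t)" for k r
    by (intro continuous_imp_integrable_real continuous_on_mult a_cont
        continuous_on_compose2[OF C_infD(3)[OF \<omega>(1), of UNIV]] continuous_intros) auto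
  have i2: "integrable (lebesgue_on {0..S}) (\<lambda>t. \<eta> k t * b t)" for k
  proof (rule Bochner_Integration.integrable_bound[OF b_int])
    show "(\<lambda>t. \<eta> k t * b t) \<in> borel_measurable (lebesgue_on {0..S})"
      by (rule borel_measurable_times[OF continuous_imp_measurable_on_sets_lebesgue[OF \<eta>_cont]]) auto
    show "AE t in lebesgue_on {0..S}. norm (\<eta> k t * b t) \<le> norm (b t)"
      using \<eta>_bound by (auto simp: abs_mult intro!: mult_left_le_one_le)
  qed
  have zero: "(LINT t|lebesgue_on {0..S}. \<omega> k (t - s) * a t) - (LINT t|lebesgue_on {0..S}. \<omega> k (t - s') * a t)
     + (LINT t|lebesgue_on {0..S}. \<eta> k t * b t) = 0" for k
  proof -
    have p: "0 < s - \<delta> k" "s' + \<delta> k < S" using \<delta>(2)[of k] d0 by auto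
    have pt: "(\<lambda>z. \<eta> k (fst z) * \<psi> (snd z)) \<in> test_functions S"
      "frechet_derivative (\<lambda>z. \<eta> k (fst z) * \<psi> (snd z)) (at (t, x)) (1, v) =
        frechet_derivative (\<eta> k) (at t) 1 * \<psi> x + \<eta> k t * frechet_derivative \<psi> (at x) v" for t x v
      by (rule product_test_function[OF \<eta>'(1)[of k] _ p \<psi>], erule \<eta>_0)+
    have "0 = (LINT t|lebesgue_on {0..S}. LINT x|\<nu> t.
        frechet_derivative (\<lambda>z. \<eta> k (fst z) * \<psi> (snd z)) (at (t, x)) (1, w t x))"
      using sol pt(1) by (simp add: solves_continuity_eq_def)
    also have "\<dots> = (LINT t|lebesgue_on {0..S}. (\<omega> k (t - s) * a t - \<omega> k (t - s') * a t) + \<eta> k t * b t)"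
    proof (rule Bochner_Integration.integral_cong[OF refl])
      fix t assume "t \<in> space (lebesgue_on {0..S})"
      then have t: "t \<in> {0..S}" by simp
      have \<nu>t: "\<nu> t \<in> P1" using ac_curve_P1[OF ac t] .
      interpret prob_space "\<nu> t" using \<nu>t by (rule P1_prob_space)
      obtain B where "\<And>x. \<bar>\<psi> x\<bar> \<le> B" using bounded_support_bounded[OF C_infD(3)[OF \<psi>(1)] \<psi>(2)] by blast
      then have "integrable (\<nu> t) \<psi>"
        by (intro integrable_const_bound[of _ B])
           (auto simp: P1_borel_measurable[OF \<nu>t] intro!: borel_measurable_continuous_onI C_infD(3)[OF \<psi>(1)])
      then show "(LINT x|\<nu> t. frechet_derivative (\<lambda>z. \<eta> k (fst z) * \<psi> (snd z)) (at (t, x)) (1, w t x)) =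
          (\<omega> k (t - s) * a t - \<omega> k (t - s') * a t) + \<eta> k t * b t"
        unfolding pt(2) \<eta>'(2) a_def b_def using int[OF t] by (simp add: left_diff_distrib)
    qed
    also have "\<dots> = (LINT t|lebesgue_on {0..S}. \<omega> k (t - s) * a t) - (LINT t|lebesgue_on {0..S}. \<omega> k (t - s') * a t)
     + (LINT t|lebesgue_on {0..S}. \<eta> k t * b t)"
      using i1 i2 by simp
    finally show ?thesis by simp
  qed
  have l1: "(\<lambda>k. LINT t|lebesgue_on {0..S}. \<omega> k (t - r) * a t) \<longlonglongrightarrow> a r" if "r = s \<or> r = s'" for r
    by (rule mollifier_limit[OF a_cont _ _ \<delta>0 \<omega>]) (use that s d0 \<delta>(2) in \<open>auto intro: order_trans[OF \<delta>(2)]\<close>)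
  have l2: "(\<lambda>k. LINT t|lebesgue_on {0..S}. \<eta> k t * b t) \<longlonglongrightarrow> (LINT t|lebesgue_on {0..S}. indicator {s..s'} t * b t)"
  proof (rule integral_dominated_convergence[where w = "\<lambda>t. \<bar>b t\<bar>"])
    show "(\<lambda>t. indicator {s..s'} t * b t) \<in> borel_measurable (lebesgue_on {0..S})"
      by (intro borel_measurable_times borel_measurable_indicator) (use s b_int in \<open>auto simp: sets_restrict_space_iff\<close>)
    show "(\<lambda>t. \<eta> k t * b t) \<in> borel_measurable (lebesgue_on {0..S})" for k
      using i2 by (rule borel_measurable_integrable)
    \<comment> \<open>At the two jump times the smoothed indicators need not converge to the
      indicator; they form a null set.\<close>
    have "AE t in lebesgue_on {0..S}. t \<notin> {s, s'}"
      by (rule AE_I'[of "{s, s'}"]) (use s in \<open>auto simp: null_sets_restrict_space\<close>)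
    then show "AE t in lebesgue_on {0..S}. (\<lambda>k. \<eta> k t * b t) \<longlonglongrightarrow> indicator {s..s'} t * b t"
      by (rule eventually_mono) (auto intro!: tendsto_mult \<eta>_lim)
    show "AE t in lebesgue_on {0..S}. norm (\<eta> k t * b t) \<le> \<bar>b t\<bar>" for k
      using \<eta>_bound by (auto simp: abs_mult intro!: mult_left_le_one_le)
  qed (use b_int in auto)
  have "a s - a s' + (LINT t|lebesgue_on {0..S}. indicator {s..s'} t * b t) = 0"
    using LIMSEQ_unique[OF tendsto_add[OF tendsto_diff[OF l1[of s] l1[of s']] l2], of 0] zero by simp
  moreover have "(LINT t|lebesgue_on {0..S}. indicator {s..s'} t * b t) = (LINT t|lebesgue_on {s..s'}. b t)"
  proof -
    have "(LINT t|lebesgue_on {0..S}. indicator {s..s'} t * b t) = (LINT t|lebesgue. indicator {0..S} t *\<^sub>R (indicator {s..s'} t * b t))"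
      by (rule integral_restrict_space) auto
    also have "\<dots> = (LINT t|lebesgue. indicator {s..s'} t *\<^sub>R b t)"
      using s by (intro Bochner_Integration.integral_cong) (auto simp: indicator_def)
    also have "\<dots> = (LINT t|lebesgue_on {s..s'}. b t)"
      by (rule integral_restrict_space[symmetric]) auto
    finally show ?thesis .
  qed
  ultimately show ?thesis unfolding a_def b_def by simp
qed

text \<open>The defect \<open>c\<close> of the identity is constant on the open interval and
  continuous on the closed one, so the identity extends to both end points. Only in this form can it
  be used from the initial datum on.\<close>

lemma weak_identity:
  fixes \<psi> :: "real ^ 'n \<Rightarrow> real"
  assumes sol: "solves_continuity_eq S w \<theta> \<nu>" and "0 < S" and \<psi>: "C_inf \<psi>" "bounded_support \<psi>"
    and int: "\<And>t. t \<in> {0..S} \<Longrightarrow> integrable (\<nu> t) (\<lambda>x. frechet_derivative \<psi> (at x) (w t x))"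
    and b_int: "integrable (lebesgue_on {0..S}) (\<lambda>t. LINT x|\<nu> t. frechet_derivative \<psi> (at x) (w t x))"
    and s: "0 \<le> s" "s \<le> s'" "s' \<le> S"
  shows "(LINT x|\<nu> s'. \<psi> x) - (LINT x|\<nu> s. \<psi> x) =
    (LINT t|lebesgue_on {s..s'}. LINT x|\<nu> t. frechet_derivative \<psi> (at x) (w t x))"
proof -
  have ac: "ac_curve S \<nu>" using sol by (simp add: solves_continuity_eq_def)
  define a where "a t = (LINT x|\<nu> t. \<psi> x)" for t
  define b where "b t = (LINT x|\<nu> t. frechet_derivative \<psi> (at x) (w t x))" for t
  obtain K where K: "0 \<le> K" "\<And>x v. \<bar>frechet_derivative \<psi> (at x) v\<bar> \<le> K * norm v"
    using C_inf_deriv_bounded[OF \<psi>] by blast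
  have "K-lipschitz_on UNIV \<psi>"
    using lipschitz_of_deriv_bound[OF C_infD(1)[OF \<psi>(1)] K(2)] K(1) by (intro lipschitz_onI) (auto simp: dist_norm)
  then have "\<bar>a r - a s\<bar> \<le> K * W1 (\<nu> r) (\<nu> s)" if "r \<in> {0..S}" "s \<in> {0..S}" for r s
    unfolding a_def using that by (intro W1_lipschitz_bound ac_curve_P1[OF ac])
  then have a_cont: "continuous_on {0..S} a"
    using \<open>0 < S\<close> K(1) by (intro W1_continuous_imp_continuous_on[OF ac]) auto
  define c where "c t = a t - (LINT r|lebesgue_on {0..t}. b r)" for t
  note comb = lebesgue_on_integral_combine[OF b_int[folded b_def]]
  have c_cont: "continuous_on {0..S} c"
    unfolding c_def by (intro continuous_intros a_cont continuous_on_lebesgue_primitive b_int[folded b_def])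
  have c_eq: "c t = c t'" if "t \<in> {0<..<S}" "t' \<in> {0<..<S}" "t \<le> t'" for t t'
    using weak_identity_interior[OF sol \<psi> a_cont[unfolded a_def] int b_int, of t t'] that comb[of 0 t t']
    by (simp add: c_def a_def b_def)
  have c: "c t = c (S / 2)" if "t \<in> {0<..<S}" for t
  proof (cases "t \<le> S / 2")
    case True
    show ?thesis by (rule c_eq) (use True that in auto)
  next
    case False
    have "c (S / 2) = c t" by (rule c_eq) (use False that in auto)
    then show ?thesis by simp
  qed
  define c0 where "c0 = c (S / 2)"
  have "c t = c0" if "t \<in> {0..S}" for t
    by (rule continuous_constant_on_closure[of "{0<..<S}" c]) (use c_cont c[folded c0_def] that \<open>0 < S\<close> in auto)
  then have "c s = c s'" using s by simp
  then show ?thesis using comb[of 0 s s'] s by (simp add: c_def a_def b_def)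
qed

subsection \<open>Velocity fields\<close>

text \<open>The summed Manhattan bounds of \<open>assumption_A1\<close>, separated by field and
  expressed in the Euclidean norm; the dimension factor of the norm comparison is meant to be
  absorbed into L.\<close>

locale velocity_data =
  fixes f\<^sub>0 g :: "real ^ 'n \<Rightarrow> real ^ 'n" and f :: "'m::finite \<Rightarrow> real ^ 'n \<Rightarrow> real ^ 'n" and C L :: real
  assumes C_nonneg: "0 \<le> C" and L_nonneg: "0 \<le> L"
    and f\<^sub>0_bound: "norm (f\<^sub>0 x) \<le> C" and f_bound: "norm (f i x) \<le> C" and g_bound: "norm (g x) \<le> C"
    and f\<^sub>0_lipschitz: "norm (f\<^sub>0 x - f\<^sub>0 y) \<le> L * norm (x - y)"
    and f_lipschitz: "norm (f i x - f i y) \<le> L * norm (x - y)"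
    and g_lipschitz: "norm (g x - g y) \<le> L * norm (x - y)"
begin

text \<open>One field serves both systems: a = 1 and b = u t for the original one, a = \<alpha> s
  and b = \<beta> s for the reduced one. Being linear in (a, b), it also makes sense for integrals
  of controls over a block, where it becomes the displacement of an Euler step.\<close>

definition velocity :: "real \<Rightarrow> real ^ 'm \<Rightarrow> (real ^ 'n) measure \<Rightarrow> real ^ 'n \<Rightarrow> real ^ 'n"
  where "velocity a b \<mu> x = a *\<^sub>R (f\<^sub>0 x + convol g \<mu> x) + (\<Sum>i\<in>UNIV. (b $ i) *\<^sub>R f i x)"

lemma g_lipschitz_on: "L-lipschitz_on UNIV (\<lambda>y. g (x - y))"
  using g_lipschitz[of "x - y" "x - z" for y z] L_nonneg
  by (intro lipschitz_onI) (auto simp: dist_norm norm_minus_commute)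

lemma g_integrable: "\<mu> \<in> P1 \<Longrightarrow> integrable \<mu> (\<lambda>y. g (x - y))"
  by (rule P1_lipschitz_integrable[OF _ g_lipschitz_on])

lemma convol_bound:
  assumes "\<mu> \<in> P1" shows "norm (convol g \<mu> x) \<le> C"
proof -
  interpret prob_space \<mu> using assms by (rule P1_prob_space)
  have "norm (convol g \<mu> x) \<le> (LINT y|\<mu>. C)"
    unfolding convol_def by (rule Bochner_Integration.integral_norm_bound_integral[OF g_integrable[OF assms]]) (auto simp: g_bound)
  then show ?thesis by (simp add: prob_space)
qed

lemma convol_lipschitz:
  assumes "\<mu> \<in> P1" shows "norm (convol g \<mu> x - convol g \<mu> y) \<le> L * norm (x - y)"
proof -
  interpret prob_space \<mu> using assms by (rule P1_prob_space)
  have "convol g \<mu> x - convol g \<mu> y = (LINT z|\<mu>. g (x - z) - g (y - z))"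
    unfolding convol_def using g_integrable[OF assms] by simp
  also have "norm \<dots> \<le> (LINT z|\<mu>. L * norm (x - y))"
    by (rule Bochner_Integration.integral_norm_bound_integral)
       (use g_integrable[OF assms] g_lipschitz[of "x - z" "y - z" for z] in auto)
  finally show ?thesis by (simp add: prob_space)
qed

text \<open>The duality behind \<open>W1\<close> tests real functions, so each component of g (x -
  y) is compared separately; the sum over components gives the dimension factor.\<close>

lemma convol_W1:
  assumes "\<mu> \<in> P1" "\<nu> \<in> P1"
  shows "norm (convol g \<mu> x - convol g \<nu> x) \<le> CARD('n) * L * W1 \<mu> \<nu>"
proof -
  have "\<bar>(convol g \<mu> x - convol g \<nu> x) $ i\<bar> \<le> L * W1 \<mu> \<nu>" for i
  proof -
    have "(convol g \<pi> x) $ i = (LINT y|\<pi>. g (x - y) $ i)" if "\<pi> \<in> P1" for \<pi>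
      unfolding convol_def
      using integral_bounded_linear[OF bounded_linear_vec_nth[of i] g_integrable[OF that, of x]] by simp
    moreover have "L-lipschitz_on UNIV (\<lambda>y. g (x - y) $ i)"
    proof (rule lipschitz_onI)
      fix y z
      have "\<bar>(g (x - y) - g (x - z)) $ i\<bar> \<le> norm (g (x - y) - g (x - z))" by (rule component_le_norm_cart)
      then show "dist (g (x - y) $ i) (g (x - z) $ i) \<le> L * dist y z"
        using lipschitz_onD[OF g_lipschitz_on[of x], of y z] by (simp add: dist_norm)
    qed (rule L_nonneg)
    ultimately show ?thesis
      using W1_lipschitz_bound[OF assms, of L "\<lambda>y. g (x - y) $ i"] assms by simp
  qed
  then have "(\<Sum>i\<in>UNIV. \<bar>(convol g \<mu> x - convol g \<nu> x) $ i\<bar>) \<le> CARD('n) * (L * W1 \<mu> \<nu>)"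
    by (intro sum_bounded_above) auto
  then show ?thesis using norm_le_l1_cart[of "convol g \<mu> x - convol g \<nu> x"] by simp
qed

lemma drift_bound:
  assumes "\<mu> \<in> P1" shows "norm (f\<^sub>0 x + convol g \<mu> x) \<le> 2 * C"
  using norm_triangle_ineq[of "f\<^sub>0 x" "convol g \<mu> x"] f\<^sub>0_bound[of x] convol_bound[OF assms, of x] by simp

lemma drift_lipschitz:
  assumes "\<mu> \<in> P1"
  shows "norm ((f\<^sub>0 x + convol g \<mu> x) - (f\<^sub>0 y + convol g \<mu> y)) \<le> 2 * L * norm (x - y)"
  using norm_triangle_ineq[of "f\<^sub>0 x - f\<^sub>0 y" "convol g \<mu> x - convol g \<mu> y"] f\<^sub>0_lipschitz[of x y] convol_lipschitz[OF assms, of x y]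
  by (simp add: algebra_simps)

text \<open>General in the normed space because it serves the vector fields as well as the scalar
  pairings with an observable.\<close>

lemma norm_combination_le:
  fixes h :: "'m \<Rightarrow> 'a::real_normed_vector"
  assumes "norm h0 \<le> c" "\<And>i. norm (h i) \<le> c"
  shows "norm (a *\<^sub>R h0 + (\<Sum>i\<in>UNIV. (b $ i) *\<^sub>R h i)) \<le> c * (\<bar>a\<bar> + manhattan b)"
proof -
  have "norm (a *\<^sub>R h0) \<le> \<bar>a\<bar> * c" using assms(1) by (simp add: mult_left_mono)
  moreover have "norm (\<Sum>i\<in>UNIV. (b $ i) *\<^sub>R h i) \<le> (\<Sum>i\<in>UNIV. \<bar>b $ i\<bar> * c)"
    using assms(2) by (intro order_trans[OF norm_sum] sum_mono) (simp add: mult_left_mono)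
  ultimately show ?thesis
    using norm_triangle_ineq[of "a *\<^sub>R h0" "\<Sum>i\<in>UNIV. (b $ i) *\<^sub>R h i"]
    by (simp add: manhattan_def sum_distrib_left distrib_left mult.commute)
qed

lemma velocity_bound:
  assumes "\<mu> \<in> P1" shows "norm (velocity a b \<mu> x) \<le> 2 * C * (\<bar>a\<bar> + manhattan b)"
  unfolding velocity_def using C_nonneg
  by (intro norm_combination_le drift_bound[OF assms] order_trans[OF f_bound]) simp

lemma velocity_lipschitz:
  assumes "\<mu> \<in> P1"
  shows "norm (velocity a b \<mu> x - velocity a b \<mu> y) \<le> 2 * L * (\<bar>a\<bar> + manhattan b) * norm (x - y)"
proof -
  have "velocity a b \<mu> x - velocity a b \<mu> y = a *\<^sub>R ((f\<^sub>0 x + convol g \<mu> x) - (f\<^sub>0 y + convol g \<mu> y))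
      + (\<Sum>i\<in>UNIV. (b $ i) *\<^sub>R (f i x - f i y))"
    unfolding velocity_def by (simp add: scaleR_diff_right sum_subtractf)
  also have "norm \<dots> \<le> (2 * L * norm (x - y)) * (\<bar>a\<bar> + manhattan b)"
    by (intro norm_combination_le drift_lipschitz[OF assms] order_trans[OF f_lipschitz])
       (simp add: L_nonneg mult_right_mono)
  finally show ?thesis by (simp add: algebra_simps)
qed

lemma velocity_W1:
  assumes "\<mu> \<in> P1" "\<nu> \<in> P1"
  shows "norm (velocity a b \<mu> x - velocity a b \<nu> x) \<le> \<bar>a\<bar> * (CARD('n) * L * W1 \<mu> \<nu>)"
proof -
  have "velocity a b \<mu> x - velocity a b \<nu> x = a *\<^sub>R (convol g \<mu> x - convol g \<nu> x)"
    unfolding velocity_def by (simp add: algebra_simps)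
  then show ?thesis using convol_W1[OF assms, of x] by (simp add: mult_left_mono)
qed

lemma velocity_diff: "velocity a b \<mu> x - velocity a' b' \<mu> x = velocity (a - a') (b - b') \<mu> x"
  unfolding velocity_def by (simp add: algebra_simps sum_subtractf)

lemma velocity_continuous:
  assumes "\<mu> \<in> P1" shows "continuous_on A (velocity a b \<mu>)"
proof (rule lipschitz_on_continuous_on)
  show "(2 * L * (\<bar>a\<bar> + manhattan b))-lipschitz_on A (velocity a b \<mu>)"
    by (rule lipschitz_onI) (use velocity_lipschitz[OF assms] L_nonneg in \<open>auto simp: dist_norm\<close>)
qed

end

text \<open>The bound 1 on the derivative and the bound K on its variation are kept apart: under
  mollification the former is independent of the scale while the latter is not.\<close>

locale test_observable =
  fixes \<psi> :: "real ^ 'n \<Rightarrow> real" and K :: real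
  assumes smooth: "C_inf \<psi>" "bounded_support \<psi>" and K_nonneg: "0 \<le> K"
    and deriv_bound: "\<bar>frechet_derivative \<psi> (at x) v\<bar> \<le> norm v"
    and deriv_lipschitz: "\<bar>frechet_derivative \<psi> (at x) v - frechet_derivative \<psi> (at y) v\<bar> \<le> K * norm (x - y) * norm v"
begin

abbreviation d\<psi> :: "real ^ 'n \<Rightarrow> real ^ 'n \<Rightarrow> real" where "d\<psi> x v \<equiv> frechet_derivative \<psi> (at x) v"

lemma d\<psi>_linear: "linear (frechet_derivative \<psi> (at x))"
  by (rule C_inf_linear_deriv[OF smooth(1)])

lemma pairing_lipschitz:
  assumes "\<And>x. norm (h x) \<le> c" "\<And>x y. norm (h x - h y) \<le> l * norm (x - y)" "0 \<le> l"
  shows "(K * c + l)-lipschitz_on UNIV (\<lambda>x. d\<psi> x (h x))"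
proof (rule lipschitz_onI)
  fix x y
  have "d\<psi> x (h x) - d\<psi> y (h y) = (d\<psi> x (h x) - d\<psi> y (h x)) + d\<psi> y (h x - h y)"
    by (simp add: linear_diff[OF d\<psi>_linear])
  also have "\<bar>\<dots>\<bar> \<le> K * norm (x - y) * norm (h x) + norm (h x - h y)"
    by (intro order_trans[OF abs_triangle_ineq] add_mono deriv_bound deriv_lipschitz)
  also have "\<dots> \<le> K * norm (x - y) * c + l * norm (x - y)"
    using K_nonneg by (intro add_mono mult_left_mono assms) auto
  finally show "dist (d\<psi> x (h x)) (d\<psi> y (h y)) \<le> (K * c + l) * dist x y"
    by (simp add: dist_norm algebra_simps)
next
  have "0 \<le> c" using assms(1) norm_ge_zero order_trans by blast
  then show "0 \<le> K * c + l" using K_nonneg assms(3) by simp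
qed

end

locale observed_velocity = velocity_data f\<^sub>0 g f C L + test_observable \<psi> K
  for f\<^sub>0 g :: "real ^ 'n \<Rightarrow> real ^ 'n" and f :: "'m::finite \<Rightarrow> real ^ 'n \<Rightarrow> real ^ 'n" and C L
    and \<psi> :: "real ^ 'n \<Rightarrow> real" and K
begin

text \<open>The rate of change of \<integral>\<psi> d\<mu> is linear in the control, with this and
  \<open>control_pairing\<close> as coefficients. The coefficients are continuous in \<mu> while the
  controls are only measurable, so a block can be treated by freezing the coefficients and
  integrating the controls exactly.\<close>

definition drift_pairing :: "(real ^ 'n) measure \<Rightarrow> real"
  where "drift_pairing \<mu> = (LINT x|\<mu>. d\<psi> x (f\<^sub>0 x + convol g \<mu> x))"

definition control_pairing :: "'m \<Rightarrow> (real ^ 'n) measure \<Rightarrow> real"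
  where "control_pairing i \<mu> = (LINT x|\<mu>. d\<psi> x (f i x))"

text \<open>The first two terms are the Lipschitz constant in x of the integrand of
  \<open>drift_pairing\<close>; the last one accounts for the measure inside the
  convolution.\<close>

definition pairing_modulus :: real
  where "pairing_modulus = 2 * C * K + 2 * L + CARD('n) * L"

lemma pairing_modulus_nonneg: "0 \<le> pairing_modulus"
  unfolding pairing_modulus_def using C_nonneg K_nonneg L_nonneg by simp

lemma drift_pairing_lipschitz:
  "\<mu> \<in> P1 \<Longrightarrow> (K * (2 * C) + 2 * L)-lipschitz_on UNIV (\<lambda>x. d\<psi> x (f\<^sub>0 x + convol g \<mu> x))"
  by (rule pairing_lipschitz) (use drift_bound drift_lipschitz L_nonneg in auto)

lemma control_pairing_lipschitz: "(K * C + L)-lipschitz_on UNIV (\<lambda>x. d\<psi> x (f i x))"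
  by (rule pairing_lipschitz) (use f_bound f_lipschitz L_nonneg in auto)

lemma velocity_pairing_eq:
  "d\<psi> x (velocity a b \<mu> x) = a * d\<psi> x (f\<^sub>0 x + convol g \<mu> x) + (\<Sum>i\<in>UNIV. b $ i * d\<psi> x (f i x))"
  unfolding velocity_def
  by (simp add: linear_add[OF d\<psi>_linear] linear_scale[OF d\<psi>_linear] linear_sum[OF d\<psi>_linear] o_def)

lemma velocity_pairing:
  assumes "\<mu> \<in> P1"
  shows "integrable \<mu> (\<lambda>x. d\<psi> x (velocity a b \<mu> x))"
    and "(LINT x|\<mu>. d\<psi> x (velocity a b \<mu> x)) = a * drift_pairing \<mu> + (\<Sum>i\<in>UNIV. b $ i * control_pairing i \<mu>)"
  unfolding velocity_pairing_eq drift_pairing_def control_pairing_def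
  using P1_lipschitz_integrable[OF assms drift_pairing_lipschitz[OF assms]]
    P1_lipschitz_integrable[OF assms control_pairing_lipschitz] by auto

lemma drift_pairing_diff:
  assumes "\<mu> \<in> P1" "\<nu> \<in> P1"
  shows "\<bar>drift_pairing \<mu> - drift_pairing \<nu>\<bar> \<le> pairing_modulus * W1 \<mu> \<nu>"
proof -
  interpret \<nu>: prob_space \<nu> using assms(2) by (rule P1_prob_space)
  note int = P1_lipschitz_integrable[OF assms(2) drift_pairing_lipschitz]
  have 1: "\<bar>drift_pairing \<mu> - (LINT x|\<nu>. d\<psi> x (f\<^sub>0 x + convol g \<mu> x))\<bar> \<le> (K * (2 * C) + 2 * L) * W1 \<mu> \<nu>"
    unfolding drift_pairing_def by (rule W1_lipschitz_bound[OF assms drift_pairing_lipschitz[OF assms(1)]])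
  \<comment> \<open>The measure enters twice. So far the integrating measure has been exchanged with
    the field kept at \<mu>; now the measure in the convolution is exchanged.\<close>
  have "(LINT x|\<nu>. d\<psi> x (f\<^sub>0 x + convol g \<mu> x)) - drift_pairing \<nu> = (LINT x|\<nu>. d\<psi> x (convol g \<mu> x - convol g \<nu> x))"
    unfolding drift_pairing_def using int[OF assms(1)] int[OF assms(2)]
    by (simp add: linear_add[OF d\<psi>_linear] linear_diff[OF d\<psi>_linear] flip: Bochner_Integration.integral_diff)
  also have "\<bar>\<dots>\<bar> \<le> (LINT x|\<nu>. CARD('n) * L * W1 \<mu> \<nu>)"
    unfolding real_norm_def[symmetric]
  proof (rule Bochner_Integration.integral_norm_bound_integral)
    show "integrable \<nu> (\<lambda>x. d\<psi> x (convol g \<mu> x - convol g \<nu> x))"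
      using Bochner_Integration.integrable_diff[OF int[OF assms(1)] int[OF assms(2)]]
      by (simp add: linear_add[OF d\<psi>_linear] linear_diff[OF d\<psi>_linear])
    show "norm (d\<psi> x (convol g \<mu> x - convol g \<nu> x)) \<le> CARD('n) * L * W1 \<mu> \<nu>" for x
      using order_trans[OF deriv_bound convol_W1[OF assms]] by simp
  qed auto
  finally have "\<bar>(LINT x|\<nu>. d\<psi> x (f\<^sub>0 x + convol g \<mu> x)) - drift_pairing \<nu>\<bar> \<le> CARD('n) * L * W1 \<mu> \<nu>"
    by (simp add: \<nu>.prob_space)
  with 1 show ?thesis unfolding pairing_modulus_def by (simp add: algebra_simps)
qed

lemma control_pairing_diff:
  assumes "\<mu> \<in> P1" "\<nu> \<in> P1"
  shows "\<bar>control_pairing i \<mu> - control_pairing i \<nu>\<bar> \<le> pairing_modulus * W1 \<mu> \<nu>"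
proof -
  have "\<bar>control_pairing i \<mu> - control_pairing i \<nu>\<bar> \<le> (K * C + L) * W1 \<mu> \<nu>"
    unfolding control_pairing_def by (rule W1_lipschitz_bound[OF assms control_pairing_lipschitz])
  also have "\<dots> \<le> pairing_modulus * W1 \<mu> \<nu>"
    unfolding pairing_modulus_def using C_nonneg K_nonneg L_nonneg W1_nonneg[OF assms]
    by (intro mult_right_mono) (auto simp: algebra_simps)
  finally show ?thesis .
qed

lemma pairing_bound:
  assumes "\<mu> \<in> P1"
  shows "\<bar>drift_pairing \<mu>\<bar> \<le> 2 * C" "\<bar>control_pairing i \<mu>\<bar> \<le> 2 * C"
proof -
  interpret prob_space \<mu> using assms by (rule P1_prob_space)
  have "norm (drift_pairing \<mu>) \<le> (LINT x|\<mu>. 2 * C)"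
    unfolding drift_pairing_def
    by (rule Bochner_Integration.integral_norm_bound_integral[OF P1_lipschitz_integrable[OF assms drift_pairing_lipschitz[OF assms]]])
       (use order_trans[OF deriv_bound drift_bound[OF assms]] in auto)
  then show "\<bar>drift_pairing \<mu>\<bar> \<le> 2 * C" by (simp add: prob_space)
  have "norm (control_pairing i \<mu>) \<le> (LINT x|\<mu>. C)"
    unfolding control_pairing_def
    by (rule Bochner_Integration.integral_norm_bound_integral[OF P1_lipschitz_integrable[OF assms control_pairing_lipschitz]])
       (use order_trans[OF deriv_bound f_bound] in auto)
  then show "\<bar>control_pairing i \<mu>\<bar> \<le> 2 * C" using C_nonneg by (simp add: prob_space)
qed

end

section \<open>Admissible controls and the weak solution over one block\<close>

lemma lebesgue_on_integral_const: "a \<le> b \<Longrightarrow> (LINT s|lebesgue_on {a..b}. c) = (b - a) * (c :: real)"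
  by (simp add: measure_restrict_space)

lemma integral_vec_nth:
  fixes h :: "'a \<Rightarrow> real ^ 'm"
  assumes "integrable M h"
  shows "(LINT x|M. h x) $ i = (LINT x|M. h x $ i)" "integrable M (\<lambda>x. h x $ i)"
  using integral_bounded_linear[OF bounded_linear_vec_nth[of i] assms]
    integrable_bounded_linear[OF bounded_linear_vec_nth[of i] assms] by simp_all

lemma manhattan_integral_le:
  fixes h :: "'a \<Rightarrow> real ^ 'm"
  assumes h: "integrable M h"
  shows "integrable M (\<lambda>x. manhattan (h x))" "manhattan (LINT x|M. h x) \<le> (LINT x|M. manhattan (h x))"
proof -
  note i = integral_vec_nth[OF h]
  show "integrable M (\<lambda>x. manhattan (h x))"
    unfolding manhattan_def using i(2) by auto
  have "manhattan (LINT x|M. h x) \<le> (\<Sum>j\<in>UNIV. LINT x|M. \<bar>h x $ j\<bar>)"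
    unfolding manhattan_def i(1) by (intro sum_mono integral_abs_bound)
  also have "\<dots> = (LINT x|M. manhattan (h x))"
    unfolding manhattan_def using i(2) by (subst Bochner_Integration.integral_sum) auto
  finally show "manhattan (LINT x|M. h x) \<le> (LINT x|M. manhattan (h x))" .
qed

locale admissible_control =
  fixes S :: real and \<alpha> :: "real \<Rightarrow> real" and \<beta> :: "real \<Rightarrow> real ^ 'm::finite"
  assumes \<alpha>_measurable: "\<alpha> \<in> borel_measurable (lebesgue_on {0..S})"
    and \<beta>_measurable: "\<beta> \<in> borel_measurable (lebesgue_on {0..S})"
    and admissible: "AE s in lebesgue_on {0..S}. (\<alpha> s, \<beta> s) \<in> control_set"
begin

lemma AE_control: "AE s in lebesgue_on {0..S}. 0 \<le> \<alpha> s \<and> \<alpha> s + manhattan (\<beta> s) \<le> 1"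
  using admissible by (simp add: control_set_def)

lemma AE_control_sub:
  assumes "0 \<le> a" "b \<le> S"
  shows "AE s in lebesgue_on {a..b}. 0 \<le> \<alpha> s \<and> \<alpha> s + manhattan (\<beta> s) \<le> 1"
proof -
  have "AE s in lebesgue. s \<in> {0..S} \<longrightarrow> 0 \<le> \<alpha> s \<and> \<alpha> s + manhattan (\<beta> s) \<le> 1"
    using AE_control by (subst (asm) AE_restrict_space_iff) simp_all
  then have "AE s in lebesgue. s \<in> {a..b} \<longrightarrow> 0 \<le> \<alpha> s \<and> \<alpha> s + manhattan (\<beta> s) \<le> 1"
    by (rule eventually_mono) (use assms in auto)
  then show ?thesis by (subst AE_restrict_space_iff) simp_all
qed

lemma \<alpha>_integrable: "integrable (lebesgue_on {0..S}) \<alpha>"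
proof (rule lebesgue_on_integrable_bounded[OF \<alpha>_measurable])
  show "AE t in lebesgue_on {0..S}. norm (\<alpha> t) \<le> 1"
    using AE_control
  proof (rule eventually_mono)
    fix s assume "0 \<le> \<alpha> s \<and> \<alpha> s + manhattan (\<beta> s) \<le> 1"
    then show "norm (\<alpha> s) \<le> 1" unfolding real_norm_def using manhattan_nonneg[of "\<beta> s"] by linarith
  qed
qed

lemma \<beta>_integrable: "integrable (lebesgue_on {0..S}) \<beta>"
proof (rule lebesgue_on_integrable_bounded[OF \<beta>_measurable])
  show "AE t in lebesgue_on {0..S}. norm (\<beta> t) \<le> 1"
    using AE_control
  proof (rule eventually_mono)
    fix s assume "0 \<le> \<alpha> s \<and> \<alpha> s + manhattan (\<beta> s) \<le> 1"
    then show "norm (\<beta> s) \<le> 1" using norm_le_manhattan[of "\<beta> s"] by simp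
  qed
qed

text \<open>The control set is convex, so averages of controls stay in it; multiplied by the length
  of the interval this is the second inequality.\<close>

lemma integral_control_bound:
  assumes "0 \<le> a" "a \<le> b" "b \<le> S"
  shows "0 \<le> (LINT s|lebesgue_on {a..b}. \<alpha> s)"
    and "(LINT s|lebesgue_on {a..b}. \<alpha> s) + manhattan (LINT s|lebesgue_on {a..b}. \<beta> s) \<le> b - a"
proof -
  note ae = AE_control_sub[OF assms(1,3)]
  note i = lebesgue_on_integrable_sub[OF \<alpha>_integrable assms(1,3)] lebesgue_on_integrable_sub[OF \<beta>_integrable assms(1,3)]
  show "0 \<le> (LINT s|lebesgue_on {a..b}. \<alpha> s)"
    by (rule Bochner_Integration.integral_nonneg_AE) (use ae in auto)
  have "(LINT s|lebesgue_on {a..b}. \<alpha> s) + manhattan (LINT s|lebesgue_on {a..b}. \<beta> s)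
      \<le> (LINT s|lebesgue_on {a..b}. \<alpha> s + manhattan (\<beta> s))"
    using manhattan_integral_le[OF i(2)] i(1) by simp
  also have "\<dots> \<le> (LINT s|lebesgue_on {a..b}. 1)"
    using ae i(1) manhattan_integral_le(1)[OF i(2)]
    by (intro integral_mono_AE) (auto simp: lebesgue_on_integrable_const)
  also have "\<dots> = b - a" using assms by (simp add: measure_restrict_space)
  finally show "(LINT s|lebesgue_on {a..b}. \<alpha> s) + manhattan (LINT s|lebesgue_on {a..b}. \<beta> s) \<le> b - a" .
qed

end

locale observed_solution = observed_velocity f\<^sub>0 g f C L \<psi> K + admissible_control S \<alpha> \<beta>
  for f\<^sub>0 g :: "real ^ 'n \<Rightarrow> real ^ 'n" and f :: "'m::finite \<Rightarrow> real ^ 'n \<Rightarrow> real ^ 'n" and C L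
    and \<psi> :: "real ^ 'n \<Rightarrow> real" and K S and \<alpha> :: "real \<Rightarrow> real" and \<beta> :: "real \<Rightarrow> real ^ 'm" +
  fixes \<theta> :: "(real ^ 'n) measure" and \<nu> :: "real \<Rightarrow> (real ^ 'n) measure"
  assumes S_pos: "0 < S"
    and solution: "solves_continuity_eq S (\<lambda>s x. velocity (\<alpha> s) (\<beta> s) (\<nu> s) x) \<theta> \<nu>"
begin

lemma ac: "ac_curve S \<nu>"
  using solution by (simp add: solves_continuity_eq_def)

lemma \<nu>_P1: "t \<in> {0..S} \<Longrightarrow> \<nu> t \<in> P1"
  by (rule ac_curve_P1[OF ac])

lemma pairing_measurable:
  "(\<lambda>t. drift_pairing (\<nu> t)) \<in> borel_measurable (lebesgue_on {0..S})"
  "(\<lambda>t. control_pairing i (\<nu> t)) \<in> borel_measurable (lebesgue_on {0..S})"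
proof -
  show "(\<lambda>t. drift_pairing (\<nu> t)) \<in> borel_measurable (lebesgue_on {0..S})"
    by (intro continuous_imp_measurable_on_sets_lebesgue W1_continuous_imp_continuous_on[OF ac _ pairing_modulus_nonneg]
        drift_pairing_diff \<nu>_P1) (use S_pos in auto)
  show "(\<lambda>t. control_pairing i (\<nu> t)) \<in> borel_measurable (lebesgue_on {0..S})"
    by (intro continuous_imp_measurable_on_sets_lebesgue W1_continuous_imp_continuous_on[OF ac _ pairing_modulus_nonneg]
        control_pairing_diff \<nu>_P1) (use S_pos in auto)
qed

lemma pairing_integrable:
  "integrable (lebesgue_on {0..S}) (\<lambda>t. \<alpha> t * drift_pairing (\<nu> t))"
  "integrable (lebesgue_on {0..S}) (\<lambda>t. \<beta> t $ i * control_pairing i (\<nu> t))"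
proof -
  note [measurable] = pairing_measurable \<alpha>_measurable borel_measurable_integrable[OF integral_vec_nth(2)[OF \<beta>_integrable]]
  show "integrable (lebesgue_on {0..S}) (\<lambda>t. \<alpha> t * drift_pairing (\<nu> t))"
    by (rule Bochner_Integration.integrable_bound[where f = "\<lambda>t. \<alpha> t * (2 * C)"])
      (use \<alpha>_integrable C_nonneg in \<open>auto intro!: AE_I2 mult_left_mono pairing_bound(1) \<nu>_P1 simp: abs_mult\<close>)
  show "integrable (lebesgue_on {0..S}) (\<lambda>t. \<beta> t $ i * control_pairing i (\<nu> t))"
    by (rule Bochner_Integration.integrable_bound[where f = "\<lambda>t. \<beta> t $ i * (2 * C)"])
      (use integral_vec_nth(2)[OF \<beta>_integrable] C_nonneg in \<open>auto intro!: AE_I2 mult_left_mono pairing_bound(2) \<nu>_P1 simp: abs_mult\<close>)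
qed

lemma observable_increment:
  assumes s: "0 \<le> s" "s \<le> s'" "s' \<le> S"
  shows "(LINT x|\<nu> s'. \<psi> x) - (LINT x|\<nu> s. \<psi> x) = (LINT t|lebesgue_on {s..s'}.
     \<alpha> t * drift_pairing (\<nu> t) + (\<Sum>i\<in>UNIV. \<beta> t $ i * control_pairing i (\<nu> t)))"
proof -
  have eq: "(LINT x|\<nu> t. d\<psi> x (velocity (\<alpha> t) (\<beta> t) (\<nu> t) x)) =
      \<alpha> t * drift_pairing (\<nu> t) + (\<Sum>i\<in>UNIV. \<beta> t $ i * control_pairing i (\<nu> t))" if "t \<in> {0..S}" for t
    by (rule velocity_pairing(2)[OF \<nu>_P1[OF that]])
  have "integrable (lebesgue_on {0..S}) (\<lambda>t. \<alpha> t * drift_pairing (\<nu> t) + (\<Sum>i\<in>UNIV. \<beta> t $ i * control_pairing i (\<nu> t)))"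
    using pairing_integrable by auto
  then have "integrable (lebesgue_on {0..S}) (\<lambda>t. LINT x|\<nu> t. d\<psi> x (velocity (\<alpha> t) (\<beta> t) (\<nu> t) x))"
    by (rule Bochner_Integration.integrable_cong[THEN iffD1, rotated -1]) (use eq in auto)
  then have "(LINT x|\<nu> s'. \<psi> x) - (LINT x|\<nu> s. \<psi> x) =
    (LINT t|lebesgue_on {s..s'}. LINT x|\<nu> t. d\<psi> x (velocity (\<alpha> t) (\<beta> t) (\<nu> t) x))"
    by (intro weak_identity[OF solution S_pos smooth _ _ s] velocity_pairing(1) \<nu>_P1)
  also have "\<dots> = (LINT t|lebesgue_on {s..s'}.
     \<alpha> t * drift_pairing (\<nu> t) + (\<Sum>i\<in>UNIV. \<beta> t $ i * control_pairing i (\<nu> t)))"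
    by (intro Bochner_Integration.integral_cong[OF refl] eq) (use s in auto)
  finally show ?thesis .
qed

text \<open>Up to small errors the weak solution moves like its push-forward under one Euler step
  with the integrated controls. Freezing the pairings at time s costs the modulus times \<omega>
  over the length of the interval. Replacing the derivative of \<psi> by a finite displacement costs
  a Taylor remainder, the displacement being at most 2 C (s' - s).\<close>

lemma one_step:
  assumes s: "0 \<le> s" "s \<le> s'" "s' \<le> S"
    and \<omega>: "\<And>r. r \<in> {s..s'} \<Longrightarrow> W1 (\<nu> r) (\<nu> s) \<le> \<omega>"
  defines "A \<equiv> (LINT r|lebesgue_on {s..s'}. \<alpha> r)" and "B \<equiv> (LINT r|lebesgue_on {s..s'}. \<beta> r)"
  shows "\<bar>(LINT x|\<nu> s'. \<psi> x) - (LINT x|\<nu> s. \<psi> (x + velocity A B (\<nu> s) x))\<bar>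
    \<le> (s' - s) * (pairing_modulus * \<omega>) + K * (2 * C * (s' - s))\<^sup>2"
proof -
  have \<nu>s: "\<nu> s \<in> P1" using s by (intro \<nu>_P1) auto
  interpret prob_space "\<nu> s" using \<nu>s by (rule P1_prob_space)
  note i = lebesgue_on_integrable_sub[OF \<alpha>_integrable s(1,3)] integral_vec_nth[OF lebesgue_on_integrable_sub[OF \<beta>_integrable s(1,3)]]
  note pi = pairing_integrable[THEN lebesgue_on_integrable_sub[OF _ s(1,3)]]
  let ?V = "velocity A B (\<nu> s)"
  let ?P = "\<lambda>r. drift_pairing (\<nu> r)" and ?Q = "\<lambda>j r. control_pairing j (\<nu> r)"
  have AB: "0 \<le> A" "A + manhattan B \<le> s' - s"
    unfolding A_def B_def by (rule integral_control_bound[OF s])+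
  have main: "(LINT x|\<nu> s. d\<psi> x (?V x)) = (LINT r|lebesgue_on {s..s'}. \<alpha> r * ?P s + (\<Sum>j\<in>UNIV. \<beta> r $ j * ?Q j s))"
    unfolding velocity_pairing(2)[OF \<nu>s] A_def B_def using i by simp
  have int: "integrable (lebesgue_on {s..s'}) (\<lambda>r. (\<alpha> r * ?P r + (\<Sum>j\<in>UNIV. \<beta> r $ j * ?Q j r)) - (\<alpha> r * ?P s + (\<Sum>j\<in>UNIV. \<beta> r $ j * ?Q j s)))"
    by (intro Bochner_Integration.integrable_diff Bochner_Integration.integrable_add Bochner_Integration.integrable_sum
        integrable_mult_left i pi)
  have incr: "(LINT x|\<nu> s'. \<psi> x) - (LINT x|\<nu> s. \<psi> x) - (LINT x|\<nu> s. d\<psi> x (?V x)) =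
    (LINT r|lebesgue_on {s..s'}. (\<alpha> r * ?P r + (\<Sum>j\<in>UNIV. \<beta> r $ j * ?Q j r)) - (\<alpha> r * ?P s + (\<Sum>j\<in>UNIV. \<beta> r $ j * ?Q j s)))"
    unfolding observable_increment[OF s] main using i pi by (subst Bochner_Integration.integral_diff) auto
  have "norm (LINT r|lebesgue_on {s..s'}. (\<alpha> r * ?P r + (\<Sum>j\<in>UNIV. \<beta> r $ j * ?Q j r)) - (\<alpha> r * ?P s + (\<Sum>j\<in>UNIV. \<beta> r $ j * ?Q j s)))
      \<le> (LINT r|lebesgue_on {s..s'}. pairing_modulus * \<omega>)"
  proof (rule order_trans[OF integral_norm_bound integral_mono_AE])
    show "AE r in lebesgue_on {s..s'}. norm ((\<alpha> r * ?P r + (\<Sum>j\<in>UNIV. \<beta> r $ j * ?Q j r)) - (\<alpha> r * ?P s + (\<Sum>j\<in>UNIV. \<beta> r $ j * ?Q j s)))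
        \<le> pairing_modulus * \<omega>"
    proof (rule AE_mp[OF AE_control_sub[OF s(1,3)]], rule AE_I2, rule impI)
      fix r assume r: "r \<in> space (lebesgue_on {s..s'})" and c: "0 \<le> \<alpha> r \<and> \<alpha> r + manhattan (\<beta> r) \<le> 1"
      have \<nu>r: "\<nu> r \<in> P1" using s r by (intro \<nu>_P1) auto
      have w: "pairing_modulus * W1 (\<nu> r) (\<nu> s) \<le> pairing_modulus * \<omega>"
        using \<omega>[of r] r pairing_modulus_nonneg by (intro mult_left_mono) auto
      have "0 \<le> \<omega>" using \<omega>[of s] W1_nonneg[OF \<nu>s \<nu>s] s by auto
      have eq: "(\<alpha> r * ?P r + (\<Sum>j\<in>UNIV. \<beta> r $ j * ?Q j r)) - (\<alpha> r * ?P s + (\<Sum>j\<in>UNIV. \<beta> r $ j * ?Q j s))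
         = \<alpha> r *\<^sub>R (?P r - ?P s) + (\<Sum>j\<in>UNIV. (\<beta> r $ j) *\<^sub>R (?Q j r - ?Q j s))"
        by (simp add: algebra_simps sum_subtractf)
      have "norm (\<alpha> r *\<^sub>R (?P r - ?P s) + (\<Sum>j\<in>UNIV. (\<beta> r $ j) *\<^sub>R (?Q j r - ?Q j s))) \<le> pairing_modulus * \<omega> * (\<bar>\<alpha> r\<bar> + manhattan (\<beta> r))"
        by (rule norm_combination_le)
           (use order_trans[OF drift_pairing_diff[OF \<nu>r \<nu>s] w] order_trans[OF control_pairing_diff[OF \<nu>r \<nu>s] w] in auto)
      also have "\<dots> \<le> pairing_modulus * \<omega> * 1"
        using c pairing_modulus_nonneg \<open>0 \<le> \<omega>\<close> by (intro mult_left_mono) auto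
      finally show "norm ((\<alpha> r * ?P r + (\<Sum>j\<in>UNIV. \<beta> r $ j * ?Q j r)) - (\<alpha> r * ?P s + (\<Sum>j\<in>UNIV. \<beta> r $ j * ?Q j s)))
        \<le> pairing_modulus * \<omega>" unfolding eq by simp
    qed
  qed (rule integrable_norm[OF int], rule lebesgue_on_integrable_const)
  then have 1: "\<bar>(LINT x|\<nu> s'. \<psi> x) - (LINT x|\<nu> s. \<psi> x) - (LINT x|\<nu> s. d\<psi> x (?V x))\<bar> \<le> (s' - s) * (pairing_modulus * \<omega>)"
    unfolding incr lebesgue_on_integral_const[OF s(2)] real_norm_def .
  have psi_lip: "1-lipschitz_on UNIV \<psi>"
    using lipschitz_of_deriv_bound[OF C_infD(1)[OF smooth(1)], of 1] deriv_bound by (intro lipschitz_onI) (auto simp: dist_norm)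
  have V_cont: "continuous_on UNIV ?V" by (rule velocity_continuous[OF \<nu>s])
  obtain b where b: "\<And>x. \<bar>\<psi> x\<bar> \<le> b" using bounded_support_bounded[OF C_infD(3)[OF smooth(1)] smooth(2)] by blast
  have "continuous_on UNIV (\<lambda>x. \<psi> (x + ?V x))"
    by (intro continuous_on_compose2[OF C_infD(3)[OF smooth(1), of UNIV]] continuous_intros V_cont) auto
  then have i1: "integrable (\<nu> s) (\<lambda>x. \<psi> (x + ?V x))"
    using b by (intro integrable_const_bound[of _ b]) (auto simp: P1_borel_measurable[OF \<nu>s] intro: borel_measurable_continuous_onI)
  note i2 = P1_lipschitz_integrable[OF \<nu>s psi_lip]
  note i3 = velocity_pairing(1)[OF \<nu>s, of A B]
  have "(LINT x|\<nu> s. \<psi> (x + ?V x)) - (LINT x|\<nu> s. \<psi> x) - (LINT x|\<nu> s. d\<psi> x (?V x)) =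
      (LINT x|\<nu> s. \<psi> (x + ?V x) - \<psi> x - d\<psi> x (?V x))"
    using i1 i2 i3 by simp
  also have "norm \<dots> \<le> (LINT x|\<nu> s. K * (2 * C * (s' - s))\<^sup>2)"
  proof (rule Bochner_Integration.integral_norm_bound_integral)
    fix x
    have "\<bar>\<psi> (x + ?V x) - \<psi> x - d\<psi> x (?V x)\<bar> \<le> K * (norm (?V x))\<^sup>2"
      by (rule taylor_quadratic[OF C_infD(1)[OF smooth(1)] deriv_lipschitz K_nonneg])
    also have "norm (?V x) \<le> 2 * C * (s' - s)"
      using velocity_bound[OF \<nu>s, of A B x] mult_left_mono[of "A + manhattan B" "s' - s" "2 * C"] AB C_nonneg by simp
    then have "K * (norm (?V x))\<^sup>2 \<le> K * (2 * C * (s' - s))\<^sup>2"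
      using K_nonneg by (intro mult_left_mono power_mono) auto
    finally show "norm (\<psi> (x + ?V x) - \<psi> x - d\<psi> x (?V x)) \<le> K * (2 * C * (s' - s))\<^sup>2" by simp
  qed (use i1 i2 i3 in auto)
  finally have "\<bar>(LINT x|\<nu> s. \<psi> (x + ?V x)) - (LINT x|\<nu> s. \<psi> x) - (LINT x|\<nu> s. d\<psi> x (?V x))\<bar> \<le> K * (2 * C * (s' - s))\<^sup>2"
    by (simp add: prob_space)
  with 1 show ?thesis by linarith
qed

end

section \<open>Mollified observables\<close>

locale mollifier =
  fixes \<kappa> :: "'a::euclidean_space \<Rightarrow> real" and \<epsilon> :: real
  assumes \<kappa>_smooth: "C_inf \<kappa>" and \<kappa>_nonneg: "0 \<le> \<kappa> z" and \<kappa>_support: "\<epsilon> < norm z \<Longrightarrow> \<kappa> z = 0"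
    and \<kappa>_integrable: "integrable lborel \<kappa>" and \<kappa>_integral: "(LINT z|lborel. \<kappa> z) = 1"
begin

text \<open>The L^1 size of the gradient of \<kappa>, with partial derivatives summed. It bounds the
  variation of the gradient of a mollified 1-Lipschitz function and necessarily grows when the
  kernel is concentrated.\<close>

definition deriv_mass :: real
  where "deriv_mass = (LINT z|lborel. (\<Sum>b\<in>Basis. \<bar>frechet_derivative \<kappa> (at z) b\<bar>))"

lemma \<kappa>_bounded_support: "bounded_support \<kappa>"
  using \<kappa>_support unfolding bounded_support_def by blast

lemma \<kappa>_measurable [measurable]: "\<kappa> \<in> borel_measurable borel"
  using C_infD(3)[OF \<kappa>_smooth] by (rule borel_measurable_continuous_onI)

lemma deriv_mass_nonneg: "0 \<le> deriv_mass"
  unfolding deriv_mass_def by (intro Bochner_Integration.integral_nonneg sum_nonneg) auto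

lemma average_bound:
  fixes h :: "'a \<Rightarrow> real"
  assumes h: "integrable lborel (\<lambda>z. h z * \<kappa> z)" and c: "\<And>z. norm z \<le> \<epsilon> \<Longrightarrow> \<bar>h z\<bar> \<le> c"
  shows "\<bar>LINT z|lborel. h z * \<kappa> z\<bar> \<le> c"
proof -
  have "norm (LINT z|lborel. h z * \<kappa> z) \<le> (LINT z|lborel. c * \<kappa> z)"
  proof (rule Bochner_Integration.integral_norm_bound_integral[OF h])
    fix z
    show "norm (h z * \<kappa> z) \<le> c * \<kappa> z"
      using c[of z] \<kappa>_nonneg[of z] \<kappa>_support[of z]
      by (cases "norm z \<le> \<epsilon>") (auto simp: abs_mult intro: mult_right_mono)
  qed (use \<kappa>_integrable in auto)
  then show ?thesis by (simp add: \<kappa>_integral)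
qed

lemma product_integrable:
  assumes "continuous_on UNIV h"
  shows "integrable lborel (\<lambda>z. h z * \<kappa> z)"
proof (rule bounded_support_integrable)
  show "continuous_on UNIV (\<lambda>z. h z * \<kappa> z)" by (intro continuous_intros assms C_infD(3)[OF \<kappa>_smooth])
  show "bounded_support (\<lambda>z. h z * \<kappa> z)"
    using \<kappa>_support unfolding bounded_support_def by (intro exI[of _ \<epsilon>]) auto
qed

lemma mollified_eq:
  assumes "continuous_on UNIV \<phi>"
  shows "fun_convolution \<phi> \<kappa> x = (LINT z|lborel. \<phi> (x - z) * \<kappa> z)" "integrable lborel (\<lambda>z. \<phi> (x - z) * \<kappa> z)"
proof -
  show "fun_convolution \<phi> \<kappa> x = (LINT z|lborel. \<phi> (x - z) * \<kappa> z)"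
    by (rule fun_convolution_commute) (use borel_measurable_continuous_onI[OF assms] in auto)
  show "integrable lborel (\<lambda>z. \<phi> (x - z) * \<kappa> z)"
    by (intro product_integrable continuous_on_compose2[OF assms] continuous_intros) auto
qed

lemma mollified_close:
  assumes "1-lipschitz_on UNIV \<phi>"
  shows "\<bar>fun_convolution \<phi> \<kappa> x - \<phi> x\<bar> \<le> \<epsilon>"
proof -
  have \<phi>: "continuous_on UNIV \<phi>" using assms by (rule lipschitz_on_continuous_on)
  have i: "integrable lborel (\<lambda>z. (\<phi> (x - z) - \<phi> x) * \<kappa> z)"
    by (intro product_integrable continuous_intros continuous_on_compose2[OF \<phi>]) auto
  have "fun_convolution \<phi> \<kappa> x - \<phi> x = (LINT z|lborel. (\<phi> (x - z) - \<phi> x) * \<kappa> z)"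
    using mollified_eq(2)[OF \<phi>, of x] \<kappa>_integrable by (simp add: mollified_eq(1)[OF \<phi>] left_diff_distrib \<kappa>_integral)
  moreover have "\<bar>\<phi> (x - z) - \<phi> x\<bar> \<le> \<epsilon>" if "norm z \<le> \<epsilon>" for z
    using lipschitz_onD[OF assms, of "x - z" x] that by (simp add: dist_norm)
  ultimately show ?thesis using average_bound[OF i, of \<epsilon>] by simp
qed

text \<open>Averaging over translates keeps the Lipschitz constant 1, hence the bound on the
  derivative independent of \<kappa>. For the variation of the derivative one differentiation is put
  on \<kappa> and the other replaced by the Lipschitz property of \<phi>.\<close>

lemma mollified_observable:
  fixes \<phi> :: "'a \<Rightarrow> real"
  assumes \<phi>: "1-lipschitz_on UNIV \<phi>" "bounded_support \<phi>"
  shows "C_inf (fun_convolution \<phi> \<kappa>)" "bounded_support (fun_convolution \<phi> \<kappa>)"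
    and "\<bar>frechet_derivative (fun_convolution \<phi> \<kappa>) (at x) v\<bar> \<le> norm v"
    and "\<bar>frechet_derivative (fun_convolution \<phi> \<kappa>) (at x) v - frechet_derivative (fun_convolution \<phi> \<kappa>) (at y) v\<bar>
      \<le> deriv_mass * norm (x - y) * norm v"
proof -
  have cont: "continuous_on UNIV \<phi>" using \<phi>(1) by (rule lipschitz_on_continuous_on)
  note int = bounded_support_integrable[OF cont \<phi>(2)]
  show C: "C_inf (fun_convolution \<phi> \<kappa>)" by (rule C_inf_fun_convolution[OF int \<kappa>_smooth \<kappa>_bounded_support])
  show bs: "bounded_support (fun_convolution \<phi> \<kappa>)" by (rule bounded_support_fun_convolution[OF \<phi>(2) \<kappa>_bounded_support])
  let ?D = "\<lambda>x v. frechet_derivative (fun_convolution \<phi> \<kappa>) (at x) v"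
  let ?K = "\<lambda>z v. frechet_derivative \<kappa> (at z) v"
  have lip: "\<bar>\<phi> a - \<phi> b\<bar> \<le> norm (a - b)" for a b using lipschitz_onD[OF \<phi>(1), of a b] by (simp add: dist_norm)
  have Kint: "integrable lborel (\<lambda>z. ?K z v)" for v
    by (intro bounded_support_integrable C_infD(3)[OF C_infD(2)[OF \<kappa>_smooth]] bounded_support_deriv \<kappa>_bounded_support)
  have Kc: "continuous_on UNIV (\<lambda>z. ?K z v)" for v by (rule C_infD(3)[OF C_infD(2)[OF \<kappa>_smooth]])
  have D: "?D x v = (LINT z|lborel. \<phi> (x - z) * ?K z v)" for x v
  proof -
    have "?D x v = fun_convolution \<phi> (\<lambda>z. ?K z v) x"
      using frechet_derivative_at[OF fun_convolution_has_derivative[OF int \<kappa>_smooth \<kappa>_bounded_support]] by metis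
    also have "\<dots> = (LINT z|lborel. \<phi> (x - z) * ?K z v)"
      by (rule fun_convolution_commute) (use cont Kc in \<open>auto intro: borel_measurable_continuous_onI\<close>)
    finally show ?thesis .
  qed
  have Dint: "integrable lborel (\<lambda>z. \<phi> (x - z) * ?K z v)" for x v
  proof (rule bounded_support_integrable)
    show "continuous_on UNIV (\<lambda>z. \<phi> (x - z) * ?K z v)"
      by (intro continuous_intros continuous_on_compose2[OF cont] Kc) auto
    show "bounded_support (\<lambda>z. \<phi> (x - z) * ?K z v)"
      using bounded_support_deriv[OF \<kappa>_bounded_support, of v] unfolding bounded_support_def by auto
  qed
  show Dlip: "\<bar>?D x v - ?D y v\<bar> \<le> deriv_mass * norm (x - y) * norm v" for x y v
  proof -
    have "?D x v - ?D y v = (LINT z|lborel. (\<phi> (x - z) - \<phi> (y - z)) * ?K z v)"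
      unfolding D using Dint[of x v] Dint[of y v] by (simp add: left_diff_distrib)
    also have "norm \<dots> \<le> (LINT z|lborel. norm (x - y) * ((\<Sum>b\<in>Basis. \<bar>?K z b\<bar>) * norm v))"
    proof (rule Bochner_Integration.integral_norm_bound_integral)
      show "integrable lborel (\<lambda>z. (\<phi> (x - z) - \<phi> (y - z)) * ?K z v)"
        using Dint[of x v] Dint[of y v] by (simp add: left_diff_distrib)
      show "integrable lborel (\<lambda>z. norm (x - y) * ((\<Sum>b\<in>Basis. \<bar>?K z b\<bar>) * norm v))"
        using Kint by auto
      fix z
      have "\<bar>?K z v\<bar> \<le> (\<Sum>b\<in>Basis. \<bar>?K z b\<bar>) * norm v"
        by (rule linear_basis_bound[OF C_inf_linear_deriv[OF \<kappa>_smooth]]) simp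
      then show "norm ((\<phi> (x - z) - \<phi> (y - z)) * ?K z v) \<le> norm (x - y) * ((\<Sum>b\<in>Basis. \<bar>?K z b\<bar>) * norm v)"
        using lip[of "x - z" "y - z"] by (simp add: abs_mult mult_mono)
    qed
    also have "\<dots> = deriv_mass * norm (x - y) * norm v"
      unfolding deriv_mass_def by simp
    finally show ?thesis by simp
  qed
  have clip: "\<bar>fun_convolution \<phi> \<kappa> a - fun_convolution \<phi> \<kappa> b\<bar> \<le> norm (a - b)" for a b
  proof -
    have i: "integrable lborel (\<lambda>z. (\<phi> (a - z) - \<phi> (b - z)) * \<kappa> z)"
      by (intro product_integrable continuous_intros continuous_on_compose2[OF cont]) auto
    have "fun_convolution \<phi> \<kappa> a - fun_convolution \<phi> \<kappa> b = (LINT z|lborel. (\<phi> (a - z) - \<phi> (b - z)) * \<kappa> z)"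
      using mollified_eq(2)[OF cont, of a] mollified_eq(2)[OF cont, of b] by (simp add: mollified_eq(1)[OF cont] left_diff_distrib)
    then show ?thesis using average_bound[OF i, of "norm (a - b)"] lip[of "a - z" "b - z" for z] by simp
  qed
  \<comment> \<open>The bound is read off from the Lipschitz constant: Taylor's estimate along t v
    is divided by t, and t tends to 0.\<close>
  show "\<bar>?D x v\<bar> \<le> norm v"
  proof (rule tendsto_lowerbound)
    show "((\<lambda>t. norm v + deriv_mass * t * (norm v)\<^sup>2) \<longlongrightarrow> norm v) (at_right 0)"
      by (auto intro!: tendsto_eq_intros)
    show "\<forall>\<^sub>F t in at_right 0. \<bar>?D x v\<bar> \<le> norm v + deriv_mass * t * (norm v)\<^sup>2"
      unfolding eventually_at_right_field
    proof (intro exI[of _ 1] conjI allI impI)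
      fix t :: real assume t: "0 < t" "t < 1"
      have "\<bar>fun_convolution \<phi> \<kappa> (x + t *\<^sub>R v) - fun_convolution \<phi> \<kappa> x - ?D x (t *\<^sub>R v)\<bar> \<le> deriv_mass * (norm (t *\<^sub>R v))\<^sup>2"
        by (rule taylor_quadratic[OF C_infD(1)[OF C] Dlip deriv_mass_nonneg])
      then have "\<bar>?D x (t *\<^sub>R v)\<bar> \<le> norm (t *\<^sub>R v) + deriv_mass * (norm (t *\<^sub>R v))\<^sup>2"
        using clip[of "x + t *\<^sub>R v" x] by simp
      then have "t * \<bar>?D x v\<bar> \<le> t * (norm v + deriv_mass * t * (norm v)\<^sup>2)"
        using t by (simp add: linear_scale[OF C_inf_linear_deriv[OF C]] abs_mult power_mult_distrib power2_eq_square algebra_simps)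
      then show "\<bar>?D x v\<bar> \<le> norm v + deriv_mass * t * (norm v)\<^sup>2" using t by simp
    qed simp
  qed simp
qed

end

subsection \<open>The nonlocal flow and its law\<close>

lemma lebesgue_on_borel_measurable:
  fixes h :: "real \<Rightarrow> 'a::euclidean_space"
  shows "h \<in> borel_measurable borel \<Longrightarrow> h \<in> borel_measurable (lebesgue_on A)"
  by (intro measurable_restrict_space1 measurable_completion) simp

lemma distr_P1:
  fixes X :: "real ^ 'n \<Rightarrow> real ^ 'n"
  assumes \<theta>: "\<theta> \<in> P1" and X: "X \<in> borel_measurable borel" and B: "\<And>x. norm (X x - x) \<le> B"
  shows "distr \<theta> borel X \<in> P1"
proof -
  interpret prob_space \<theta> using \<theta> by (rule P1_prob_space)
  have m: "X \<in> measurable \<theta> borel" using X by (simp add: P1_borel_measurable[OF \<theta>])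
  have bd: "manhattan (X x) \<le> CARD('n) * (norm x + B)" for x
  proof -
    have "norm (X x) \<le> norm x + B" using norm_triangle_sub[of "X x" x] B[of x] by linarith
    then have "CARD('n) * norm (X x) \<le> CARD('n) * (norm x + B)" by (intro mult_left_mono) auto
    then show ?thesis by (rule order_trans[OF manhattan_le_norm])
  qed
  have le: "norm (manhattan (X x)) \<le> norm (CARD('n) * (norm x + B))" for x
    unfolding real_norm_def abs_of_nonneg[OF manhattan_nonneg] by (rule order_trans[OF bd abs_ge_self])
  have "integrable \<theta> (\<lambda>x. CARD('n) * (norm x + B))"
    using P1_integrable_norm[OF \<theta>] by simp
  then have "integrable \<theta> (\<lambda>x. manhattan (X x))"
    by (rule Bochner_Integration.integrable_bound[OF _ _ AE_I2[OF le]]) (use m in measurable)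
  then show ?thesis
    unfolding P1_def using prob_space_distr[OF m] by (auto simp: integrable_distr_eq[OF m])
qed

locale controlled_velocity = velocity_data f\<^sub>0 g f C L
  for f\<^sub>0 g :: "real ^ 'n \<Rightarrow> real ^ 'n" and f :: "'m::finite \<Rightarrow> real ^ 'n \<Rightarrow> real ^ 'n" and C L +
  fixes \<theta> :: "(real ^ 'n) measure" and T U :: real and u :: "real \<Rightarrow> real ^ 'm"
  assumes \<theta>: "\<theta> \<in> P1" and T_pos: "0 < T" and u_measurable: "u \<in> borel_measurable borel"
    and u_bound: "manhattan (u t) \<le> U"
begin

lemma U_nonneg: "0 \<le> U"
  using order_trans[OF manhattan_nonneg u_bound] .

lemma convol_distr:
  assumes "X \<in> borel_measurable borel"
  shows "convol g (distr \<theta> borel X) z = (LINT y|\<theta>. g (z - X y))"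
  unfolding convol_def
  by (subst integral_distr)
     (use assms lipschitz_measurable[OF g_lipschitz_on, of z] in \<open>auto simp: P1_borel_measurable[OF \<theta>]\<close>)

text \<open>Particles interact only through the law of their positions. Taking the family of
  positions as the unknown, instead of the curve of measures, makes the nonlocal equation a fixed
  point problem in a space of functions.\<close>

definition particle_velocity :: "(real \<Rightarrow> real ^ 'n \<Rightarrow> real ^ 'n) \<Rightarrow> real \<Rightarrow> real ^ 'n \<Rightarrow> real ^ 'n"
  where "particle_velocity X t x = velocity 1 (u t) (distr \<theta> borel (X t)) (X t x)"

context
  fixes X :: "real \<Rightarrow> real ^ 'n \<Rightarrow> real ^ 'n" and B :: real
  assumes X_cont: "continuous_on UNIV (\<lambda>z. X (fst z) (snd z))" and X_bound: "\<And>t x. norm (X t x - x) \<le> B"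
begin

lemma X_cont_space: "continuous_on A (X t)"
  by (rule continuous_on_compose2[OF X_cont, of A "\<lambda>x. (t, x)", simplified]) (auto intro: continuous_intros)

lemma X_measurable: "X t \<in> borel_measurable borel"
  by (rule borel_measurable_continuous_onI[OF X_cont_space])

lemma X_P1: "distr \<theta> borel (X t) \<in> P1"
  by (rule distr_P1[OF \<theta> X_measurable X_bound])

text \<open>The time dependence hidden in the law becomes explicit when the convolution is written
  as an integral over initial positions; dominated convergence with the constant C then gives joint
  continuity.\<close>

lemma convol_continuous:
  "continuous_on UNIV (\<lambda>z. convol g (distr \<theta> borel (X (fst z))) (X (fst z) (snd z)))"
proof (rule continuous_on_sequentiallyI)
  fix z :: "nat \<Rightarrow> real \<times> (real ^ 'n)" and a
  assume z: "z \<longlonglongrightarrow> a"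
  have lim: "(\<lambda>k. X (fst (w k)) (snd (w k))) \<longlonglongrightarrow> X (fst b) (snd b)" if "w \<longlonglongrightarrow> b" for w b
    using X_cont that unfolding continuous_on_sequentially o_def by blast
  have g_cont: "continuous_on UNIV g"
    by (rule lipschitz_on_continuous_on[of L])
       (use g_lipschitz L_nonneg in \<open>auto intro!: lipschitz_onI simp: dist_norm\<close>)
  interpret prob_space \<theta> using \<theta> by (rule P1_prob_space)
  show "(\<lambda>k. convol g (distr \<theta> borel (X (fst (z k)))) (X (fst (z k)) (snd (z k))))
      \<longlonglongrightarrow> convol g (distr \<theta> borel (X (fst a))) (X (fst a) (snd a))"
    unfolding convol_distr[OF X_measurable]
  proof (rule integral_dominated_convergence[where w = "\<lambda>y. C"])
    have "(\<lambda>y. g (c - X t y)) \<in> borel_measurable borel" for c t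
      by (intro borel_measurable_continuous_onI continuous_on_compose2[OF g_cont] continuous_intros X_cont_space) auto
    then have m: "(\<lambda>y. g (c - X t y)) \<in> borel_measurable \<theta>" for c t
      by (simp add: P1_borel_measurable[OF \<theta>])
    show "(\<lambda>y. g (X (fst a) (snd a) - X (fst a) y)) \<in> borel_measurable \<theta>" by (rule m)
    show "(\<lambda>y. g (X (fst (z k)) (snd (z k)) - X (fst (z k)) y)) \<in> borel_measurable \<theta>" for k by (rule m)
    show "AE y in \<theta>. (\<lambda>k. g (X (fst (z k)) (snd (z k)) - X (fst (z k)) y)) \<longlonglongrightarrow> g (X (fst a) (snd a) - X (fst a) y)"
    proof (rule AE_I2)
      fix y
      have "(\<lambda>k. X (fst (z k)) y) \<longlonglongrightarrow> X (fst a) y"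
        using lim[of "\<lambda>k. (fst (z k), y)" "(fst a, y)"] tendsto_fst[OF z] by (simp add: tendsto_Pair)
      then have "(\<lambda>k. X (fst (z k)) (snd (z k)) - X (fst (z k)) y) \<longlonglongrightarrow> X (fst a) (snd a) - X (fst a) y"
        by (intro tendsto_diff lim[OF z])
      then show "(\<lambda>k. g (X (fst (z k)) (snd (z k)) - X (fst (z k)) y)) \<longlonglongrightarrow> g (X (fst a) (snd a) - X (fst a) y)"
        using g_cont unfolding continuous_on_sequentially o_def by blast
    qed
  qed (auto simp: g_bound)
qed

lemma particle_velocity_eq:
  "particle_velocity X t x = f\<^sub>0 (X t x) + convol g (distr \<theta> borel (X t)) (X t x) + (\<Sum>i\<in>UNIV. (u t $ i) *\<^sub>R f i (X t x))"
  unfolding particle_velocity_def velocity_def by simp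

lemma field_continuous:
  "continuous_on UNIV (\<lambda>z. f\<^sub>0 (X (fst z) (snd z)))" "continuous_on UNIV (\<lambda>z. f i (X (fst z) (snd z)))"
proof -
  have "L-lipschitz_on UNIV f\<^sub>0" "L-lipschitz_on UNIV (f i)"
    using f\<^sub>0_lipschitz f_lipschitz L_nonneg by (auto intro!: lipschitz_onI simp: dist_norm)
  then show "continuous_on UNIV (\<lambda>z. f\<^sub>0 (X (fst z) (snd z)))" "continuous_on UNIV (\<lambda>z. f i (X (fst z) (snd z)))"
    by (auto intro: continuous_on_compose2[OF lipschitz_on_continuous_on X_cont])
qed

lemma particle_velocity_measurable:
  "(\<lambda>z. particle_velocity X (fst z) (snd z)) \<in> borel_measurable borel"
proof -
  have u: "(\<lambda>z :: real \<times> (real ^ 'n). u (fst z) $ i) \<in> borel_measurable borel" for i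
  proof -
    have 1: "(\<lambda>v :: real ^ 'm. v $ i) \<in> borel_measurable borel" and 2: "(fst :: real \<times> (real ^ 'n) \<Rightarrow> real) \<in> borel_measurable borel"
      by (intro borel_measurable_continuous_onI continuous_intros)+
    show ?thesis by (rule measurable_compose[OF 2 measurable_compose[OF u_measurable 1]])
  qed
  show ?thesis
    unfolding particle_velocity_eq
    by (intro borel_measurable_add borel_measurable_sum borel_measurable_scaleR u
        borel_measurable_continuous_onI[OF convol_continuous] borel_measurable_continuous_onI[OF field_continuous(1)]
        borel_measurable_continuous_onI[OF field_continuous(2)])
qed

lemma particle_velocity_measurable_time:
  "(\<lambda>t. particle_velocity X t x) \<in> borel_measurable borel"
  using measurable_compose[OF borel_measurable_Pair[OF measurable_ident_sets[OF refl] borel_measurable_const] particle_velocity_measurable, of x]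
  by simp

lemma particle_velocity_bound: "norm (particle_velocity X t x) \<le> 2 * C * (1 + manhattan (u t))"
  unfolding particle_velocity_def using velocity_bound[OF X_P1, of 1 "u t" t "X t x"] by simp

lemma particle_velocity_bound': "norm (particle_velocity X t x) \<le> 2 * C * (1 + U)"
  by (rule order_trans[OF particle_velocity_bound]) (use u_bound C_nonneg in \<open>auto intro: mult_left_mono\<close>)

lemma particle_velocity_integrable: "integrable (lebesgue_on {a..b}) (\<lambda>t. particle_velocity X t x)"
  by (rule lebesgue_on_integrable_bounded[OF lebesgue_on_borel_measurable[OF particle_velocity_measurable_time], where B = "2 * C * (1 + U)"])
     (rule AE_I2, rule particle_velocity_bound')

lemma particle_velocity_section_continuous:
  assumes "z \<longlonglongrightarrow> x" shows "(\<lambda>k. particle_velocity X t (z k)) \<longlonglongrightarrow> particle_velocity X t x"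
proof -
  have lim: "(\<lambda>k. h (t, z k)) \<longlonglongrightarrow> h (t, x)" if "continuous_on UNIV h" for h :: "real \<times> (real ^ 'n) \<Rightarrow> real ^ 'n"
    using that tendsto_Pair[OF tendsto_const[of t] assms] unfolding continuous_on_sequentially o_def by auto
  show ?thesis
    unfolding particle_velocity_eq
    using lim[OF convol_continuous] lim[OF field_continuous(1)] lim[OF field_continuous(2)]
    by (intro tendsto_add tendsto_sum tendsto_scaleR tendsto_const) auto
qed

end

text \<open>The term with U comes from the particle's own position. The other comes from the law,
  with one dimension factor from \<open>convol_W1\<close> and one from
  \<open>W1_distr_le\<close>.\<close>

lemma particle_velocity_diff:
  assumes X: "continuous_on UNIV (\<lambda>z. X (fst z) (snd z))" "\<And>t x. norm (X t x - x) \<le> B"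
    and Y: "continuous_on UNIV (\<lambda>z. Y (fst z) (snd z))" "\<And>t x. norm (Y t x - x) \<le> B'"
    and c: "\<And>x. norm (X t x - Y t x) \<le> c"
  shows "norm (particle_velocity X t x - particle_velocity Y t x) \<le> (2 * L * (1 + U) + CARD('n) * L * CARD('n)) * c"
proof -
  let ?\<mu> = "distr \<theta> borel (X t)" and ?\<nu> = "distr \<theta> borel (Y t)"
  note P = X_P1[OF X] X_P1[OF Y]
  have "0 \<le> c" using c[of 0] norm_ge_zero order_trans by blast
  have w: "W1 ?\<mu> ?\<nu> \<le> CARD('n) * c"
    by (rule W1_distr_le[OF \<theta> X_measurable[OF X] P(1) X_measurable[OF Y] P(2) c])
  have "norm (velocity 1 (u t) ?\<mu> (X t x) - velocity 1 (u t) ?\<mu> (Y t x)) \<le> 2 * L * (\<bar>1\<bar> + manhattan (u t)) * norm (X t x - Y t x)"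
    by (rule velocity_lipschitz[OF P(1)])
  also have "\<dots> \<le> 2 * L * (1 + U) * c"
    using L_nonneg u_bound[of t] c[of x] U_nonneg by (intro mult_mono) auto
  finally have 1: "norm (velocity 1 (u t) ?\<mu> (X t x) - velocity 1 (u t) ?\<mu> (Y t x)) \<le> 2 * L * (1 + U) * c" .
  have "norm (velocity 1 (u t) ?\<mu> (Y t x) - velocity 1 (u t) ?\<nu> (Y t x)) \<le> \<bar>1\<bar> * (CARD('n) * L * W1 ?\<mu> ?\<nu>)"
    by (rule velocity_W1[OF P])
  also have "\<dots> \<le> CARD('n) * L * (CARD('n) * c)"
    using w L_nonneg by (simp add: mult_left_mono)
  finally have 2: "norm (velocity 1 (u t) ?\<mu> (Y t x) - velocity 1 (u t) ?\<nu> (Y t x)) \<le> CARD('n) * L * CARD('n) * c" by simp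
  have "particle_velocity X t x - particle_velocity Y t x =
     (velocity 1 (u t) ?\<mu> (X t x) - velocity 1 (u t) ?\<mu> (Y t x)) + (velocity 1 (u t) ?\<mu> (Y t x) - velocity 1 (u t) ?\<nu> (Y t x))"
    unfolding particle_velocity_def by simp
  also have "norm \<dots> \<le> (2 * L * (1 + U) * c) + (CARD('n) * L * CARD('n) * c)"
    by (rule norm_triangle_le[OF add_mono[OF 1 2]])
  finally show ?thesis by (simp add: algebra_simps)
qed

text \<open>Freezing time outside [0, T] lets all maps live on the full space of times and
  positions, so that the fixed point is taken in the type of bounded continuous functions.\<close>

definition clamp_time :: "real \<Rightarrow> real"
  where "clamp_time t = max 0 (min T t)"

lemma clamp_time_range: "0 \<le> clamp_time t" "clamp_time t \<le> T"
  using T_pos by (auto simp: clamp_time_def)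

lemma continuous_on_clamp_time: "continuous_on A clamp_time"
  unfolding clamp_time_def by (intro continuous_intros)

lemma particle_position_continuous:
  assumes X: "continuous_on UNIV (\<lambda>z. X (fst z) (snd z))" "\<And>t x. norm (X t x - x) \<le> B"
  shows "continuous_on UNIV (\<lambda>z. LINT r|lebesgue_on {0..clamp_time (fst z)}. particle_velocity X r (snd z))"
proof (rule continuous_on_sequentiallyI)
  fix z :: "nat \<Rightarrow> real \<times> (real ^ 'n)" and a
  assume z: "z \<longlonglongrightarrow> a"
  let ?c = "clamp_time (fst a)"
  have c: "(\<lambda>k. clamp_time (fst (z k))) \<longlonglongrightarrow> ?c"
    using continuous_on_clamp_time[of UNIV] tendsto_fst[OF z] unfolding continuous_on_sequentially o_def by blast
  \<comment> \<open>The moving end point is put into an indicator over a fixed interval, so that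
    dominated convergence applies in time and position at once.\<close>
  have eq: "(LINT r|lebesgue_on {0..clamp_time t}. h r) = (LINT r|lebesgue_on {0..T}. indicator {..clamp_time t} r *\<^sub>R h r)"
    for t and h :: "real \<Rightarrow> real ^ 'n"
  proof -
    have "(LINT r|lebesgue_on {0..T}. indicator {..clamp_time t} r *\<^sub>R h r) = (LINT r|lebesgue. indicator {0..T} r *\<^sub>R indicator {..clamp_time t} r *\<^sub>R h r)"
      by (rule integral_restrict_space) auto
    also have "\<dots> = (LINT r|lebesgue. indicator {0..clamp_time t} r *\<^sub>R h r)"
      using clamp_time_range[of t] by (intro Bochner_Integration.integral_cong) (auto simp: indicator_def)
    also have "\<dots> = (LINT r|lebesgue_on {0..clamp_time t}. h r)"
      by (rule integral_restrict_space[symmetric]) auto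
    finally show ?thesis ..
  qed
  show "(\<lambda>k. LINT r|lebesgue_on {0..clamp_time (fst (z k))}. particle_velocity X r (snd (z k)))
     \<longlonglongrightarrow> (LINT r|lebesgue_on {0..?c}. particle_velocity X r (snd a))"
    unfolding eq
  proof (rule integral_dominated_convergence[where w = "\<lambda>r. 2 * C * (1 + U)"])
    show "(\<lambda>r. indicator {..?c} r *\<^sub>R particle_velocity X r (snd a)) \<in> borel_measurable (lebesgue_on {0..T})"
      "(\<lambda>r. indicator {..clamp_time (fst (z k))} r *\<^sub>R particle_velocity X r (snd (z k))) \<in> borel_measurable (lebesgue_on {0..T})" for k
      by (intro lebesgue_on_borel_measurable borel_measurable_scaleR particle_velocity_measurable_time[OF X] borel_measurable_indicator; simp)+
    have "AE r in lebesgue_on {0..T}. r \<notin> {?c}"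
      by (rule AE_I'[of "{?c}"]) (use clamp_time_range[of "fst a"] in \<open>auto simp: null_sets_restrict_space\<close>)
    then show "AE r in lebesgue_on {0..T}. (\<lambda>k. indicator {..clamp_time (fst (z k))} r *\<^sub>R particle_velocity X r (snd (z k)))
        \<longlonglongrightarrow> indicator {..?c} r *\<^sub>R particle_velocity X r (snd a)"
    proof (rule eventually_mono)
      fix r assume r: "r \<notin> {?c}"
      have "(\<lambda>k. indicator {..clamp_time (fst (z k))} r :: real) \<longlonglongrightarrow> indicator {..?c} r"
      proof (cases "r < ?c")
        case True
        then show ?thesis
          by (intro tendsto_eventually eventually_mono[OF order_tendstoD(1)[OF c True]]) auto
      next
        case False
        then have "?c < r" using r by simp
        then show ?thesis
          by (intro tendsto_eventually eventually_mono[OF order_tendstoD(2)[OF c \<open>?c < r\<close>]]) auto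
      qed
      then show "(\<lambda>k. indicator {..clamp_time (fst (z k))} r *\<^sub>R particle_velocity X r (snd (z k)))
        \<longlonglongrightarrow> indicator {..?c} r *\<^sub>R particle_velocity X r (snd a)"
        by (intro tendsto_scaleR particle_velocity_section_continuous[OF X] tendsto_snd[OF z])
    qed
    show "AE r in lebesgue_on {0..T}. norm (indicator {..clamp_time (fst (z k))} r *\<^sub>R particle_velocity X r (snd (z k))) \<le> 2 * C * (1 + U)" for k
    proof (rule AE_I2)
      fix r
      have "norm (indicator {..clamp_time (fst (z k))} r *\<^sub>R particle_velocity X r (snd (z k))) \<le> norm (particle_velocity X r (snd (z k)))"
        by (simp add: indicator_def)
      then show "norm (indicator {..clamp_time (fst (z k))} r *\<^sub>R particle_velocity X r (snd (z k))) \<le> 2 * C * (1 + U)"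
        using particle_velocity_bound'[OF X, of r "snd (z k)"] by linarith
    qed
  qed (simp add: lebesgue_on_integrable_const)
qed

text \<open>Picard iteration for the displacement, in the exponentially weighted supremum norm in which
  the iteration map is a contraction on the whole interval \<open>[0, T]\<close>.\<close>

lemma flow_exists:
  obtains X B where "continuous_on UNIV (\<lambda>z. X (fst z) (snd z))" "\<And>t x. norm (X t x - x) \<le> B"
    "\<And>t x. t \<in> {0..T} \<Longrightarrow> X t x = x + (LINT r|lebesgue_on {0..t}. particle_velocity X r x)"
proof -
  \<comment> \<open>At least twice the Lipschitz constant of \<open>particle_velocity_diff\<close>,
    which makes the contraction factor 1/2; the summand 1 keeps it positive when L vanishes.\<close>
  define \<gamma> where "\<gamma> = 2 * (2 * L * (1 + U) + CARD('n) * L * CARD('n)) + 1"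
  have \<gamma>: "0 < \<gamma>" "2 * L * (1 + U) + CARD('n) * L * CARD('n) \<le> \<gamma> / 2"
    using L_nonneg U_nonneg by (auto simp: \<gamma>_def intro!: add_nonneg_pos)
  \<comment> \<open>Positions are unbounded, displacements are not: the unknown is the displacement
    divided by the exponential weight.\<close>
  define pos :: "((real \<times> (real ^ 'n)) \<Rightarrow>\<^sub>C (real ^ 'n)) \<Rightarrow> real \<Rightarrow> real ^ 'n \<Rightarrow> real ^ 'n"
    where "pos Z t x = x + exp (\<gamma> * clamp_time t) *\<^sub>R apply_bcontfun Z (t, x)" for Z t x
  have pos_cont: "continuous_on UNIV (\<lambda>z. pos Z (fst z) (snd z))" for Z
    unfolding pos_def
    by (intro continuous_intros continuous_on_compose2[OF continuous_on_clamp_time] continuous_on_apply_bcontfun) auto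
  have exp_le: "exp (\<gamma> * clamp_time t) \<le> exp (\<gamma> * T)" for t
    using clamp_time_range[of t] \<gamma>(1) by simp
  have pos_bound: "norm (pos Z t x - x) \<le> exp (\<gamma> * T) * norm Z" for Z t x
    unfolding pos_def using exp_le[of t] norm_bounded[of Z "(t, x)"] by (simp add: mult_mono)
  define F where "F Z z = exp (- \<gamma> * clamp_time (fst z)) *\<^sub>R (LINT r|lebesgue_on {0..clamp_time (fst z)}. particle_velocity (pos Z) r (snd z))" for Z z
  have F_bcont: "F Z \<in> bcontfun" for Z
  proof (rule bcontfun_normI)
    show "continuous_on UNIV (F Z)"
      unfolding F_def
      by (intro continuous_intros particle_position_continuous[OF pos_cont pos_bound] continuous_on_compose2[OF continuous_on_clamp_time]) auto
    show "norm (F Z z) \<le> 2 * C * (1 + U) * T" for z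
    proof -
      let ?c = "clamp_time (fst z)"
      have "norm (LINT r|lebesgue_on {0..?c}. particle_velocity (pos Z) r (snd z)) \<le> (LINT r|lebesgue_on {0..?c}. 2 * C * (1 + U))"
        by (rule Bochner_Integration.integral_norm_bound_integral[OF particle_velocity_integrable[OF pos_cont pos_bound]])
           (auto simp: lebesgue_on_integrable_const intro: particle_velocity_bound'[OF pos_cont pos_bound])
      also have "\<dots> = ?c * (2 * C * (1 + U))"
        using lebesgue_on_integral_const[OF clamp_time_range(1)[of "fst z"], of "2 * C * (1 + U)"] by simp
      also have "\<dots> \<le> T * (2 * C * (1 + U))"
        using clamp_time_range[of "fst z"] C_nonneg U_nonneg by (intro mult_right_mono) auto
      finally have "norm (LINT r|lebesgue_on {0..?c}. particle_velocity (pos Z) r (snd z)) \<le> T * (2 * C * (1 + U))" .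
      moreover have "exp (- \<gamma> * ?c) \<le> 1" using clamp_time_range[of "fst z"] \<gamma>(1) by simp
      ultimately have "exp (- \<gamma> * ?c) * norm (LINT r|lebesgue_on {0..?c}. particle_velocity (pos Z) r (snd z)) \<le> 1 * (T * (2 * C * (1 + U)))"
        by (intro mult_mono) auto
      then show ?thesis unfolding F_def by (simp add: mult_ac)
    qed
  qed
  define \<Phi> where "\<Phi> Z = Bcontfun (F Z)" for Z
  have \<Phi>_apply: "apply_bcontfun (\<Phi> Z) = F Z" for Z
    unfolding \<Phi>_def by (rule Bcontfun_inverse[OF F_bcont])
  have contr: "dist (\<Phi> Z) (\<Phi> Z') \<le> (1 / 2) * dist Z Z'" for Z Z'
  proof (rule dist_bound)
    fix z :: "real \<times> (real ^ 'n)"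
    obtain t x where z: "z = (t, x)" by (cases z)
    let ?c = "clamp_time t" and ?p = "\<lambda>Z r. particle_velocity (pos Z) r x"
    note int = particle_velocity_integrable[OF pos_cont pos_bound, where x = x and a = 0 and b = ?c]
    have c: "0 \<le> ?c" by (rule clamp_time_range)
    have d: "norm (?p Z r - ?p Z' r) \<le> (\<gamma> / 2 * dist Z Z') * exp (\<gamma> * r)" if "r \<in> {0..?c}" for r
    proof -
      have "0 \<le> r" "r \<le> T" using that clamp_time_range[of t] by auto
      then have r: "clamp_time r = r" by (simp add: clamp_time_def)
      have "norm (pos Z r y - pos Z' r y) \<le> exp (\<gamma> * r) * dist Z Z'" for y
      proof -
        have "pos Z r y - pos Z' r y = exp (\<gamma> * r) *\<^sub>R (apply_bcontfun Z (r, y) - apply_bcontfun Z' (r, y))"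
          unfolding pos_def r by (simp add: scaleR_diff_right)
        then show ?thesis using dist_bounded[of Z "(r, y)" Z'] by (simp add: dist_norm)
      qed
      then have "norm (?p Z r - ?p Z' r) \<le> (2 * L * (1 + U) + CARD('n) * L * CARD('n)) * (exp (\<gamma> * r) * dist Z Z')"
        by (rule particle_velocity_diff[OF pos_cont pos_bound pos_cont pos_bound])
      also have "\<dots> \<le> \<gamma> / 2 * (exp (\<gamma> * r) * dist Z Z')"
        using \<gamma>(2) by (intro mult_right_mono) auto
      finally show ?thesis by (simp add: mult_ac)
    qed
    \<comment> \<open>Integrating the weight gains the factor 1 / \<gamma>, which compensates the
      Lipschitz constant however large T is.\<close>
    have "((\<lambda>r. exp (\<gamma> * r)) has_integral exp (\<gamma> * ?c) / \<gamma> - exp (\<gamma> * 0) / \<gamma>) {0..?c}"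
      by (rule fundamental_theorem_of_calculus[OF c])
         (use \<gamma>(1) in \<open>auto intro!: derivative_eq_intros simp flip: has_real_derivative_iff_has_vector_derivative\<close>)
    then have ei: "integral {0..?c} (\<lambda>r. exp (\<gamma> * r)) = (exp (\<gamma> * ?c) - 1) / \<gamma>"
      by (simp add: integral_unique diff_divide_distrib)
    have eint: "integrable (lebesgue_on {0..?c}) (\<lambda>r. exp (\<gamma> * r))"
      by (intro continuous_imp_integrable_real continuous_intros)
    have "norm ((LINT r|lebesgue_on {0..?c}. ?p Z r) - (LINT r|lebesgue_on {0..?c}. ?p Z' r))
        = norm (LINT r|lebesgue_on {0..?c}. ?p Z r - ?p Z' r)"
      by (simp add: Bochner_Integration.integral_diff[OF int int])
    also have "\<dots> \<le> (LINT r|lebesgue_on {0..?c}. (\<gamma> / 2 * dist Z Z') * exp (\<gamma> * r))"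
      by (rule Bochner_Integration.integral_norm_bound_integral[OF Bochner_Integration.integrable_diff[OF int int]])
         (use eint d in auto)
    also have "\<dots> = (\<gamma> / 2 * dist Z Z') * ((exp (\<gamma> * ?c) - 1) / \<gamma>)"
      using eint by (simp add: lebesgue_on_integral_eq ei)
    also have "\<dots> \<le> (1 / 2 * dist Z Z') * exp (\<gamma> * ?c)"
      using \<gamma>(1) by (simp add: field_simps)
    finally have i: "norm ((LINT r|lebesgue_on {0..?c}. ?p Z r) - (LINT r|lebesgue_on {0..?c}. ?p Z' r)) \<le> (1 / 2 * dist Z Z') * exp (\<gamma> * ?c)" .
    have "dist (F Z z) (F Z' z) = exp (- \<gamma> * ?c) * norm ((LINT r|lebesgue_on {0..?c}. ?p Z r) - (LINT r|lebesgue_on {0..?c}. ?p Z' r))"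
      unfolding F_def z dist_norm by (simp add: scaleR_diff_right[symmetric])
    also have "\<dots> \<le> exp (- \<gamma> * ?c) * ((1 / 2 * dist Z Z') * exp (\<gamma> * ?c))"
      by (intro mult_left_mono i) simp
    also have "\<dots> = 1 / 2 * dist Z Z'" by (simp add: exp_minus)
    finally show "dist (apply_bcontfun (\<Phi> Z) z) (apply_bcontfun (\<Phi> Z') z) \<le> 1 / 2 * dist Z Z'"
      unfolding \<Phi>_apply .
  qed
  have "\<exists>!Z. \<Phi> Z = Z"
    by (rule banach_fix_type[where c = "1 / 2"]) (use contr in auto)
  then obtain Z where Z: "\<Phi> Z = Z" by blast
  show ?thesis
  proof (rule that[OF pos_cont[of Z] pos_bound])
    fix t x assume "t \<in> {0..T}"
    then have t: "clamp_time t = t" by (simp add: clamp_time_def)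
    have "apply_bcontfun Z (t, x) = F Z (t, x)" using \<Phi>_apply[of Z] Z by simp
    then show "pos Z t x = x + (LINT r|lebesgue_on {0..t}. particle_velocity (pos Z) r x)"
      unfolding pos_def[of Z t x] F_def by (simp add: t exp_minus)
  qed
qed

end

section \<open>The law of the flow as a weak solution\<close>

lemma deriv_measurable:
  fixes \<phi> :: "'a::euclidean_space \<Rightarrow> real"
  assumes \<phi>: "C_inf \<phi>" and p: "p \<in> borel_measurable M" and q: "q \<in> borel_measurable M"
  shows "(\<lambda>w. frechet_derivative \<phi> (at (p w)) (q w)) \<in> borel_measurable M"
proof -
  have eq: "frechet_derivative \<phi> (at (p w)) (q w) = (\<Sum>b\<in>Basis. (q w \<bullet> b) * frechet_derivative \<phi> (at (p w)) b)" for w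
    using Linear_Algebra.linear_componentwise[OF C_inf_linear_deriv[OF \<phi>, of "p w"], of "q w" 1] by simp
  have "(\<lambda>w. frechet_derivative \<phi> (at (p w)) b) \<in> borel_measurable M" for b
    by (rule measurable_compose[OF p borel_measurable_continuous_onI[OF C_infD(3)[OF C_infD(2)[OF \<phi>]]]])
  then show ?thesis unfolding eq using q by (intro borel_measurable_sum borel_measurable_times borel_measurable_inner) auto
qed

text \<open>\<open>D\<close> holds the jump times of the control. Off this set trajectories are
  differentiable in the classical sense, and the fundamental theorem of calculus tolerates a finite
  exceptional set.\<close>

locale flow = controlled_velocity f\<^sub>0 g f C L \<theta> T U u
  for f\<^sub>0 g :: "real ^ 'n \<Rightarrow> real ^ 'n" and f :: "'m::finite \<Rightarrow> real ^ 'n \<Rightarrow> real ^ 'n" and C L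
    and \<theta> :: "(real ^ 'n) measure" and T U :: real and u :: "real \<Rightarrow> real ^ 'm" +
  fixes X :: "real \<Rightarrow> real ^ 'n \<Rightarrow> real ^ 'n" and B :: real and D :: "real set"
  assumes X_cont: "continuous_on UNIV (\<lambda>z. X (fst z) (snd z))" and X_bound: "norm (X t x - x) \<le> B"
    and X_flow: "t \<in> {0..T} \<Longrightarrow> X t x = x + (LINT r|lebesgue_on {0..t}. particle_velocity X r x)"
    and D_finite: "finite D" and u_cont: "t \<in> {0<..<T} - D \<Longrightarrow> isCont u t"
begin

definition law :: "real \<Rightarrow> (real ^ 'n) measure"
  where "law t = distr \<theta> borel (X t)"

lemma X_meas: "X t \<in> borel_measurable borel"
  by (rule X_measurable[OF X_cont X_bound])

lemma X_meas_\<theta>: "X t \<in> measurable \<theta> borel"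
  using X_meas by (simp add: P1_borel_measurable[OF \<theta>])

lemma law_P1: "law t \<in> P1"
  unfolding law_def by (rule X_P1[OF X_cont X_bound])

lemmas velocity_integrable = particle_velocity_integrable[OF X_cont X_bound]

lemma X_initial: "X 0 x = x"
  using X_flow[of 0 x] T_pos lebesgue_on_integral_eq[OF velocity_integrable, of 0 0 x] by simp

lemma law_initial: "law 0 = \<theta>"
proof -
  have "law 0 = distr \<theta> borel (\<lambda>x. x)" unfolding law_def by (rule distr_cong) (auto simp: X_initial)
  also have "\<dots> = \<theta>" by (rule distr_id2) (simp add: P1_sets[OF \<theta>])
  finally show ?thesis .
qed

lemma X_increment:
  assumes "0 \<le> s" "s \<le> t" "t \<le> T"
  shows "X t x - X s x = (LINT r|lebesgue_on {s..t}. particle_velocity X r x)"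
  using X_flow[of t x] X_flow[of s x] assms lebesgue_on_integral_combine[OF velocity_integrable[of 0 T x], of 0 s t] by simp

lemma u_integrable: "integrable (lebesgue_on {a..b}) u" "integrable (lebesgue_on {a..b}) (\<lambda>t. manhattan (u t))"
proof -
  show "integrable (lebesgue_on {a..b}) u"
    by (rule lebesgue_on_integrable_bounded[OF lebesgue_on_borel_measurable[OF u_measurable], where B = U])
       (use order_trans[OF norm_le_manhattan u_bound] in auto)
  then show "integrable (lebesgue_on {a..b}) (\<lambda>t. manhattan (u t))" by (rule manhattan_integral_le)
qed

text \<open>The bound is in terms of elapsed time plus spent cost, which on a block add up to at
  most its length. A bound through U, as in \<open>X_displacement_U\<close>, would be useless for
  the limit because U is not controlled along the approximating sequence; that form serves only the
  absolute continuity of one law.\<close>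

lemma X_displacement:
  assumes "0 \<le> s" "s \<le> t" "t \<le> T"
  shows "norm (X t x - X s x) \<le> 2 * C * ((t - s) + (LINT r|lebesgue_on {s..t}. manhattan (u r)))"
proof -
  have c: "integrable (lebesgue_on {s..t}) (\<lambda>r. 1 :: real)"
    by (rule lebesgue_on_integrable_const)
  have "norm (X t x - X s x) \<le> (LINT r|lebesgue_on {s..t}. 2 * C * (1 + manhattan (u r)))"
    unfolding X_increment[OF assms]
    by (rule Bochner_Integration.integral_norm_bound_integral[OF velocity_integrable])
       (use u_integrable(2) c particle_velocity_bound[OF X_cont X_bound] in auto)
  also have "\<dots> = 2 * C * ((t - s) + (LINT r|lebesgue_on {s..t}. manhattan (u r)))"
    using u_integrable(2)[of s t] c lebesgue_on_integral_const[OF assms(2), of 1] by simp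
  finally show ?thesis .
qed

lemma X_displacement_U:
  assumes "0 \<le> s" "s \<le> t" "t \<le> T"
  shows "norm (X t x - X s x) \<le> 2 * C * (1 + U) * (t - s)"
proof -
  have "(LINT r|lebesgue_on {s..t}. manhattan (u r)) \<le> (LINT r|lebesgue_on {s..t}. U)"
    using u_bound u_integrable(2) by (intro integral_mono lebesgue_on_integrable_const)
  also have "\<dots> = (t - s) * U" by (rule lebesgue_on_integral_const[OF assms(2)])
  finally have "(t - s) + (LINT r|lebesgue_on {s..t}. manhattan (u r)) \<le> (1 + U) * (t - s)" by (simp add: algebra_simps)
  then show ?thesis
    using X_displacement[OF assms, of x] C_nonneg mult_left_mono[of _ _ "2 * C"] by (force simp: mult.assoc)
qed

lemma law_W1:
  fixes c :: real
  assumes "0 \<le> s" "s \<le> t" "t \<le> T" and "\<And>x. norm (X t x - X s x) \<le> c"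
  shows "W1 (law s) (law t) \<le> CARD('n) * c"
  unfolding law_def
  using W1_distr_le[OF \<theta> X_meas law_P1[unfolded law_def] X_meas law_P1[unfolded law_def], of s t c] assms(4)
  by (simp add: norm_minus_commute)

lemma law_ac: "ac_curve T law"
proof -
  have "W1 (law s) (law t) \<le> (LINT r|lebesgue_on {s..t}. CARD('n) * (2 * C * (1 + U)))" if "0 \<le> s" "s \<le> t" "t \<le> T" for s t
    using law_W1[OF that X_displacement_U[OF that]] unfolding lebesgue_on_integral_const[OF that(2)] by (simp add: mult_ac)
  then show ?thesis
    unfolding ac_curve_def
    by (intro conjI ballI law_P1 exI[of _ "\<lambda>r. CARD('n) * (2 * C * (1 + U))"] allI impI
        lebesgue_on_integrable_const) auto
qed

lemma particle_velocity_isCont: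
  assumes "isCont u t" shows "isCont (\<lambda>r. particle_velocity X r x) t"
proof -
  have sect: "isCont (\<lambda>r. h (r, x)) t" if "continuous_on UNIV h" for h :: "real \<times> (real ^ 'n) \<Rightarrow> real ^ 'n"
  proof -
    have "continuous_on UNIV (\<lambda>r. h (r, x))"
      by (intro continuous_on_compose2[OF that] continuous_intros) auto
    then show ?thesis by (simp add: continuous_on_eq_continuous_at)
  qed
  have ui: "isCont (\<lambda>r. u r $ i) t" for i using assms by (rule isCont_vec_nth)
  show ?thesis
    unfolding particle_velocity_eq[OF X_cont X_bound]
    using sect[OF field_continuous(1)[OF X_cont X_bound]] sect[OF field_continuous(2)[OF X_cont X_bound]]
      sect[OF convol_continuous[OF X_cont X_bound]] ui
    by (intro isCont_add isCont_sum isCont_scaleR) auto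
qed

lemma X_derivative:
  assumes t: "t \<in> {0<..<T} - D"
  shows "((\<lambda>r. X r x) has_vector_derivative particle_velocity X t x) (at t)"
proof -
  have "((\<lambda>r. integral {0..r} (\<lambda>r. particle_velocity X r x)) has_vector_derivative particle_velocity X t x) (at t within {0..T} - {})"
    by (rule integral_has_vector_derivative_continuous_at[OF integrable_on_lebesgue_on[OF velocity_integrable] _ finite.emptyI
        continuous_at_imp_continuous_within[OF particle_velocity_isCont[OF u_cont[OF t]]]]) (use t in auto)
  then have 1: "((\<lambda>r. integral {0..r} (\<lambda>r. particle_velocity X r x)) has_vector_derivative particle_velocity X t x) (at t)"
    unfolding Diff_empty using at_within_Icc_at[of 0 t T] t by simp
  have "((\<lambda>r. x + integral {0..r} (\<lambda>r. particle_velocity X r x)) has_vector_derivative particle_velocity X t x) (at t)"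
    using 1 by (auto intro!: derivative_eq_intros)
  then show ?thesis
    by (rule has_vector_derivative_transform_within_open[of _ _ _ "{0<..<T}"])
       (use t X_flow lebesgue_on_integral_eq[OF velocity_integrable] in auto)
qed

lemma test_derivative_integral:
  assumes \<phi>: "C_inf \<phi>"
  shows "((\<lambda>t. frechet_derivative \<phi> (at (t, X t x)) (1, particle_velocity X t x)) has_integral \<phi> (T, X T x) - \<phi> (0, X 0 x)) {0..T}"
proof (rule fundamental_theorem_of_calculus_interior_strong[OF D_finite])
  show "0 \<le> T" using T_pos by simp
  have Xx: "continuous_on UNIV (\<lambda>t. X t x)"
    by (rule continuous_on_compose2[OF X_cont, of UNIV "\<lambda>t. (t, x)", simplified]) (auto intro: continuous_intros)
  then show "continuous_on {0..T} (\<lambda>t. \<phi> (t, X t x))"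
    by (intro continuous_on_compose2[OF C_infD(3)[OF \<phi>, of UNIV]] continuous_intros continuous_on_subset[OF Xx]) auto
  fix t assume t: "t \<in> {0<..<T} - D"
  have "((\<lambda>t. (t, X t x)) has_derivative (\<lambda>h. (h, h *\<^sub>R particle_velocity X t x))) (at t)"
    using X_derivative[OF t, of x] unfolding has_vector_derivative_def by (intro has_derivative_Pair has_derivative_ident)
  from has_derivative_compose[OF this C_infD(1)[OF \<phi>]]
  have "((\<lambda>t. \<phi> (t, X t x)) has_derivative (\<lambda>h. frechet_derivative \<phi> (at (t, X t x)) (h, h *\<^sub>R particle_velocity X t x))) (at t)" .
  moreover have "frechet_derivative \<phi> (at (t, X t x)) (h, h *\<^sub>R particle_velocity X t x) =
      h *\<^sub>R frechet_derivative \<phi> (at (t, X t x)) (1, particle_velocity X t x)" for h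
    using linear_scale[OF C_inf_linear_deriv[OF \<phi>, of "(t, X t x)"], of h "(1, particle_velocity X t x)"] by simp
  ultimately show "((\<lambda>t. \<phi> (t, X t x)) has_vector_derivative frechet_derivative \<phi> (at (t, X t x)) (1, particle_velocity X t x)) (at t)"
    unfolding has_vector_derivative_def by simp
qed

text \<open>Fubini is applied to a product with \<theta>, a measure on Borel sets, hence the passage
  from completed Lebesgue measure to its Borel version.\<close>

lemma lebesgue_on_eq_lborel:
  fixes h :: "real \<Rightarrow> real"
  assumes "h \<in> borel_measurable borel"
  shows "(LINT t|lebesgue_on {a..b}. h t) = (LINT t|restrict_space lborel {a..b}. h t)"
proof -
  have "(LINT t|lebesgue_on {a..b}. h t) = (LINT t|lebesgue. indicator {a..b} t *\<^sub>R h t)"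
    by (rule integral_restrict_space) auto
  also have "\<dots> = (LINT t|lborel. indicator {a..b} t *\<^sub>R h t)"
    by (rule integral_completion) (use assms in measurable)
  also have "\<dots> = (LINT t|restrict_space lborel {a..b}. h t)"
    by (rule integral_restrict_space[symmetric]) auto
  finally show ?thesis .
qed

text \<open>After Fubini the inner integral is that of the time derivative of \<phi> along one
  trajectory. It equals the difference of the values of \<phi> at the end times, which lie outside
  its support.\<close>

lemma law_test_integral:
  assumes "\<phi> \<in> test_functions T"
  shows "(LINT t|lebesgue_on {0..T}. LINT x|law t. frechet_derivative \<phi> (at (t, x)) (1, velocity 1 (u t) (law t) x)) = 0"
proof -
  have \<phi>: "C_inf \<phi>" using assms by (simp add: test_functions_def C_inf_def)
  obtain K where K: "compact K" "K \<subseteq> {0<..<T} \<times> UNIV" "\<And>z. z \<notin> K \<Longrightarrow> \<phi> z = 0"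
    using assms unfolding test_functions_def by blast
  have "bounded_support \<phi>"
  proof -
    obtain R where "\<And>z. z \<in> K \<Longrightarrow> norm z \<le> R" using compact_imp_bounded[OF K(1)] unfolding bounded_iff by blast
    then show ?thesis using K(3) unfolding bounded_support_def by (metis not_le)
  qed
  then obtain k where k: "0 \<le> k" "\<And>z v. \<bar>frechet_derivative \<phi> (at z) v\<bar> \<le> k * norm v"
    using C_inf_deriv_bounded[OF \<phi>] by blast
  interpret \<theta>: prob_space \<theta> using \<theta> by (rule P1_prob_space)
  define N where "N = restrict_space lborel {0..T}"
  interpret N: finite_measure N
    unfolding N_def by (rule finite_measureI) (simp add: emeasure_restrict_space space_restrict_space emeasure_lborel_Icc_eq)
  interpret P: pair_sigma_finite N \<theta> ..
  interpret NP: finite_measure "N \<Otimes>\<^sub>M \<theta>" by (rule finite_measure_pair_measure) unfold_locales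
  define G where "G t x = frechet_derivative \<phi> (at (t, X t x)) (1, particle_velocity X t x)" for t x
  have sets: "sets ((borel :: real measure) \<Otimes>\<^sub>M \<theta>) = sets (borel :: (real \<times> (real ^ 'n)) measure)"
    unfolding borel_prod[symmetric] by (rule sets_pair_measure_cong[OF refl P1_sets[OF \<theta>]])
  have Gz: "(\<lambda>z. G (fst z) (snd z)) \<in> borel_measurable borel"
    unfolding G_def
  proof (rule deriv_measurable[OF \<phi>])
    have "continuous_on UNIV (\<lambda>z :: real \<times> (real ^ 'n). (fst z, X (fst z) (snd z)))"
      by (intro continuous_intros X_cont)
    then show "(\<lambda>z. (fst z, X (fst z) (snd z))) \<in> borel_measurable borel" by (rule borel_measurable_continuous_onI)
    show "(\<lambda>z. (1 :: real, particle_velocity X (fst z) (snd z))) \<in> borel_measurable borel"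
      by (intro borel_measurable_Pair particle_velocity_measurable[OF X_cont X_bound]) simp
  qed
  have G_meas: "case_prod G \<in> borel_measurable (borel \<Otimes>\<^sub>M \<theta>)"
    unfolding measurable_cong_sets[OF sets refl] case_prod_beta' by (rule Gz)
  have G_bound: "\<bar>G t x\<bar> \<le> k * (1 + 2 * C * (1 + U))" for t x
  proof -
    have "norm (1 :: real, particle_velocity X t x) \<le> 1 + 2 * C * (1 + U)"
      using norm_Pair_le[of "1 :: real" "particle_velocity X t x"] particle_velocity_bound'[OF X_cont X_bound, of t x] by simp
    then show ?thesis unfolding G_def using order_trans[OF k(2) mult_left_mono[OF _ k(1)]] by blast
  qed
  have "(\<lambda>t. t) \<in> measurable N borel"
    unfolding N_def by (intro measurable_restrict_space1) simp
  then have "(\<lambda>z. (fst z, snd z)) \<in> measurable (N \<Otimes>\<^sub>M \<theta>) (borel \<Otimes>\<^sub>M \<theta>)"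
    by (intro measurable_Pair measurable_snd measurable_compose[OF measurable_fst])
  from measurable_compose[OF this G_meas] have "case_prod G \<in> borel_measurable (N \<Otimes>\<^sub>M \<theta>)"
    by (simp add: case_prod_beta')
  then have G_int: "integrable (N \<Otimes>\<^sub>M \<theta>) (case_prod G)"
    by (rule NP.integrable_const_bound[where B = "k * (1 + 2 * C * (1 + U))", rotated])
      (use G_bound in \<open>auto simp: case_prod_beta'\<close>)
  have inner: "(LINT x|law t. frechet_derivative \<phi> (at (t, x)) (1, velocity 1 (u t) (law t) x)) = (LINT x|\<theta>. G t x)" for t
  proof -
    have "(\<lambda>x. frechet_derivative \<phi> (at (t, x)) (1, velocity 1 (u t) (law t) x)) \<in> borel_measurable borel"
      by (intro deriv_measurable[OF \<phi>] borel_measurable_continuous_onI continuous_intros velocity_continuous law_P1)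
    then show ?thesis
      unfolding G_def particle_velocity_def law_def using X_meas_\<theta> by (subst integral_distr) auto
  qed
  have "(LINT t|lebesgue_on {0..T}. LINT x|\<theta>. G t x) = (LINT t|N. LINT x|\<theta>. G t x)"
    unfolding N_def by (rule lebesgue_on_eq_lborel) (use G_meas in measurable)
  also have "\<dots> = (LINT x|\<theta>. LINT t|N. G t x)"
    by (rule P.Fubini_integral[OF G_int, symmetric])
  also have "\<dots> = (LINT x|\<theta>. 0)"
  proof (rule Bochner_Integration.integral_cong[OF refl])
    fix x
    have m: "(\<lambda>t. G t x) \<in> borel_measurable borel"
      using measurable_compose[OF borel_measurable_Pair[OF measurable_ident_sets[OF refl] borel_measurable_const] Gz, of x] by simp
    have "integrable (lebesgue_on {0..T}) (\<lambda>t. G t x)"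
      by (rule lebesgue_on_integrable_bounded[OF lebesgue_on_borel_measurable[OF m]]) (use G_bound in auto)
    then have "(LINT t|lebesgue_on {0..T}. G t x) = integral {0..T} (\<lambda>t. G t x)" by (rule lebesgue_on_integral_eq)
    also have "\<dots> = \<phi> (T, X T x) - \<phi> (0, X 0 x)"
      unfolding G_def by (rule integral_unique[OF test_derivative_integral[OF \<phi>]])
    also have "\<dots> = 0"
    proof -
      have "(T, X T x) \<notin> K" "(0, X 0 x) \<notin> K" using K(2) by auto
      then show ?thesis by (simp add: K(3))
    qed
    finally show "(LINT t|N. G t x) = 0" unfolding N_def lebesgue_on_eq_lborel[OF m] .
  qed
  finally show ?thesis by (simp add: inner)
qed

lemma law_control_process:
  assumes "u \<in> controls T M"
  shows "control_process T M f\<^sub>0 f g \<theta> law u"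
proof -
  have v: "f\<^sub>0 x + (\<Sum>i\<in>UNIV. (u t $ i) *\<^sub>R f i x) + convol g (law t) x = velocity 1 (u t) (law t) x" for t x
    unfolding velocity_def by simp
  show ?thesis
    unfolding control_process_def solves_continuity_eq_def v
    using assms law_ac law_initial law_test_integral by blast
qed

end

subsection \<open>Piecewise constant controls\<close>

text \<open>Oscillation wastes cost: b + v and b - v have mean b, while their norms have mean c. It
  suffices to shift one arbitrary coordinate by l \<ge> |b_i|, since then |b_i + l| + |b_i - l| = 2
  l; the slack c - |b| is put into l.\<close>

lemma manhattan_split:
  fixes b :: "real ^ 'm::finite"
  assumes "manhattan b \<le> c"
  obtains v where "manhattan (b + v) + manhattan (b - v) = 2 * c"
proof -
  fix i :: 'm
  define l where "l = \<bar>b $ i\<bar> + (c - manhattan b)"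
  have l: "\<bar>b $ i\<bar> \<le> l" using assms by (simp add: l_def)
  have m: "manhattan (b + d *\<^sub>R axis i 1) = (manhattan b - \<bar>b $ i\<bar>) + \<bar>b $ i + d\<bar>" for d
  proof -
    have "manhattan (b + d *\<^sub>R axis i 1) = \<bar>b $ i + d\<bar> + (\<Sum>j\<in>UNIV - {i}. \<bar>b $ j\<bar>)"
      unfolding manhattan_def by (subst sum.remove[of UNIV i]) (auto simp: axis_def intro!: sum.cong)
    moreover have "manhattan b = \<bar>b $ i\<bar> + (\<Sum>j\<in>UNIV - {i}. \<bar>b $ j\<bar>)"
      unfolding manhattan_def by (rule sum.remove) auto
    ultimately show ?thesis by simp
  qed
  have "manhattan (b + l *\<^sub>R axis i 1) + manhattan (b - l *\<^sub>R axis i 1) = 2 * c"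
  proof -
    have "manhattan (b - l *\<^sub>R axis i 1) = (manhattan b - \<bar>b $ i\<bar>) + \<bar>b $ i - l\<bar>"
      using m[of "- l"] by simp
    moreover have "\<bar>b $ i + l\<bar> + \<bar>b $ i - l\<bar> = 2 * l" using l by linarith
    ultimately show ?thesis using m[of l] l_def by linarith
  qed
  then show ?thesis by (rule that)
qed

lemma lebesgue_on_integral_spike:
  fixes h k :: "real \<Rightarrow> 'a::euclidean_space"
  assumes "integrable (lebesgue_on {a..b}) h" "integrable (lebesgue_on {a..b}) k"
    and "finite F" "\<And>s. s \<in> {a..b} - F \<Longrightarrow> h s = k s"
  shows "(LINT s|lebesgue_on {a..b}. h s) = (LINT s|lebesgue_on {a..b}. k s)"
  unfolding lebesgue_on_integral_eq[OF assms(1)] lebesgue_on_integral_eq[OF assms(2)]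
  by (rule integral_spike[OF negligible_finite[OF assms(3)]]) (use assms(4) in auto)

lemma lebesgue_on_integral_spike_const:
  fixes h :: "real \<Rightarrow> 'a::euclidean_space"
  assumes "integrable (lebesgue_on {a..b}) h" "a \<le> b" "finite F" "\<And>s. s \<in> {a..b} - F \<Longrightarrow> h s = c"
  shows "(LINT s|lebesgue_on {a..b}. h s) = (b - a) *\<^sub>R c"
proof -
  have "(LINT s|lebesgue_on {a..b}. h s) = (LINT s|lebesgue_on {a..b}. c)"
    by (rule lebesgue_on_integral_spike[OF assms(1) lebesgue_on_integrable_const assms(3,4)])
  also have "\<dots> = (b - a) *\<^sub>R c" using assms(2) by (simp add: measure_restrict_space)
  finally show ?thesis .
qed

text \<open>Each interval is halved and the control takes the values of
  \<open>manhattan_split\<close> on the halves, rescaled. In the induction it is redefined on the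
  whole half line from t N on, so the earlier integrals are affected at one point at most and the
  later values are overwritten in turn.\<close>

lemma piecewise_control_exists:
  fixes t c :: "nat \<Rightarrow> real" and b :: "nat \<Rightarrow> real ^ 'm::finite"
  assumes "\<And>j. j < N \<Longrightarrow> t j < t (Suc j)" and "\<And>j. j < N \<Longrightarrow> manhattan (b j) \<le> c j"
  shows "\<exists>u D U. u \<in> borel_measurable borel \<and> (\<forall>s. manhattan (u s) \<le> U) \<and> finite D \<and> (\<forall>s. s \<notin> D \<longrightarrow> isCont u s) \<and>
    (\<forall>j<N. (LINT s|lebesgue_on {t j..t (Suc j)}. u s) = b j \<and>
      (LINT s|lebesgue_on {t j..t (Suc j)}. manhattan (u s)) = c j)"
  using assms
proof (induction N)
  case 0
  have "(\<lambda>s. 0 :: real ^ 'm) \<in> borel_measurable borel \<and> (\<forall>s :: real. manhattan (0 :: real ^ 'm) \<le> 0) \<and> finite {} \<and>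
    (\<forall>s :: real. s \<notin> {} \<longrightarrow> isCont (\<lambda>s. 0 :: real ^ 'm) s)" by simp
  then show ?case by blast
next
  case (Suc N)
  have "\<exists>u D U. u \<in> borel_measurable borel \<and> (\<forall>s. manhattan (u s) \<le> U) \<and> finite D \<and> (\<forall>s. s \<notin> D \<longrightarrow> isCont u s) \<and>
    (\<forall>j<N. (LINT s|lebesgue_on {t j..t (Suc j)}. u s) = b j \<and>
      (LINT s|lebesgue_on {t j..t (Suc j)}. manhattan (u s)) = c j)"
    by (rule Suc.IH) (use Suc.prems in auto)
  then obtain u D U where u: "u \<in> borel_measurable borel" "\<And>s. manhattan (u s) \<le> U" "finite D" "\<And>s. s \<notin> D \<Longrightarrow> isCont u s"
    "\<And>j. j < N \<Longrightarrow> (LINT s|lebesgue_on {t j..t (Suc j)}. u s) = b j"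
    "\<And>j. j < N \<Longrightarrow> (LINT s|lebesgue_on {t j..t (Suc j)}. manhattan (u s)) = c j"
    by blast
  define a where "a = t (Suc N) - t N"
  have a: "0 < a" using Suc.prems(1)[of N] by (simp add: a_def)
  define m where "m = t N + a / 2"
  have m: "t N < m" "m < t (Suc N)" "t (Suc N) - m = a / 2" "m - t N = a / 2" using a unfolding m_def a_def by (simp_all add: field_simps)
  obtain v where v: "manhattan (b N + v) + manhattan (b N - v) = 2 * c N"
    using manhattan_split[of "b N" "c N"] Suc.prems(2)[of N] by auto
  \<comment> \<open>Each value is held for the time a / 2, so the integral is the mean of the two
    vectors before rescaling by 1 / a.\<close>
  define p q where "p = (1 / a) *\<^sub>R (b N + v)" and "q = (1 / a) *\<^sub>R (b N - v)"
  define u' where "u' s = (if s < t N then u s else if s < m then p else q)" for s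
  define U' where "U' = max U (max (manhattan p) (manhattan q))"
  have meas: "u' \<in> borel_measurable borel"
    unfolding u'_def using u(1) by measurable
  have bound: "manhattan (u' s) \<le> U'" for s
    unfolding u'_def U'_def using u(2)[of s] by auto
  have fin: "finite (insert (t N) (insert m D))" using u(3) by simp
  have cont: "isCont u' s" if "s \<notin> insert (t N) (insert m D)" for s
  proof -
    have "s \<noteq> t N" "s \<noteq> m" using that by auto
    then consider "s < t N" | "t N < s" "s < m" | "m < s" by linarith
    then show ?thesis
    proof cases
      case 1
      then have "\<forall>\<^sub>F r in nhds s. u' r = u r"
        by (intro eventually_mono[OF eventually_nhds_in_open[of "{..<t N}"]]) (auto simp: u'_def)
      then show ?thesis using isCont_cong u(4)[of s] that by (metis insertCI)
    next
      case 2
      then have "\<forall>\<^sub>F r in nhds s. u' r = p"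
        by (intro eventually_mono[OF eventually_nhds_in_open[of "{t N<..<m}"]]) (auto simp: u'_def)
      then show ?thesis by (subst isCont_cong[of _ "\<lambda>_. p"]) auto
    next
      case 3
      then have "\<forall>\<^sub>F r in nhds s. u' r = q"
        using m by (intro eventually_mono[OF eventually_nhds_in_open[of "{m<..}"]]) (auto simp: u'_def)
      then show ?thesis by (subst isCont_cong[of _ "\<lambda>_. q"]) auto
    qed
  qed
  have int: "integrable (lebesgue_on {x..y}) w" "integrable (lebesgue_on {x..y}) (\<lambda>s. manhattan (w s))"
    if "w \<in> borel_measurable borel" "\<And>s. manhattan (w s) \<le> W" for w :: "real \<Rightarrow> real ^ 'm" and W x y
  proof -
    show "integrable (lebesgue_on {x..y}) w"
      by (rule lebesgue_on_integrable_bounded[OF lebesgue_on_borel_measurable[OF that(1)], where B = W])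
         (use order_trans[OF norm_le_manhattan that(2)] in auto)
    then show "integrable (lebesgue_on {x..y}) (\<lambda>s. manhattan (w s))" by (rule manhattan_integral_le)
  qed
  note i = int[OF u(1,2)] int[OF meas bound]
  have tmono: "t (Suc j) \<le> t N" if "j < N" for j
  proof -
    have "t (Suc j) \<le> t k" if "Suc j \<le> k" "k \<le> N" for k
      using that
    proof (induction k rule: dec_induct)
      case (step k)
      then show ?case using Suc.prems(1)[of k] by force
    qed simp
    then show ?thesis using that by simp
  qed
  have "(LINT s|lebesgue_on {t j..t (Suc j)}. u' s) = b j \<and>
      (LINT s|lebesgue_on {t j..t (Suc j)}. manhattan (u' s)) = c j" if j: "j < Suc N" for j
  proof (cases "j < N")
    case True
    have eq: "u' s = u s" if "s \<in> {t j..t (Suc j)} - {t N}" for s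
      using that tmono[OF True] by (auto simp: u'_def)
    have "(LINT s|lebesgue_on {t j..t (Suc j)}. u' s) = (LINT s|lebesgue_on {t j..t (Suc j)}. u s)"
      by (rule lebesgue_on_integral_spike[OF i(3,1), where F = "{t N}"]) (use eq in auto)
    moreover have "(LINT s|lebesgue_on {t j..t (Suc j)}. manhattan (u' s)) = (LINT s|lebesgue_on {t j..t (Suc j)}. manhattan (u s))"
      by (rule lebesgue_on_integral_spike[OF i(4,2), where F = "{t N}"]) (use eq in auto)
    ultimately show ?thesis using u(5,6)[OF True] by simp
  next
    case False
    then have j: "j = N" using j by simp
    have 1: "u' s = p" if "s \<in> {t N..m} - {m}" for s using that by (auto simp: u'_def)
    have 2: "u' s = q" if "s \<in> {m..t (Suc N)} - {}" for s using that m by (auto simp: u'_def)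
    have "(LINT s|lebesgue_on {t N..t (Suc N)}. u' s) = (LINT s|lebesgue_on {t N..m}. u' s) + (LINT s|lebesgue_on {m..t (Suc N)}. u' s)"
      by (rule lebesgue_on_integral_combine[OF i(3)]) (use m in auto)
    also have "(LINT s|lebesgue_on {t N..m}. u' s) = (a / 2) *\<^sub>R p"
      using lebesgue_on_integral_spike_const[OF i(3), of "t N" m "{m}" p] 1 m by simp
    also have "(LINT s|lebesgue_on {m..t (Suc N)}. u' s) = (a / 2) *\<^sub>R q"
      using lebesgue_on_integral_spike_const[OF i(3), of m "t (Suc N)" "{}" q] 2 m by simp
    also have "(a / 2) *\<^sub>R p + (a / 2) *\<^sub>R q = b N"
    proof -
      have "(a / 2) *\<^sub>R p + (a / 2) *\<^sub>R q = (1 / 2) *\<^sub>R (b N + v) + (1 / 2) *\<^sub>R (b N - v)"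
        using a by (simp add: p_def q_def)
      also have "\<dots> = b N" by (simp add: vec_eq_iff field_simps)
      finally show ?thesis .
    qed
    finally have "(LINT s|lebesgue_on {t N..t (Suc N)}. u' s) = b N" .
    moreover have "(LINT s|lebesgue_on {t N..t (Suc N)}. manhattan (u' s)) = c N"
    proof -
      have "(LINT s|lebesgue_on {t N..t (Suc N)}. manhattan (u' s)) = (LINT s|lebesgue_on {t N..m}. manhattan (u' s)) + (LINT s|lebesgue_on {m..t (Suc N)}. manhattan (u' s))"
        by (rule lebesgue_on_integral_combine[OF i(4)]) (use m in auto)
      also have "(LINT s|lebesgue_on {t N..m}. manhattan (u' s)) = (a / 2) * manhattan p"
        using lebesgue_on_integral_spike_const[OF i(4), of "t N" m "{m}" "manhattan p"] 1 m by simp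
      also have "(LINT s|lebesgue_on {m..t (Suc N)}. manhattan (u' s)) = (a / 2) * manhattan q"
        using lebesgue_on_integral_spike_const[OF i(4), of m "t (Suc N)" "{}" "manhattan q"] 2 m by simp
      also have "(a / 2) * manhattan p + (a / 2) * manhattan q = c N"
      proof -
        have "manhattan p = manhattan (b N + v) / a" "manhattan q = manhattan (b N - v) / a"
          unfolding p_def q_def manhattan_scaleR using a by simp_all
        then have "(a / 2) * manhattan p + (a / 2) * manhattan q = (manhattan (b N + v) + manhattan (b N - v)) / 2"
          using a by (simp only: add_divide_distrib) simp
        then show ?thesis using v by simp
      qed
      finally show ?thesis .
    qed
    ultimately show ?thesis using j by simp
  qed
  then show ?case using meas bound fin cont by blast
qed

subsection \<open>Comparison of a weak solution with a flow\<close>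

locale comparison = flow f\<^sub>0 g f C L \<theta> T U u X B D + admissible_control S \<alpha> \<beta> + mollifier \<kappa> \<epsilon>
  for f\<^sub>0 g :: "real ^ 'n \<Rightarrow> real ^ 'n" and f :: "'m::finite \<Rightarrow> real ^ 'n \<Rightarrow> real ^ 'n" and C L
    and \<theta> :: "(real ^ 'n) measure" and T U :: real and u :: "real \<Rightarrow> real ^ 'm"
    and X :: "real \<Rightarrow> real ^ 'n \<Rightarrow> real ^ 'n" and B :: real and D :: "real set"
    and S :: real and \<alpha> :: "real \<Rightarrow> real" and \<beta> :: "real \<Rightarrow> real ^ 'm"
    and \<kappa> :: "real ^ 'n \<Rightarrow> real" and \<epsilon> :: real +
  fixes \<nu> :: "real \<Rightarrow> (real ^ 'n) measure"
  assumes S_pos: "0 < S" and \<epsilon>_pos: "0 < \<epsilon>"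
    and solution: "solves_continuity_eq S (\<lambda>s x. velocity (\<alpha> s) (\<beta> s) (\<nu> s) x) \<theta> \<nu>"
begin

text \<open>Only the second measure is mollified: the mollified test function is then an admissible observable in
  the weak formulation satisfied by \<open>\<nu>\<close>, while the law of the flow may be tested with Lipschitz
  functions directly.\<close>

definition close :: "real \<Rightarrow> (real ^ 'n) measure \<Rightarrow> (real ^ 'n) measure \<Rightarrow> bool"
  where "close d \<mu> \<pi> \<longleftrightarrow> (\<forall>\<phi>. 1-lipschitz_on UNIV \<phi> \<longrightarrow> bounded_support \<phi> \<longrightarrow>
    \<bar>(LINT x|\<mu>. \<phi> x) - (LINT x|\<pi>. fun_convolution \<phi> \<kappa> x)\<bar> \<le> d)"

lemma \<nu>_P1: "s \<in> {0..S} \<Longrightarrow> \<nu> s \<in> P1"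
  using solution ac_curve_P1 by (auto simp: solves_continuity_eq_def)

lemma mollified_lipschitz:
  assumes "1-lipschitz_on UNIV \<phi>" "bounded_support \<phi>"
  shows "1-lipschitz_on UNIV (fun_convolution \<phi> \<kappa>)"
  by (rule lipschitz_onI)
     (use lipschitz_of_deriv_bound[OF C_infD(1)[OF mollified_observable(1)[OF assms]], of 1]
        mollified_observable(3)[OF assms] in \<open>auto simp: dist_norm\<close>)

text \<open>Undoing the mollification costs \<epsilon> by \<open>mollified_close\<close>; the factor
  is that of the reduction to bounded support.\<close>

lemma close_W1:
  assumes "close d \<mu> \<pi>" "\<mu> \<in> P1" "\<pi> \<in> P1"
  shows "W1 \<mu> \<pi> \<le> CARD('n) * (d + \<epsilon>)"
proof (rule W1_le_of_bounded_support[OF assms(2,3)])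
  fix \<phi> :: "real ^ 'n \<Rightarrow> real" and R
  assume \<phi>: "1-lipschitz_on UNIV \<phi>" "\<forall>x. R < norm x \<longrightarrow> \<phi> x = 0"
  then have bs: "bounded_support \<phi>" unfolding bounded_support_def by blast
  interpret \<pi>: prob_space \<pi> using assms(3) by (rule P1_prob_space)
  have "(LINT x|\<pi>. fun_convolution \<phi> \<kappa> x) - (LINT x|\<pi>. \<phi> x) = (LINT x|\<pi>. fun_convolution \<phi> \<kappa> x - \<phi> x)"
    using P1_lipschitz_integrable[OF assms(3) \<phi>(1)] P1_lipschitz_integrable[OF assms(3) mollified_lipschitz[OF \<phi>(1) bs]] by simp
  also have "\<dots> \<le> (LINT x|\<pi>. \<epsilon>)"
    using P1_lipschitz_integrable[OF assms(3) \<phi>(1)] P1_lipschitz_integrable[OF assms(3) mollified_lipschitz[OF \<phi>(1) bs]]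
      mollified_close[OF \<phi>(1)] by (intro integral_mono) (auto simp: abs_le_iff)
  finally have "(LINT x|\<pi>. fun_convolution \<phi> \<kappa> x) - (LINT x|\<pi>. \<phi> x) \<le> \<epsilon>" by (simp add: \<pi>.prob_space)
  moreover have "\<bar>(LINT x|\<mu>. \<phi> x) - (LINT x|\<pi>. fun_convolution \<phi> \<kappa> x)\<bar> \<le> d"
    using assms(1) \<phi>(1) bs unfolding close_def by blast
  ultimately show "(LINT x|\<mu>. \<phi> x) - (LINT x|\<pi>. \<phi> x) \<le> d + \<epsilon>" by linarith
qed

lemma close_initial: "close \<epsilon> (law 0) (\<nu> 0)"
  unfolding close_def
proof (intro allI impI)
  fix \<phi> :: "real ^ 'n \<Rightarrow> real" assume \<phi>: "1-lipschitz_on UNIV \<phi>" "bounded_support \<phi>"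
  have \<nu>0: "\<nu> 0 = \<theta>" using solution by (simp add: solves_continuity_eq_def)
  interpret prob_space \<theta> using \<theta> by (rule P1_prob_space)
  note i = P1_lipschitz_integrable[OF \<theta> \<phi>(1)] P1_lipschitz_integrable[OF \<theta> mollified_lipschitz[OF \<phi>]]
  have "norm (LINT x|\<theta>. \<phi> x - fun_convolution \<phi> \<kappa> x) \<le> (LINT x|\<theta>. \<epsilon>)"
    by (rule Bochner_Integration.integral_norm_bound_integral)
       (use i mollified_close[OF \<phi>(1)] in \<open>auto simp: abs_minus_commute\<close>)
  then show "\<bar>(LINT x|law 0. \<phi> x) - (LINT x|\<nu> 0. fun_convolution \<phi> \<kappa> x)\<bar> \<le> \<epsilon>"
    unfolding law_initial \<nu>0 using i by (simp add: prob_space)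
qed

lemma close_scaled:
  assumes c: "close d \<mu> \<pi>" and \<phi>: "K-lipschitz_on UNIV \<phi>" "bounded_support \<phi>" and K: "0 < K"
  shows "\<bar>(LINT x|\<mu>. \<phi> x) - (LINT x|\<pi>. fun_convolution \<phi> \<kappa> x)\<bar> \<le> K * d"
proof -
  have "bounded_support (\<lambda>x. \<phi> x / K)" using \<phi>(2) unfolding bounded_support_def by auto
  then have 1: "\<bar>(LINT x|\<mu>. \<phi> x / K) - (LINT x|\<pi>. fun_convolution (\<lambda>x. \<phi> x / K) \<kappa> x)\<bar> \<le> d"
    using c lipschitz_on_divide[OF \<phi>(1) K] unfolding close_def by blast
  have "fun_convolution (\<lambda>x. \<phi> x / K) \<kappa> x = fun_convolution \<phi> \<kappa> x / K" for x
    unfolding fun_convolution_def by simp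
  then have "(LINT x|\<mu>. \<phi> x / K) - (LINT x|\<pi>. fun_convolution (\<lambda>x. \<phi> x / K) \<kappa> x)
      = ((LINT x|\<mu>. \<phi> x) - (LINT x|\<pi>. fun_convolution \<phi> \<kappa> x)) / K"
    by (simp add: diff_divide_distrib)
  with 1 K show ?thesis by (simp add: abs_divide pos_divide_le_eq mult.commute)
qed

section \<open>Errors committed on one block\<close>

definition growth :: real
  where "growth = 2 * L + CARD('n) * L * CARD('n)"

text \<open>The value of \<open>pairing_modulus\<close> for a mollified test function, whose second
  order constant is \<open>deriv_mass\<close>.\<close>

definition modulus :: real
  where "modulus = 2 * C * deriv_mass + 2 * L + CARD('n) * L"

lemma growth_nonneg: "0 \<le> growth"
  unfolding growth_def using L_nonneg by simp

text \<open>Within the block no particle moves farther than 2 C h, so both its position and the law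
  stay near their values at time t. Per unit of elapsed time plus spent cost the velocity then
  deviates by at most \<open>growth\<close> times this distance, and at most h such units are
  available.\<close>

lemma frozen_velocity_error:
  assumes t: "0 \<le> t" "t \<le> t'" "t' \<le> T" and h: "(t' - t) + (LINT r|lebesgue_on {t..t'}. manhattan (u r)) \<le> h"
  shows "norm (X t' x - (X t x + velocity (t' - t) (LINT r|lebesgue_on {t..t'}. u r) (law t) (X t x))) \<le> growth * (2 * C * h) * h"
proof -
  let ?c = "\<lambda>r. velocity 1 (u r) (law t) (X t x)"
  have c1: "integrable (lebesgue_on {t..t'}) (\<lambda>r. c)" for c :: "'z::euclidean_space"
    by (rule lebesgue_on_integrable_const)
  note ui = integral_vec_nth[OF u_integrable(1)[of t t']]
  have uc: "integrable (lebesgue_on {t..t'}) (\<lambda>r. (u r $ i) *\<^sub>R f i (X t x))" for i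
    using ui(2) by simp
  have cint: "integrable (lebesgue_on {t..t'}) ?c"
    unfolding velocity_def using uc c1 by (intro Bochner_Integration.integrable_add Bochner_Integration.integrable_sum) auto
  have ceq: "(LINT r|lebesgue_on {t..t'}. ?c r) = velocity (t' - t) (LINT r|lebesgue_on {t..t'}. u r) (law t) (X t x)"
  proof -
    have "(LINT r|lebesgue_on {t..t'}. (1 :: real) *\<^sub>R (f\<^sub>0 (X t x) + convol g (law t) (X t x))) = (t' - t) *\<^sub>R (f\<^sub>0 (X t x) + convol g (law t) (X t x))"
      using t by (simp add: measure_restrict_space)
    moreover have "(LINT r|lebesgue_on {t..t'}. (\<Sum>i\<in>UNIV. (u r $ i) *\<^sub>R f i (X t x))) = (\<Sum>i\<in>UNIV. ((LINT r|lebesgue_on {t..t'}. u r) $ i) *\<^sub>R f i (X t x))"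
      by (subst Bochner_Integration.integral_sum[OF uc]) (simp add: ui)
    ultimately show ?thesis
      unfolding velocity_def
      by (subst Bochner_Integration.integral_add) (use uc c1 in auto)
  qed
  have pt: "norm (particle_velocity X r x - ?c r) \<le> growth * (2 * C * h) * (1 + manhattan (u r))" if r: "r \<in> {t..t'}" for r
  proof -
    have d: "norm (X r y - X t y) \<le> 2 * C * h" for y
    proof -
      have "(LINT r|lebesgue_on {t..r}. manhattan (u r)) \<le> (LINT r|lebesgue_on {t..t'}. manhattan (u r))"
        using lebesgue_on_integral_combine[OF u_integrable(2)[of t t'], of t r t'] r
          Bochner_Integration.integral_nonneg[of "lebesgue_on {r..t'}" "\<lambda>r. manhattan (u r)"] by simp
      then have "(r - t) + (LINT r|lebesgue_on {t..r}. manhattan (u r)) \<le> h" using h r by simp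
      then have "2 * C * ((r - t) + (LINT r|lebesgue_on {t..r}. manhattan (u r))) \<le> 2 * C * h"
        using C_nonneg by (intro mult_left_mono) auto
      then show ?thesis using X_displacement[of t r y] r t by (intro order_trans[OF X_displacement]) auto
    qed
    have "0 \<le> 2 * C * h" by (rule order_trans[OF norm_ge_zero d[of x]])
    have w: "W1 (law r) (law t) \<le> CARD('n) * (2 * C * h)"
      using law_W1[of t r "2 * C * h"] d r t by (simp add: W1_commute[of "law r"])
    have "norm (velocity 1 (u r) (law r) (X r x) - velocity 1 (u r) (law r) (X t x)) \<le> 2 * L * (\<bar>1\<bar> + manhattan (u r)) * norm (X r x - X t x)"
      by (rule velocity_lipschitz[OF law_P1])
    also have "\<dots> \<le> 2 * L * (\<bar>1\<bar> + manhattan (u r)) * (2 * C * h)"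
      using L_nonneg by (intro mult_left_mono d) auto
    finally have 1: "norm (velocity 1 (u r) (law r) (X r x) - velocity 1 (u r) (law r) (X t x)) \<le> 2 * L * (1 + manhattan (u r)) * (2 * C * h)" by simp
    have "norm (velocity 1 (u r) (law r) (X t x) - velocity 1 (u r) (law t) (X t x)) \<le> \<bar>1\<bar> * (CARD('n) * L * W1 (law r) (law t))"
      by (rule velocity_W1[OF law_P1 law_P1])
    also have "\<dots> \<le> CARD('n) * L * (CARD('n) * (2 * C * h))"
      using w L_nonneg by (simp add: mult_left_mono)
    also have "\<dots> \<le> CARD('n) * L * CARD('n) * (2 * C * h) * (1 + manhattan (u r))"
      using \<open>0 \<le> 2 * C * h\<close> L_nonneg mult_left_mono[of 1 "1 + manhattan (u r)" "CARD('n) * L * CARD('n) * (2 * C * h)"]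
      by (simp add: mult.assoc)
    finally have 2: "norm (velocity 1 (u r) (law r) (X t x) - velocity 1 (u r) (law t) (X t x)) \<le> CARD('n) * L * CARD('n) * (2 * C * h) * (1 + manhattan (u r))" .
    have "particle_velocity X r x - ?c r = (velocity 1 (u r) (law r) (X r x) - velocity 1 (u r) (law r) (X t x))
       + (velocity 1 (u r) (law r) (X t x) - velocity 1 (u r) (law t) (X t x))"
      unfolding particle_velocity_def law_def by simp
    then have "norm (particle_velocity X r x - ?c r) \<le> 2 * L * (1 + manhattan (u r)) * (2 * C * h) + CARD('n) * L * CARD('n) * (2 * C * h) * (1 + manhattan (u r))"
      using norm_triangle_le[OF add_mono[OF 1 2]] by simp
    then show ?thesis unfolding growth_def by (simp add: algebra_simps)
  qed
  have "X t' x - (X t x + velocity (t' - t) (LINT r|lebesgue_on {t..t'}. u r) (law t) (X t x)) = (LINT r|lebesgue_on {t..t'}. particle_velocity X r x - ?c r)"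
    unfolding ceq[symmetric] Bochner_Integration.integral_diff[OF velocity_integrable cint] using X_increment[OF t, of x] by simp
  also have "norm \<dots> \<le> (LINT r|lebesgue_on {t..t'}. growth * (2 * C * h) * (1 + manhattan (u r)))"
    by (rule Bochner_Integration.integral_norm_bound_integral)
       (use pt velocity_integrable cint u_integrable(2) c1 in auto)
  also have "\<dots> = growth * (2 * C * h) * ((t' - t) + (LINT r|lebesgue_on {t..t'}. manhattan (u r)))"
    using u_integrable(2)[of t t'] c1[of "1 :: real"] lebesgue_on_integral_const[OF t(2), of 1] by simp
  also have "\<dots> \<le> growth * (2 * C * h) * h"
  proof (rule mult_left_mono[OF h])
    have "0 \<le> (t' - t) + (LINT r|lebesgue_on {t..t'}. manhattan (u r))" using t by simp
    then have "0 \<le> h" using h by simp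
    then show "0 \<le> growth * (2 * C * h)" using growth_nonneg C_nonneg by simp
  qed
  finally show ?thesis .
qed

text \<open>The two Euler displacements differ through the integrated controls, which gives the term
  in \<delta>, and through the measure in the convolution. The latter is multiplied by the integral
  of \<alpha>, which is at most s' - s, and the distance of the measures is controlled by
  \<open>close_W1\<close>.\<close>

lemma frozen_velocity_mismatch:
  assumes s: "0 \<le> s" "s \<le> s'" "s' \<le> S" and c: "close d (law t) (\<nu> s)"
    and \<delta>: "\<bar>(t' - t) - (LINT r|lebesgue_on {s..s'}. \<alpha> r)\<bar> + manhattan (b - (LINT r|lebesgue_on {s..s'}. \<beta> r)) \<le> \<delta>"
  shows "norm (velocity (t' - t) b (law t) y - velocity (LINT r|lebesgue_on {s..s'}. \<alpha> r) (LINT r|lebesgue_on {s..s'}. \<beta> r) (\<nu> s) y)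
    \<le> 2 * C * \<delta> + (s' - s) * (growth * (d + \<epsilon>))"
proof -
  let ?A = "LINT r|lebesgue_on {s..s'}. \<alpha> r" and ?B = "LINT r|lebesgue_on {s..s'}. \<beta> r"
  have \<nu>s: "\<nu> s \<in> P1" using s by (intro \<nu>_P1) auto
  have A: "0 \<le> ?A" "?A \<le> s' - s" using integral_control_bound[OF s] manhattan_nonneg[of ?B] by linarith+
  have w: "W1 (law t) (\<nu> s) \<le> CARD('n) * (d + \<epsilon>)" by (rule close_W1[OF c law_P1 \<nu>s])
  have w0: "0 \<le> W1 (law t) (\<nu> s)" by (rule W1_nonneg[OF law_P1 \<nu>s])
  have "norm (velocity (t' - t) b (law t) y - velocity ?A ?B (law t) y) \<le> 2 * C * (\<bar>(t' - t) - ?A\<bar> + manhattan (b - ?B))"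
    unfolding velocity_diff by (rule velocity_bound[OF law_P1])
  also have "\<dots> \<le> 2 * C * \<delta>" using C_nonneg by (intro mult_left_mono \<delta>) auto
  finally have 1: "norm (velocity (t' - t) b (law t) y - velocity ?A ?B (law t) y) \<le> 2 * C * \<delta>" .
  have "norm (velocity ?A ?B (law t) y - velocity ?A ?B (\<nu> s) y) \<le> \<bar>?A\<bar> * (CARD('n) * L * W1 (law t) (\<nu> s))"
    by (rule velocity_W1[OF law_P1 \<nu>s])
  also have "\<dots> \<le> (s' - s) * (CARD('n) * L * (CARD('n) * (d + \<epsilon>)))"
    using A w L_nonneg w0 by (intro mult_mono) auto
  also have "\<dots> \<le> (s' - s) * (growth * (d + \<epsilon>))"
  proof (intro mult_left_mono)
    have "0 \<le> CARD('n) * (d + \<epsilon>)" using w w0 by linarith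
    then have "0 \<le> d + \<epsilon>" by (simp add: zero_le_mult_iff)
    then show "CARD('n) * L * (CARD('n) * (d + \<epsilon>)) \<le> growth * (d + \<epsilon>)"
      unfolding growth_def using L_nonneg by (simp add: distrib_right mult.assoc)
  qed (use s in simp)
  finally have 2: "norm (velocity ?A ?B (law t) y - velocity ?A ?B (\<nu> s) y) \<le> (s' - s) * (growth * (d + \<epsilon>))" .
  show ?thesis using norm_triangle_le[OF add_mono[OF 1 2]] by simp
qed

text \<open>Commutator of averaging and transport: the arguments of \<phi> differ by V x - V (x - z)
  with |z| \<le> \<epsilon>. This is how a velocity that is only Lipschitz is combined with a smooth
  observable.\<close>

lemma mollified_transport:
  assumes \<phi>: "1-lipschitz_on UNIV \<phi>" and V: "\<And>x y. norm (V x - V y) \<le> l * norm (x - y)" and l: "0 \<le> l"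
  shows "\<bar>fun_convolution \<phi> \<kappa> (x + V x) - fun_convolution (\<lambda>y. \<phi> (y + V y)) \<kappa> x\<bar> \<le> l * \<epsilon>"
proof -
  have cV: "continuous_on UNIV V"
    by (rule lipschitz_on_continuous_on[of l]) (use V l in \<open>auto intro!: lipschitz_onI simp: dist_norm\<close>)
  have c\<phi>: "continuous_on UNIV \<phi>" using \<phi> by (rule lipschitz_on_continuous_on)
  have c\<phi>': "continuous_on UNIV (\<lambda>y. \<phi> (y + V y))"
    by (intro continuous_on_compose2[OF c\<phi>] continuous_intros cV) auto
  note e = mollified_eq[OF c\<phi>, of "x + V x"] mollified_eq[OF c\<phi>', of x]
  have "fun_convolution \<phi> \<kappa> (x + V x) - fun_convolution (\<lambda>y. \<phi> (y + V y)) \<kappa> x =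
      (LINT z|lborel. (\<phi> (x + V x - z) - \<phi> ((x - z) + V (x - z))) * \<kappa> z)"
    unfolding e(1,3) using e(2,4) by (simp add: left_diff_distrib)
  also have "\<bar>\<dots>\<bar> \<le> l * \<epsilon>"
  proof (rule average_bound)
    show "integrable lborel (\<lambda>z. (\<phi> (x + V x - z) - \<phi> ((x - z) + V (x - z))) * \<kappa> z)"
      using e(2,4) by (simp add: left_diff_distrib)
    fix z :: "real ^ 'n" assume z: "norm z \<le> \<epsilon>"
    have "\<bar>\<phi> (x + V x - z) - \<phi> ((x - z) + V (x - z))\<bar> \<le> norm ((x + V x - z) - ((x - z) + V (x - z)))"
      using lipschitz_onD[OF \<phi>, of "x + V x - z" "(x - z) + V (x - z)"] by (simp add: dist_norm)
    also have "\<dots> = norm (V x - V (x - z))" by (simp add: algebra_simps)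
    also have "\<dots> \<le> l * norm z" using V[of x "x - z"] by simp
    also have "\<dots> \<le> l * \<epsilon>" using z l by (rule mult_left_mono)
    finally show "\<bar>\<phi> (x + V x - z) - \<phi> ((x - z) + V (x - z))\<bar> \<le> l * \<epsilon>" .
  qed
  finally show ?thesis .
qed

text \<open>Four replacements connect the two integrals. The flow is replaced by the Euler step of
  the reduced system, turning \<phi> into \<phi>'; the hypothesis is applied to \<phi>', whose
  Lipschitz constant 1 + 2 L h yields the amplification of d; the commutator exchanges mollification
  and transport; finally the step estimate of the weak solution is used.\<close>

lemma close_step:
  assumes s: "0 \<le> s" "s \<le> s'" "s' \<le> S" and t: "0 \<le> t" "t \<le> t'" "t' \<le> T"
    and h: "s' - s = h" "(t' - t) + (LINT r|lebesgue_on {t..t'}. manhattan (u r)) \<le> h"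
    and \<delta>: "\<bar>(t' - t) - (LINT r|lebesgue_on {s..s'}. \<alpha> r)\<bar> + manhattan ((LINT r|lebesgue_on {t..t'}. u r) - (LINT r|lebesgue_on {s..s'}. \<beta> r)) \<le> \<delta> * h"
    and \<omega>: "\<And>r. r \<in> {s..s'} \<Longrightarrow> W1 (\<nu> r) (\<nu> s) \<le> \<omega>"
    and c: "close d (law t) (\<nu> s)"
  shows "close ((1 + (2 * L + growth) * h) * d +
     h * (modulus * \<omega> + deriv_mass * (2 * C)\<^sup>2 * h + (2 * L + growth) * \<epsilon> + growth * (2 * C * h) + 2 * C * \<delta>)) (law t') (\<nu> s')"
  unfolding close_def
proof (intro allI impI)
  fix \<phi> :: "real ^ 'n \<Rightarrow> real" assume \<phi>: "1-lipschitz_on UNIV \<phi>" "bounded_support \<phi>"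
  let ?A = "LINT r|lebesgue_on {s..s'}. \<alpha> r" and ?B = "LINT r|lebesgue_on {s..s'}. \<beta> r"
  define V where "V = velocity ?A ?B (\<nu> s)"
  define \<phi>' where "\<phi>' y = \<phi> (y + V y)" for y
  have \<nu>s: "\<nu> s \<in> P1" using s by (intro \<nu>_P1) auto
  have h0: "0 \<le> h" using h(1) s by simp
  have AB: "\<bar>?A\<bar> + manhattan ?B \<le> h" using integral_control_bound[OF s] h(1) by simp
  have l: "norm (V x - V y) \<le> 2 * L * h * norm (x - y)" for x y
  proof -
    have "norm (V x - V y) \<le> 2 * L * (\<bar>?A\<bar> + manhattan ?B) * norm (x - y)"
      unfolding V_def by (rule velocity_lipschitz[OF \<nu>s])
    also have "\<dots> \<le> 2 * L * h * norm (x - y)"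
      using AB L_nonneg by (intro mult_right_mono mult_left_mono) auto
    finally show ?thesis .
  qed
  have l0: "0 \<le> 2 * L * h" using L_nonneg h0 by simp
  have d\<phi>: "\<bar>\<phi> a - \<phi> b\<bar> \<le> norm (a - b)" for a b using lipschitz_onD[OF \<phi>(1), of a b] by (simp add: dist_norm)
  have \<phi>'_lip: "(1 + 2 * L * h)-lipschitz_on UNIV \<phi>'"
  proof (rule lipschitz_onI)
    fix x y
    have "\<bar>\<phi>' x - \<phi>' y\<bar> \<le> norm ((x - y) + (V x - V y))"
      unfolding \<phi>'_def using d\<phi>[of "x + V x" "y + V y"] by (simp add: algebra_simps)
    also have "\<dots> \<le> norm (x - y) + 2 * L * h * norm (x - y)"
      by (rule norm_triangle_le[OF add_mono[OF order_refl l]])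
    finally show "dist (\<phi>' x) (\<phi>' y) \<le> (1 + 2 * L * h) * dist x y" by (simp add: dist_norm distrib_right)
  qed (use l0 in simp)
  have \<phi>'_supp: "bounded_support \<phi>'"
  proof -
    obtain R where R: "\<And>x. R < norm x \<Longrightarrow> \<phi> x = 0" using \<phi>(2) unfolding bounded_support_def by blast
    have "\<phi>' x = 0" if "R + 2 * C * (\<bar>?A\<bar> + manhattan ?B) < norm x" for x
    proof -
      have "norm (V x) \<le> 2 * C * (\<bar>?A\<bar> + manhattan ?B)" unfolding V_def by (rule velocity_bound[OF \<nu>s])
      then have "R < norm (x + V x)" using that norm_diff_ineq[of x "V x"] by linarith
      then show ?thesis unfolding \<phi>'_def by (rule R)
    qed
    then show ?thesis unfolding bounded_support_def by blast
  qed
  \<comment> \<open>The only smoothness requirement in the argument: the mollified function is fed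
    to the weak formulation, with \<open>deriv_mass\<close> as its second order constant.\<close>
  interpret O: observed_solution f\<^sub>0 g f C L "fun_convolution \<phi> \<kappa>" deriv_mass S \<alpha> \<beta> \<theta> \<nu>
    by unfold_locales (rule mollified_observable[OF \<phi>] deriv_mass_nonneg S_pos solution)+
  have 1: "\<bar>(LINT x|\<nu> s'. fun_convolution \<phi> \<kappa> x) - (LINT x|\<nu> s. fun_convolution \<phi> \<kappa> (x + V x))\<bar> \<le> h * (modulus * \<omega>) + deriv_mass * (2 * C * h)\<^sup>2"
    using O.one_step[OF s \<omega>] unfolding V_def h(1) modulus_def O.pairing_modulus_def by simp
  interpret \<nu>s: prob_space "\<nu> s" using \<nu>s by (rule P1_prob_space)
  have clip: "1-lipschitz_on UNIV (fun_convolution \<phi> \<kappa>)" by (rule mollified_lipschitz[OF \<phi>])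
  have V_lip: "(2 * L * h)-lipschitz_on UNIV V" by (rule lipschitz_onI) (use l l0 in \<open>auto simp: dist_norm\<close>)
  have i1: "integrable (\<nu> s) (\<lambda>x. fun_convolution \<phi> \<kappa> (x + V x))"
    by (rule P1_lipschitz_integrable[OF \<nu>s lipschitz_on_compose2[OF lipschitz_on_add[OF lipschitz_on_id V_lip] lipschitz_on_subset[OF clip]]]) auto
  have C_inf\<phi>': "C_inf (fun_convolution \<phi>' \<kappa>)" "bounded_support (fun_convolution \<phi>' \<kappa>)"
    using C_inf_fun_convolution[OF bounded_support_integrable[OF lipschitz_on_continuous_on[OF \<phi>'_lip] \<phi>'_supp] \<kappa>_smooth \<kappa>_bounded_support]
      bounded_support_fun_convolution[OF \<phi>'_supp \<kappa>_bounded_support] by auto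
  obtain b where b: "\<And>x. \<bar>fun_convolution \<phi>' \<kappa> x\<bar> \<le> b" using bounded_support_bounded[OF C_infD(3)[OF C_inf\<phi>'(1)] C_inf\<phi>'(2)] by blast
  have i2: "integrable (\<nu> s) (fun_convolution \<phi>' \<kappa>)"
    by (rule \<nu>s.integrable_const_bound[where B = b])
       (use b borel_measurable_continuous_onI[OF C_infD(3)[OF C_inf\<phi>'(1)]] in \<open>auto simp: P1_borel_measurable[OF \<nu>s]\<close>)
  have "norm (LINT x|\<nu> s. fun_convolution \<phi> \<kappa> (x + V x) - fun_convolution \<phi>' \<kappa> x) \<le> (LINT x|\<nu> s. 2 * L * h * \<epsilon>)"
    by (rule Bochner_Integration.integral_norm_bound_integral)
       (use i1 i2 mollified_transport[OF \<phi>(1) l l0, folded \<phi>'_def] in auto)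
  then have 2: "\<bar>(LINT x|\<nu> s. fun_convolution \<phi> \<kappa> (x + V x)) - (LINT x|\<nu> s. fun_convolution \<phi>' \<kappa> x)\<bar> \<le> 2 * L * h * \<epsilon>"
    using i1 i2 by (simp add: \<nu>s.prob_space)
  have 3: "\<bar>(LINT x|law t. \<phi>' x) - (LINT x|\<nu> s. fun_convolution \<phi>' \<kappa> x)\<bar> \<le> (1 + 2 * L * h) * d"
    by (rule close_scaled[OF c \<phi>'_lip \<phi>'_supp]) (use l0 in simp)
  define e where "e = growth * (2 * C * h) * h + (2 * C * (\<delta> * h) + h * (growth * (d + \<epsilon>)))"
  have e: "norm (X t' x - (X t x + V (X t x))) \<le> e" for x
  proof -
    let ?V' = "velocity (t' - t) (LINT r|lebesgue_on {t..t'}. u r) (law t)"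
    have "norm (?V' (X t x) - V (X t x)) \<le> 2 * C * (\<delta> * h) + h * (growth * (d + \<epsilon>))"
      using frozen_velocity_mismatch[OF s c \<delta>] unfolding V_def h(1) .
    from norm_triangle_le[OF add_mono[OF frozen_velocity_error[OF t h(2), of x] this]]
    moreover have "X t' x - (X t x + V (X t x)) = (X t' x - (X t x + ?V' (X t x))) + (?V' (X t x) - V (X t x))" by simp
    ultimately show ?thesis unfolding e_def by (simp only:)
  qed
  interpret \<theta>: prob_space \<theta> using \<theta> by (rule P1_prob_space)
  note lip_int = P1_lipschitz_integrable[OF law_P1]
  have push: "(LINT x|law r. h x) = (LINT x|\<theta>. h (X r x))" "integrable \<theta> (\<lambda>x. h (X r x))" if "k-lipschitz_on UNIV h" for h :: "real ^ 'n \<Rightarrow> real" and k r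
  proof -
    have [measurable]: "h \<in> borel_measurable borel" by (rule lipschitz_measurable[OF that])
    show "(LINT x|law r. h x) = (LINT x|\<theta>. h (X r x))" unfolding law_def using X_meas_\<theta> by (simp add: integral_distr)
    show "integrable \<theta> (\<lambda>x. h (X r x))" using lip_int[OF that, of r] X_meas_\<theta> unfolding law_def by (simp add: integrable_distr_eq)
  qed
  have "norm (LINT x|\<theta>. \<phi> (X t' x) - \<phi>' (X t x)) \<le> (LINT x|\<theta>. e)"
  proof (rule Bochner_Integration.integral_norm_bound_integral)
    show "integrable \<theta> (\<lambda>x. \<phi> (X t' x) - \<phi>' (X t x))"
      by (intro Bochner_Integration.integrable_diff push(2)[OF \<phi>(1)] push(2)[OF \<phi>'_lip])
    show "norm (\<phi> (X t' x) - \<phi>' (X t x)) \<le> e" for x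
      unfolding \<phi>'_def using order_trans[OF d\<phi> e] by simp
  qed simp
  then have 4: "\<bar>(LINT x|law t'. \<phi> x) - (LINT x|law t. \<phi>' x)\<bar> \<le> e"
    unfolding push(1)[OF \<phi>(1)] push(1)[OF \<phi>'_lip] using push(2)[OF \<phi>(1)] push(2)[OF \<phi>'_lip] by (simp add: \<theta>.prob_space)
  have "\<bar>(LINT x|law t'. \<phi> x) - (LINT x|\<nu> s'. fun_convolution \<phi> \<kappa> x)\<bar>
    \<le> e + (1 + 2 * L * h) * d + 2 * L * h * \<epsilon> + (h * (modulus * \<omega>) + deriv_mass * (2 * C * h)\<^sup>2)"
    using 1 2 3 4 by linarith
  also have "\<dots> = (1 + (2 * L + growth) * h) * d +
     h * (modulus * \<omega> + deriv_mass * (2 * C)\<^sup>2 * h + (2 * L + growth) * \<epsilon> + growth * (2 * C * h) + 2 * C * \<delta>)"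
    unfolding e_def by (simp add: algebra_simps power2_eq_square)
  finally show "\<bar>(LINT x|law t'. \<phi> x) - (LINT x|\<nu> s'. fun_convolution \<phi> \<kappa> x)\<bar> \<le> (1 + (2 * L + growth) * h) * d +
     h * (modulus * \<omega> + deriv_mass * (2 * C)\<^sup>2 * h + (2 * L + growth) * \<epsilon> + growth * (2 * C * h) + 2 * C * \<delta>)" .
qed

text \<open>Discrete Gronwall. Each block multiplies the distance by 1 + (2 L + growth) h and adds h
  err; since N h \<le> S, both the product of the factors and the sum of the sources are bounded
  independently of the number of blocks.\<close>

lemma close_iterate:
  fixes h \<delta> \<omega> :: real and t :: "nat \<Rightarrow> real"
  assumes part: "\<And>j. j < N \<Longrightarrow> 0 \<le> t j" "\<And>j. j < N \<Longrightarrow> t j \<le> t (Suc j)" "\<And>j. j < N \<Longrightarrow> t (Suc j) \<le> T" "t 0 = 0"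
    and h: "0 \<le> h" "real N * h \<le> S"
    and cost: "\<And>j. j < N \<Longrightarrow> (t (Suc j) - t j) + (LINT r|lebesgue_on {t j..t (Suc j)}. manhattan (u r)) \<le> h"
    and \<delta>: "\<And>j. j < N \<Longrightarrow> \<bar>(t (Suc j) - t j) - (LINT r|lebesgue_on {j * h..Suc j * h}. \<alpha> r)\<bar> +
        manhattan ((LINT r|lebesgue_on {t j..t (Suc j)}. u r) - (LINT r|lebesgue_on {j * h..Suc j * h}. \<beta> r)) \<le> \<delta> * h"
    and \<omega>: "\<And>r s. r \<in> {0..S} \<Longrightarrow> s \<in> {0..S} \<Longrightarrow> \<bar>r - s\<bar> \<le> h \<Longrightarrow> W1 (\<nu> r) (\<nu> s) \<le> \<omega>"
    and \<omega>0: "0 \<le> \<omega>" "0 \<le> \<delta>"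
    and j: "j \<le> N"
  defines "err \<equiv> modulus * \<omega> + deriv_mass * (2 * C)\<^sup>2 * h + (2 * L + growth) * \<epsilon> + growth * (2 * C * h) + 2 * C * \<delta>"
  shows "close (exp ((2 * L + growth) * S) * (\<epsilon> + S * err)) (law (t j)) (\<nu> (j * h))"
proof -
  let ?c = "2 * L + growth"
  have c0: "0 \<le> ?c" using L_nonneg growth_nonneg by simp
  have err0: "0 \<le> err"
    unfolding err_def modulus_def using L_nonneg growth_nonneg C_nonneg deriv_mass_nonneg h(1) \<omega>0 \<epsilon>_pos by simp
  have mono: "close d' \<mu> \<pi>" if "close d \<mu> \<pi>" "d \<le> d'" for d d' \<mu> \<pi>
    using that unfolding close_def by (meson order_trans)
  \<comment> \<open>The growth factor is put in front of the whole accumulated source. As it is at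
    least 1, each new source may be multiplied by it as well, and the claim keeps its closed
    form.\<close>
  have rec: "close ((1 + ?c * h) ^ j * (\<epsilon> + j * h * err)) (law (t j)) (\<nu> (j * h))"
    using j
  proof (induction j)
    case 0
    then show ?case using close_initial part(4) by simp
  next
    case (Suc j)
    have jN: "j < N" using Suc.prems by simp
    have sN: "real (Suc j) * h \<le> S"
      using Suc.prems h mult_right_mono[of "real (Suc j)" "real N" h] by simp
    have step: "close ((1 + ?c * h) * ((1 + ?c * h) ^ j * (\<epsilon> + j * h * err)) + h * err) (law (t (Suc j))) (\<nu> (Suc j * h))"
      unfolding err_def
    proof (rule close_step)
      show "close ((1 + ?c * h) ^ j * (\<epsilon> + j * h * (modulus * \<omega> + deriv_mass * (2 * C)\<^sup>2 * h + (2 * L + growth) * \<epsilon> + growth * (2 * C * h) + 2 * C * \<delta>)))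
         (law (t j)) (\<nu> (j * h))"
        using Suc.IH jN unfolding err_def by simp
      show "W1 (\<nu> r) (\<nu> (j * h)) \<le> \<omega>" if "r \<in> {j * h..Suc j * h}" for r
      proof (rule \<omega>)
        have "0 \<le> real j * h" using h by simp
        moreover have "real (Suc j) * h = real j * h + h" by (simp add: algebra_simps)
        moreover have "real j * h \<le> r" "r \<le> real (Suc j) * h" using that by auto
        ultimately show "r \<in> {0..S}" "real j * h \<in> {0..S}" "\<bar>r - j * h\<bar> \<le> h"
          using sN h(1) unfolding atLeastAtMost_iff by linarith+
      qed
      show "real j * h \<le> Suc j * h" using h(1) by (simp add: algebra_simps)
      show "Suc j * h - j * h = h" by (simp add: algebra_simps)
    qed (use part jN cost \<delta> sN h(1) in auto)
    have "1 \<le> (1 + ?c * h) ^ Suc j" using c0 h(1) by (intro one_le_power) simp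
    then have "h * err \<le> (1 + ?c * h) ^ Suc j * (h * err)"
      using mult_right_mono[of 1 "(1 + ?c * h) ^ Suc j" "h * err"] h(1) err0 by simp
    then have "(1 + ?c * h) * ((1 + ?c * h) ^ j * (\<epsilon> + j * h * err)) + h * err \<le> (1 + ?c * h) ^ Suc j * (\<epsilon> + j * h * err) + (1 + ?c * h) ^ Suc j * (h * err)"
      by simp
    also have "\<dots> = (1 + ?c * h) ^ Suc j * (\<epsilon> + Suc j * h * err)" by (simp add: algebra_simps)
    finally show ?case by (rule mono[OF step])
  qed
  have "(1 + ?c * h) ^ j \<le> exp (?c * h) ^ j"
    using c0 h(1) by (intro power_mono exp_ge_add_one_self) auto
  also have "\<dots> = exp (?c * (j * h))" by (simp add: exp_of_nat_mult[symmetric] mult_ac)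
  also have "\<dots> \<le> exp (?c * S)"
    using c0 j h mult_right_mono[of "real j" "real N" h] by (simp add: mult_left_mono)
  finally have "(1 + ?c * h) ^ j * (\<epsilon> + j * h * err) \<le> exp (?c * S) * (\<epsilon> + S * err)"
    using j h mult_right_mono[of "real j" "real N" h] err0 \<epsilon>_pos c0
    by (intro mult_mono add_left_mono mult_right_mono) auto
  then show ?thesis by (rule mono[OF rec])
qed

end

subsection \<open>The delayed clock\<close>

text \<open>Variation and right continuity are both controlled by H after p: its increments
  telescope along any partition because p is monotone, and continuity of H transfers the right
  continuity of p. Jumps of p are allowed.\<close>

lemma BV_plus_composition:
  fixes H p :: "real \<Rightarrow> real"
  assumes G: "\<And>s. s \<in> {0..S} \<Longrightarrow> G s \<in> X"
    and d: "\<And>x y. x \<in> X \<Longrightarrow> y \<in> X \<Longrightarrow> 0 \<le> d x y" "\<And>x y. d x y = d y x"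
    and H: "continuous_on {0..S} H" "\<And>s s'. 0 \<le> s \<Longrightarrow> s \<le> s' \<Longrightarrow> s' \<le> S \<Longrightarrow> d (G s) (G s') \<le> H s' - H s"
    and p: "\<And>t. t \<in> {0..T} \<Longrightarrow> p t \<in> {0..S}" "\<And>t t'. 0 \<le> t \<Longrightarrow> t \<le> t' \<Longrightarrow> t' \<le> T \<Longrightarrow> p t \<le> p t'"
    and p_right: "\<And>t. t \<in> {0..<T} \<Longrightarrow> (p \<longlongrightarrow> p t) (at_right t)"
  shows "(\<lambda>t. G (p t)) \<in> BV_plus X d T"
  unfolding BV_plus_def
proof (intro CollectI conjI ballI exI[of _ "H S - H 0"] allI impI)
  show "G (p t) \<in> X" if "t \<in> {0..T}" for t using G[OF p(1)[OF that]] .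
  have Hmono: "H s \<le> H s'" if "0 \<le> s" "s \<le> s'" "s' \<le> S" for s s'
    using H(2)[OF that] d(1)[OF G G, of s s'] that by simp
  show "(\<Sum>i<N. d (G (p (\<tau> i))) (G (p (\<tau> (Suc i))))) \<le> H S - H 0"
    if "mono_on {..N} \<tau> \<and> \<tau> ` {..N} \<subseteq> {0..T}" for N :: nat and \<tau>
  proof -
    have \<tau>: "0 \<le> \<tau> i" "\<tau> i \<le> T" if "i \<le> N" for i
      using \<open>mono_on {..N} \<tau> \<and> \<tau> ` {..N} \<subseteq> {0..T}\<close> that by (auto simp: image_subset_iff)
    have "(\<Sum>i<N. d (G (p (\<tau> i))) (G (p (\<tau> (Suc i))))) \<le> (\<Sum>i<N. H (p (\<tau> (Suc i))) - H (p (\<tau> i)))"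
    proof (rule sum_mono)
      fix i assume i: "i \<in> {..<N}"
      have "\<tau> i \<le> \<tau> (Suc i)" using that i by (auto simp: mono_on_def)
      then have "p (\<tau> i) \<le> p (\<tau> (Suc i))" using \<tau>[of i] \<tau>[of "Suc i"] i by (intro p(2)) auto
      then show "d (G (p (\<tau> i))) (G (p (\<tau> (Suc i)))) \<le> H (p (\<tau> (Suc i))) - H (p (\<tau> i))"
        using p(1)[of "\<tau> i"] p(1)[of "\<tau> (Suc i)"] \<tau>[of i] \<tau>[of "Suc i"] i by (intro H(2)) auto
    qed
    also have "\<dots> = H (p (\<tau> N)) - H (p (\<tau> 0))" by (rule sum_lessThan_telescope)
    also have "\<dots> \<le> H S - H 0"
      using p(1)[of "\<tau> N"] p(1)[of "\<tau> 0"] \<tau>[of N] \<tau>[of 0]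
      by (intro diff_mono Hmono) auto
    finally show ?thesis .
  qed
  fix t assume t: "t \<in> {0..<T}"
  have ev: "\<forall>\<^sub>F s in at_right t. s \<in> {t<..<T}"
    unfolding eventually_at_right_field using t by (intro exI[of _ T]) auto
  have pt: "p t \<in> {0..S}" using t by (intro p(1)) auto
  have "((\<lambda>s. H (p s)) \<longlongrightarrow> H (p t)) (at_right t)"
    by (rule continuous_on_tendsto_compose[OF H(1) p_right[OF t] pt])
       (use t in \<open>auto intro!: eventually_mono[OF ev] p(1)[simplified]\<close>)
  then have lim: "((\<lambda>s. H (p s) - H (p t)) \<longlongrightarrow> 0) (at_right t)"
    by (intro tendsto_eq_intros) auto
  show "((\<lambda>s. d (G (p s)) (G (p t))) \<longlongrightarrow> 0) (at_right t)"
  proof (rule tendsto_sandwich[OF _ _ tendsto_const lim])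
    show "\<forall>\<^sub>F s in at_right t. 0 \<le> d (G (p s)) (G (p t))"
    proof (rule eventually_mono[OF ev])
      fix s assume s: "s \<in> {t<..<T}"
      have "p s \<in> {0..S}" using s t by (intro p(1)) auto
      then show "0 \<le> d (G (p s)) (G (p t))" using pt by (intro d(1) G)
    qed
    show "\<forall>\<^sub>F s in at_right t. d (G (p s)) (G (p t)) \<le> H (p s) - H (p t)"
    proof (rule eventually_mono[OF ev])
      fix s assume s: "s \<in> {t<..<T}"
      have "p s \<in> {0..S}" using s t by (intro p(1)) auto
      moreover have "p t \<le> p s" using s t by (intro p(2)) auto
      ultimately show "d (G (p s)) (G (p t)) \<le> H (p s) - H (p t)"
        using pt by (subst d(2)) (intro H(2); auto)
    qed
  qed
qed

lemma primitive_increment: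
  fixes h :: "real \<Rightarrow> real ^ 'm"
  assumes h: "integrable (lebesgue_on {0..S}) h" and s: "0 \<le> s" "s \<le> s'" "s' \<le> S"
  shows "primitive h s' - primitive h s = (LINT r|lebesgue_on {s..s'}. h r)"
    and "manhattan (primitive h s - primitive h s')
      \<le> (LINT r|lebesgue_on {0..s'}. manhattan (h r)) - (LINT r|lebesgue_on {0..s}. manhattan (h r))"
proof -
  show e: "primitive h s' - primitive h s = (LINT r|lebesgue_on {s..s'}. h r)"
    unfolding primitive_def using lebesgue_on_integral_combine[OF h, of 0 s s'] s by simp
  have "manhattan (primitive h s - primitive h s') \<le> (LINT r|lebesgue_on {s..s'}. manhattan (h r))"
    unfolding manhattan_minus_commute[of "primitive h s"] e
    by (rule manhattan_integral_le[OF lebesgue_on_integrable_sub[OF h s(1,3)]])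
  then show "manhattan (primitive h s - primitive h s')
      \<le> (LINT r|lebesgue_on {0..s'}. manhattan (h r)) - (LINT r|lebesgue_on {0..s}. manhattan (h r))"
    using lebesgue_on_integral_combine[OF manhattan_integral_le(1)[OF h], of 0 s s'] s by simp
qed

lemma primitive_BV_plus:
  fixes h :: "real \<Rightarrow> real ^ 'm"
  assumes h: "integrable (lebesgue_on {0..S}) h"
    and p: "\<And>t. t \<in> {0..T} \<Longrightarrow> p t \<in> {0..S}" "\<And>t t'. 0 \<le> t \<Longrightarrow> t \<le> t' \<Longrightarrow> t' \<le> T \<Longrightarrow> p t \<le> p t'"
      "\<And>t. t \<in> {0..<T} \<Longrightarrow> (p \<longlongrightarrow> p t) (at_right t)"
  shows "(\<lambda>t. primitive h (p t)) \<in> BV_plus UNIV (\<lambda>x y. manhattan (x - y)) T"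
proof (rule BV_plus_composition[where G = "primitive h" and S = S and p = p])
  show "continuous_on {0..S} (\<lambda>t. LINT r|lebesgue_on {0..t}. manhattan (h r))"
    by (rule continuous_on_lebesgue_primitive[OF manhattan_integral_le(1)[OF h]])
qed (use primitive_increment(2)[OF h] p manhattan_minus_commute in auto)

lemma ac_curve_BV_plus:
  assumes ac: "ac_curve S \<nu>" "0 \<le> S"
    and p: "\<And>t. t \<in> {0..T} \<Longrightarrow> p t \<in> {0..S}" "\<And>t t'. 0 \<le> t \<Longrightarrow> t \<le> t' \<Longrightarrow> t' \<le> T \<Longrightarrow> p t \<le> p t'"
      "\<And>t. t \<in> {0..<T} \<Longrightarrow> (p \<longlongrightarrow> p t) (at_right t)"
  shows "(\<lambda>t. \<nu> (p t)) \<in> BV_plus P1 W1 T"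
proof -
  obtain H where H: "continuous_on {0..S} H"
    "\<And>s t. 0 \<le> s \<Longrightarrow> s \<le> t \<Longrightarrow> t \<le> S \<Longrightarrow> W1 (\<nu> s) (\<nu> t) \<le> H t - H s"
    using ac_curve_modulus[OF ac] by blast
  show ?thesis
    by (rule BV_plus_composition[OF ac_curve_P1[OF ac(1)] W1_nonneg W1_commute H p])
qed

section \<open>The clock of the reduced process and its pseudo-inverse\<close>

locale reduced_process = velocity_data f\<^sub>0 g f C L + admissible_control S \<alpha> \<beta>
  for f\<^sub>0 g :: "real ^ 'n \<Rightarrow> real ^ 'n" and f :: "'m::finite \<Rightarrow> real ^ 'n \<Rightarrow> real ^ 'n" and C L
    and S and \<alpha> :: "real \<Rightarrow> real" and \<beta> :: "real \<Rightarrow> real ^ 'm" +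
  fixes T M :: real and \<theta> :: "(real ^ 'n) measure" and \<nu> :: "real \<Rightarrow> (real ^ 'n) measure"
  assumes T_pos: "0 < T" and M_pos: "0 < M" and S_eq: "S = T + M" and \<theta>: "\<theta> \<in> P1"
    and \<alpha>_total: "(LINT s|lebesgue_on {0..S}. \<alpha> s) = T"
    and solution: "solves_continuity_eq S (\<lambda>s x. velocity (\<alpha> s) (\<beta> s) (\<nu> s) x) \<theta> \<nu>"
begin

lemma S_pos: "0 < S" using T_pos M_pos S_eq by simp

lemma ac: "ac_curve S \<nu>" using solution by (simp add: solves_continuity_eq_def)

definition \<xi> :: "real \<Rightarrow> real" where "\<xi> = primitive \<alpha>"

lemma \<xi>_increment:
  assumes "0 \<le> s" "s \<le> s'" "s' \<le> S"
  shows "\<xi> s' - \<xi> s = (LINT r|lebesgue_on {s..s'}. \<alpha> r)"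
  unfolding \<xi>_def primitive_def using lebesgue_on_integral_combine[OF \<alpha>_integrable, of 0 s s'] assms by simp

lemma \<xi>_increment_bounds:
  assumes "0 \<le> s" "s \<le> s'" "s' \<le> S"
  shows "0 \<le> \<xi> s' - \<xi> s" "\<xi> s' - \<xi> s \<le> s' - s"
  unfolding \<xi>_increment[OF assms]
  using integral_control_bound[OF assms] manhattan_nonneg[of "LINT r|lebesgue_on {s..s'}. \<beta> r"] by linarith+

lemma \<xi>_0: "\<xi> 0 = 0"
  using \<xi>_increment_bounds[of 0 0] \<xi>_increment[of 0 0] S_pos unfolding \<xi>_def primitive_def by simp

lemma \<xi>_S: "\<xi> S = T" unfolding \<xi>_def primitive_def by (rule \<alpha>_total)

text \<open>\<xi> has slope at most 1 and must still reach T at S = T + M, so it cannot fall below T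
  - (S - s) = s - M.\<close>

lemma \<xi>_lower: "s \<in> {0..S} \<Longrightarrow> max 0 (s - M) \<le> \<xi> s"
  using \<xi>_increment_bounds[of s S] \<xi>_increment_bounds[of 0 s] \<xi>_0 \<xi>_S S_eq by auto

lemma \<xi>_mono: "0 \<le> s \<Longrightarrow> s \<le> s' \<Longrightarrow> s' \<le> S \<Longrightarrow> \<xi> s \<le> \<xi> s'"
  using \<xi>_increment_bounds(1)[of s s'] by simp

lemma \<xi>_range: "s \<in> {0..S} \<Longrightarrow> \<xi> s \<in> {0..T}"
  using \<xi>_mono[of 0 s] \<xi>_mono[of s S] \<xi>_0 \<xi>_S by auto

definition p :: "real \<Rightarrow> real" where "p = pseudo_inverse T S \<xi>"

lemma p_T: "p T = S" by (simp add: p_def pseudo_inverse_def)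

lemma p_eq: "t < T \<Longrightarrow> p t = Inf {s \<in> {0..S}. t < \<xi> s}" by (simp add: p_def pseudo_inverse_def)

lemma p_set: assumes "t < T" shows "{s \<in> {0..S}. t < \<xi> s} \<noteq> {}" "bdd_below {s \<in> {0..S}. t < \<xi> s}"
proof -
  have "S \<in> {s \<in> {0..S}. t < \<xi> s}" using assms \<xi>_S S_pos by simp
  then show "{s \<in> {0..S}. t < \<xi> s} \<noteq> {}" by blast
  show "bdd_below {s \<in> {0..S}. t < \<xi> s}" by (rule bdd_belowI[of _ 0]) auto
qed

lemma p_range: assumes "t \<in> {0..T}" shows "p t \<in> {0..S}"
proof (cases "t < T")
  case True
  have "S \<in> {s \<in> {0..S}. t < \<xi> s}" using True \<xi>_S S_pos by simp
  then have "p t \<le> S" unfolding p_eq[OF True] by (rule cInf_lower) (rule p_set(2)[OF True])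
  moreover have "0 \<le> p t" unfolding p_eq[OF True] by (rule cInf_greatest[OF p_set(1)[OF True]]) auto
  ultimately show ?thesis by simp
next
  case False
  then show ?thesis using assms p_T S_pos by simp
qed

lemma \<xi>_above_p:
  assumes "t < T" "s \<in> {0..S}" "p t < s" shows "t < \<xi> s"
proof -
  obtain r where r: "r \<in> {0..S}" "t < \<xi> r" "r < s"
    using assms(3) unfolding p_eq[OF assms(1)] cInf_less_iff[OF p_set[OF assms(1)]] by auto
  then show ?thesis using \<xi>_mono[of r s] assms(2) by auto
qed

lemma \<xi>_below_p:
  assumes "t < T" "s \<in> {0..S}" "s < p t" shows "\<xi> s \<le> t"
proof (rule ccontr)
  assume "\<not> \<xi> s \<le> t"
  then have "p t \<le> s" unfolding p_eq[OF assms(1)] using assms(2) by (intro cInf_lower p_set(2)[OF assms(1)]) auto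
  then show False using assms(3) by simp
qed

lemma p_mono: assumes "0 \<le> t" "t \<le> t'" "t' \<le> T" shows "p t \<le> p t'"
proof (cases "t' < T")
  case True
  then have "t < T" using assms by simp
  show ?thesis
    unfolding p_eq[OF True] p_eq[OF \<open>t < T\<close>]
    by (rule cInf_superset_mono[OF p_set(1)[OF True] p_set(2)[OF \<open>t < T\<close>]]) (use assms in auto)
next
  case False
  then show ?thesis using assms p_T p_range[of t] by simp
qed

text \<open>The strict inequality in the pseudo-inverse is responsible: a point r with t < \<xi> r
  is a competitor for every later time below \<xi> r as well.\<close>

lemma p_right_continuous:
  assumes t: "t \<in> {0..<T}" shows "(p \<longlongrightarrow> p t) (at_right t)"
proof (rule order_tendstoI)
  fix a assume a: "a < p t"
  show "\<forall>\<^sub>F s in at_right t. a < p s"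
    unfolding eventually_at_right_field
    using t a p_mono by (intro exI[of _ T]) (auto intro: less_le_trans)
next
  fix a assume a: "p t < a"
  have tT: "t < T" using t by simp
  obtain r where r: "r \<in> {0..S}" "t < \<xi> r" "r < a"
    using a unfolding p_eq[OF tT] cInf_less_iff[OF p_set[OF tT]] by auto
  have "p s < a" if s: "t < s" "s < \<xi> r" for s
  proof -
    have sT: "s < T" using s \<xi>_range[OF r(1)] by simp
    have "p s \<le> r" unfolding p_eq[OF sT] using r(1) s by (intro cInf_lower p_set(2)[OF sT]) auto
    then show ?thesis using r(3) by simp
  qed
  then show "\<forall>\<^sub>F s in at_right t. p s < a"
    unfolding eventually_at_right_field using r(2) by blast
qed

text \<open>The shift by 3 gives \<delta> k \<le> 1/3, so that \<open>weight k\<close> is positive;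
  the reciprocal of an integer makes the number of blocks S / mesh k = (k + 3)^2 an integer.\<close>

definition \<delta> :: "nat \<Rightarrow> real" where "\<delta> k = 1 / (real k + 3)"

text \<open>The mesh is quadratic in \<open>\<delta> k\<close> so that it does not spoil the delay of the clock below, which is of
  first order in \<open>\<delta> k\<close>.\<close>

definition mesh :: "nat \<Rightarrow> real" where "mesh k = S * (\<delta> k)\<^sup>2"

text \<open>What remains for \<xi> when two other clocks enter with weights \<delta> k and its
  square: the result is a convex combination of three clocks that run from 0 to T with slope at most
  1.\<close>

definition weight :: "nat \<Rightarrow> real" where "weight k = 1 - \<delta> k - (\<delta> k)\<^sup>2"

text \<open>Among all primitives of admissible controls, \<open>max 0 (s - M)\<close> is the smallest, and it is strictly
  increasing wherever it is positive. Mixing it in delays the clock, so that the inverse of the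
  perturbed clock approaches the right end point of every interval on which \<open>\<xi>\<close> is constant with a
  value in \<open>(0, T)\<close>. The second order term makes the clock strictly increasing.\<close>

definition clock :: "nat \<Rightarrow> real \<Rightarrow> real"
  where "clock k s = weight k * \<xi> s + \<delta> k * max 0 (s - M) + (\<delta> k)\<^sup>2 * (s * (T / S))"

lemma \<delta>_bounds: "0 < \<delta> k" "\<delta> k \<le> 1 / 3" "(\<delta> k)\<^sup>2 \<le> \<delta> k" "0 < weight k" "weight k \<le> 1"
proof -
  show 1: "0 < \<delta> k" "\<delta> k \<le> 1 / 3" by (auto simp: \<delta>_def divide_simps)
  have "(\<delta> k)\<^sup>2 = \<delta> k * \<delta> k" by (simp add: power2_eq_square)
  also have "\<dots> \<le> \<delta> k * (1 / 3)" using 1 by (intro mult_left_mono) auto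
  finally have 2: "(\<delta> k)\<^sup>2 \<le> \<delta> k / 3" by simp
  then show "(\<delta> k)\<^sup>2 \<le> \<delta> k" using 1 by simp
  show "0 < weight k" unfolding weight_def using 1 2 by linarith
  show "weight k \<le> 1" unfolding weight_def using 1 zero_le_power2[of "\<delta> k"] by linarith
qed

lemma \<delta>_limit: "\<delta> \<longlonglongrightarrow> 0"
  unfolding \<delta>_def using LIMSEQ_ignore_initial_segment[OF lim_1_over_n, of 3] by (simp add: add.commute)

lemma mesh_limit: "mesh \<longlonglongrightarrow> 0"
  unfolding mesh_def using \<delta>_limit by (auto intro!: tendsto_eq_intros)

lemma mesh_pos: "0 < mesh k"
  unfolding mesh_def using S_pos \<delta>_bounds(1)[of k] by simp

lemma mesh_steps: "real ((k + 3)\<^sup>2) * mesh k = S"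
  unfolding mesh_def \<delta>_def by (simp add: power_divide field_simps)

lemma clock_0: "clock k 0 = 0" unfolding clock_def using \<xi>_0 M_pos by simp

lemma clock_S: "clock k S = T"
  unfolding clock_def weight_def using \<xi>_S S_pos S_eq T_pos by (simp add: field_simps)

text \<open>The second bound is the budget of a block. The two added clocks have slope at most 1, so
  the length left over by the perturbed clock is at least \<open>weight k\<close> times the length
  left over by \<xi>, which leaves room for \<open>weight k\<close> times the integral of
  \<beta>.\<close>

lemma clock_increment:
  assumes s: "0 \<le> s" "s < s'" "s' \<le> S"
  shows "0 < clock k s' - clock k s" "clock k s' - clock k s \<le> (s' - s) - weight k * ((s' - s) - (\<xi> s' - \<xi> s))"
    and "\<bar>(clock k s' - clock k s) - (\<xi> s' - \<xi> s)\<bar> \<le> 4 * \<delta> k * (s' - s)"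
proof -
  define a b c where "a = \<xi> s' - \<xi> s" and "b = max 0 (s' - M) - max 0 (s - M)" and "c = (s' - s) * (T / S)"
  have eq: "clock k s' - clock k s = weight k * a + \<delta> k * b + (\<delta> k)\<^sup>2 * c"
    unfolding clock_def a_def b_def c_def by (simp add: algebra_simps diff_divide_distrib)
  have a: "0 \<le> a" "a \<le> s' - s" unfolding a_def using \<xi>_increment_bounds[of s s'] s by auto
  have b: "0 \<le> b" "b \<le> s' - s" unfolding b_def using s by auto
  have c: "0 < c" "c \<le> s' - s"
  proof -
    show "0 < c" unfolding c_def using s T_pos S_pos by simp
    have "(s' - s) * (T / S) \<le> (s' - s) * 1"
      using s M_pos S_pos S_eq by (intro mult_left_mono) auto
    then show "c \<le> s' - s" unfolding c_def by simp
  qed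
  note d = \<delta>_bounds[of k]
  have wa: "0 \<le> weight k * a" "weight k * a \<le> a" using a d(4,5) mult_right_mono[of "weight k" 1 a] by auto
  have db: "0 \<le> \<delta> k * b" "\<delta> k * b \<le> \<delta> k * (s' - s)" using b d(1) by (auto intro: mult_left_mono)
  have dc: "0 < (\<delta> k)\<^sup>2 * c" "(\<delta> k)\<^sup>2 * c \<le> (\<delta> k)\<^sup>2 * (s' - s)" using c d(1) by (auto intro: mult_left_mono)
  show "0 < clock k s' - clock k s" unfolding eq using wa db dc by linarith
  have w: "weight k * (s' - s) = (s' - s) - \<delta> k * (s' - s) - (\<delta> k)\<^sup>2 * (s' - s)"
    unfolding weight_def by (simp add: algebra_simps)
  show "clock k s' - clock k s \<le> (s' - s) - weight k * ((s' - s) - (\<xi> s' - \<xi> s))"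
    unfolding eq a_def[symmetric] using w right_diff_distrib[of "weight k" "s' - s" a] db dc by linarith
  have d2: "(\<delta> k)\<^sup>2 * (s' - s) \<le> \<delta> k * (s' - s)" using d(3) s by (intro mult_right_mono) auto
  have "weight k * a = a - \<delta> k * a - (\<delta> k)\<^sup>2 * a" unfolding weight_def by (simp add: algebra_simps)
  moreover have "0 \<le> \<delta> k * a" "\<delta> k * a \<le> \<delta> k * (s' - s)" "0 \<le> (\<delta> k)\<^sup>2 * a" "(\<delta> k)\<^sup>2 * a \<le> (\<delta> k)\<^sup>2 * (s' - s)"
    using a d(1) by (auto intro: mult_left_mono)
  moreover have "0 \<le> \<delta> k * (s' - s)" using d(1) s by simp
  ultimately show "\<bar>(clock k s' - clock k s) - (\<xi> s' - \<xi> s)\<bar> \<le> 4 * \<delta> k * (s' - s)"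
    unfolding eq a_def[symmetric] using db dc d2 by (simp add: abs_le_iff)
qed

lemma clock_limit: "(\<lambda>k. clock k s) \<longlonglongrightarrow> \<xi> s"
proof -
  have "(\<lambda>k. weight k * \<xi> s + \<delta> k * max 0 (s - M) + (\<delta> k)\<^sup>2 * (s * (T / S))) \<longlonglongrightarrow> (1 - 0 - 0\<^sup>2) * \<xi> s + 0 * max 0 (s - M) + 0\<^sup>2 * (s * (T / S))"
    unfolding weight_def by (intro tendsto_intros \<delta>_limit)
  then show ?thesis unfolding clock_def by simp
qed

text \<open>If \<xi> s < t, convergence of the clocks suffices. The critical case is \<xi> s = t
  with s < p t, a flat piece of \<xi>: there the admixture of max 0 (s - M), which is strictly below
  t, lowers the clock to first order in \<delta> k, while the mesh and the strictly increasing term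
  are of second order.\<close>

lemma clock_delay:
  assumes t: "0 < t" "t < T" and s: "s \<in> {0..S}" "s < p t"
  shows "\<forall>\<^sub>F k in sequentially. clock k s + mesh k < t"
proof (cases "\<xi> s < t")
  case True
  have "(\<lambda>k. clock k s + mesh k) \<longlonglongrightarrow> \<xi> s + 0" by (intro tendsto_add clock_limit mesh_limit)
  then show ?thesis using True by (intro order_tendstoD(2)) auto
next
  case False
  have pS: "p t \<le> S" using p_range[of t] t by simp
  have eq: "\<xi> s = t" using \<xi>_below_p[OF t(2) s] False by simp
  \<comment> \<open>Beyond M this lower clock is strictly increasing, and at a later point r of the
    same flat piece it is still at most \<xi> r \<le> t; up to M it is 0, which is where t > 0
    enters.\<close>
  have gap: "max 0 (s - M) < t"
  proof (cases "s \<le> M")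
    case True
    then show ?thesis using t by simp
  next
    case sM: False
    define r where "r = (s + p t) / 2"
    have r: "r \<in> {0..S}" "s < r" "r < p t" using s pS by (auto simp: r_def)
    have "s - M < max 0 (r - M)" using r sM by simp
    also have "\<dots> \<le> \<xi> r" by (rule \<xi>_lower[OF r(1)])
    also have "\<dots> \<le> t" by (rule \<xi>_below_p[OF t(2) r(1,3)])
    finally show ?thesis using t by simp
  qed
  define e where "e = t - max 0 (s - M)"
  have e: "0 < e" using gap by (simp add: e_def)
  \<comment> \<open>One S bounds the strictly increasing term s (T / S), the other is the factor in
    the mesh.\<close>
  have "(\<lambda>k. \<delta> k * (S + S)) \<longlonglongrightarrow> 0" using \<delta>_limit by (auto intro!: tendsto_eq_intros)
  then have "\<forall>\<^sub>F k in sequentially. \<delta> k * (S + S) < e" using e by (rule order_tendstoD(2))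
  then show ?thesis
  proof (rule eventually_mono)
    fix k assume k: "\<delta> k * (S + S) < e"
    have "clock k s + mesh k = t - \<delta> k * e - (\<delta> k)\<^sup>2 * t + (\<delta> k)\<^sup>2 * (s * (T / S)) + S * (\<delta> k)\<^sup>2"
      unfolding clock_def mesh_def weight_def eq e_def by (simp add: algebra_simps)
    also have "\<dots> \<le> t - \<delta> k * e + (\<delta> k)\<^sup>2 * (S + S)"
    proof -
      have "s * (T / S) \<le> S * 1" using s S_pos T_pos M_pos S_eq by (intro mult_mono) auto
      then have "(\<delta> k)\<^sup>2 * (s * (T / S)) \<le> (\<delta> k)\<^sup>2 * S" by (intro mult_left_mono) auto
      moreover have "0 \<le> (\<delta> k)\<^sup>2 * t" using t by simp
      ultimately show ?thesis by (simp add: algebra_simps)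
    qed
    also have "\<dots> = t - \<delta> k * (e - \<delta> k * (S + S))" by (simp add: algebra_simps power2_eq_square)
    also have "\<dots> < t" using k \<delta>_bounds(1)[of k] by simp
    finally show "clock k s + mesh k < t" .
  qed
qed

text \<open>Points where the clock is within one mesh of t are squeezed: left of p t the delayed
  clock stays more than a mesh below t, and right of p t it tends to \<xi> a > t. The error of one
  mesh is allowed because r k will be a grid point.\<close>

lemma clock_inverse_limit:
  assumes t: "0 < t" "t < T" and r: "\<And>k. r k \<in> {0..S}" "\<And>k. \<bar>clock k (r k) - t\<bar> \<le> mesh k"
  shows "r \<longlonglongrightarrow> p t"
proof (rule order_tendstoI)
  have cmono: "clock k s \<le> clock k s'" if "0 \<le> s" "s \<le> s'" "s' \<le> S" for k s s'
    using clock_increment(1)[of s s' k] that by (cases "s = s'") auto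
  have pt: "p t \<in> {0..S}" using t by (intro p_range) auto
  fix a
  {
    assume a: "a < p t"
    show "\<forall>\<^sub>F k in sequentially. a < r k"
    proof (cases "a < 0")
      case True
      then show ?thesis using r(1) by (intro always_eventually allI) (auto intro: less_le_trans)
    next
      case False
      then have aS: "a \<in> {0..S}" using a pt by simp
      from clock_delay[OF t aS a] show ?thesis
      proof (rule eventually_mono)
        fix k assume k: "clock k a + mesh k < t"
        show "a < r k"
        proof (rule ccontr)
          assume "\<not> a < r k"
          then have "clock k (r k) \<le> clock k a" using r(1)[of k] aS by (intro cmono) auto
          then show False using k r(2)[of k] by linarith
        qed
      qed
    qed
  }
  {
    assume a: "p t < a"
    show "\<forall>\<^sub>F k in sequentially. r k < a"
    proof (cases "S < a")
      case True
      then show ?thesis using r(1) by (intro always_eventually allI) (auto intro: le_less_trans)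
    next
      case False
      then have aS: "a \<in> {0..S}" using a pt by simp
      have "(\<lambda>k. clock k a - mesh k) \<longlonglongrightarrow> \<xi> a - 0" by (intro tendsto_diff clock_limit mesh_limit)
      then have "\<forall>\<^sub>F k in sequentially. t < clock k a - mesh k"
        using \<xi>_above_p[OF t(2) aS a] by (intro order_tendstoD(1)) auto
      then show ?thesis
      proof (rule eventually_mono)
        fix k assume k: "t < clock k a - mesh k"
        show "r k < a"
        proof (rule ccontr)
          assume "\<not> r k < a"
          then have "clock k a \<le> clock k (r k)" using r(1)[of k] aS by (intro cmono) auto
          then show False using k r(2)[of k] by linarith
        qed
      qed
    qed
  }
qed

end

subsection \<open>Approximating control processes\<close>

context reduced_process
begin

text \<open>The constant \<open>growth\<close>, restated where no flow is present, so that the error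
  bound does not mention the approximating process.\<close>

definition G :: real
  where "G = 2 * L + CARD('n) * L * CARD('n)"

text \<open>The outcome of \<open>close_iterate\<close> passed through \<open>close_W1\<close>, plus
  the displacement of the flow between a grid time and t in the last summand. The 6 \<delta> k is
  the control error per unit length: 4 \<delta> k from the clock and 2 \<delta> k from the factor
  \<open>weight k\<close> on \<beta>.\<close>

definition error_bound :: "real \<Rightarrow> real \<Rightarrow> real \<Rightarrow> nat \<Rightarrow> real"
  where "error_bound dm \<omega> \<epsilon> k = CARD('n) * (exp ((2 * L + G) * S) * (\<epsilon> + S * ((2 * C * dm + 2 * L + CARD('n) * L) * \<omega>
    + dm * (2 * C)\<^sup>2 * mesh k + (2 * L + G) * \<epsilon> + G * (2 * C * mesh k) + 2 * C * (6 * \<delta> k))) + \<epsilon>) + CARD('n) * (2 * C * mesh k)"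

text \<open>s is the point of the reduced time axis to which the process has advanced at time t.
  Kernel, scale and modulus are quantified inside because the process is fixed before the scale of
  mollification is chosen.\<close>

definition tracks :: "nat \<Rightarrow> (real \<Rightarrow> (real ^ 'n) measure) \<Rightarrow> (real \<Rightarrow> real ^ 'm) \<Rightarrow> real \<Rightarrow> real \<Rightarrow> bool"
  where "tracks k \<mu> u t s \<longleftrightarrow> s \<in> {0..S} \<and> \<bar>clock k s - t\<bar> \<le> mesh k \<and> (t = T \<longrightarrow> s = S) \<and>
    manhattan (primitive u t - primitive \<beta> s) \<le> mesh k + 2 * \<delta> k * S \<and>
    (\<forall>(\<kappa> :: real ^ 'n \<Rightarrow> real) \<epsilon> \<omega>. mollifier \<kappa> \<epsilon> \<longrightarrow> 0 < \<epsilon> \<longrightarrow> 0 \<le> \<omega> \<longrightarrow>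
      (\<forall>r\<in>{0..S}. \<forall>q\<in>{0..S}. \<bar>r - q\<bar> \<le> mesh k \<longrightarrow> W1 (\<nu> r) (\<nu> q) \<le> \<omega>) \<longrightarrow>
      W1 (\<mu> t) (\<nu> s) \<le> error_bound (mollifier.deriv_mass \<kappa>) \<omega> \<epsilon> k)"

text \<open>The blocks of length \<open>mesh k\<close> are mapped by the perturbed clock to
  intervals of positive length; what the clock leaves of each block is spent as control cost, with a
  multiple of the integral of \<beta> as net effect.\<close>

lemma approximant_exists:
  "\<exists>\<mu> u. control_process T M f\<^sub>0 f g \<theta> \<mu> u \<and> \<mu> \<in> BV_plus P1 W1 T \<and>
    primitive u \<in> BV_plus UNIV (\<lambda>x y. manhattan (x - y)) T \<and> \<mu> 0 = \<theta> \<and>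
    (\<forall>t\<in>{0..T}. \<mu> t \<in> P1 \<and> (\<exists>s. tracks k \<mu> u t s))"
proof -
  define h where "h = mesh k"
  define N where "N = (k + 3)\<^sup>2"
  have h: "0 < h" unfolding h_def by (rule mesh_pos)
  have Nh: "real N * h = S" unfolding N_def h_def by (rule mesh_steps)
  have sub: "0 \<le> real j * h" "real j * h < real (Suc j) * h" "real (Suc j) * h - real j * h = h" for j
    using h by (auto simp: algebra_simps)
  have subN: "real j * h \<le> S" if "j \<le> N" for j
    using mult_right_mono[of "real j" "real N" h] that h Nh by simp
  define t where "t j = clock k (real j * h)" for j
  have t0: "t 0 = 0" unfolding t_def by (simp add: clock_0)
  have tN: "t N = T" unfolding t_def Nh by (rule clock_S)
  define A where "A j = (LINT r|lebesgue_on {real j * h..real (Suc j) * h}. \<alpha> r)" for j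
  define b where "b j = (LINT r|lebesgue_on {real j * h..real (Suc j) * h}. \<beta> r)" for j
  have Ab: "0 \<le> A j" "A j + manhattan (b j) \<le> h" if "j < N" for j
    using integral_control_bound[OF sub(1) less_imp_le[OF sub(2)] subN[of "Suc j"]] that sub(3)[of j]
    unfolding A_def b_def by auto
  have A\<xi>: "\<xi> (real (Suc j) * h) - \<xi> (real j * h) = A j" if "j < N" for j
    unfolding A_def by (rule \<xi>_increment[OF sub(1) less_imp_le[OF sub(2)] subN]) (use that in auto)
  have inc: "t j < t (Suc j)" "t (Suc j) - t j \<le> h - weight k * (h - A j)" "\<bar>(t (Suc j) - t j) - A j\<bar> \<le> 4 * \<delta> k * h" if "j < N" for j
    using clock_increment[OF sub(1) sub(2) subN[of "Suc j"], of k] that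
    unfolding sub(3)[of j] A\<xi>[OF that] t_def by auto
  note w = \<delta>_bounds[of k]
  \<comment> \<open>Time and cost of a block together use up h exactly, so the total cost is S - T =
    M.\<close>
  define c where "c j = h - (t (Suc j) - t j)" for j
  have bc: "manhattan (weight k *\<^sub>R b j) \<le> c j" if "j < N" for j
  proof -
    have "manhattan (weight k *\<^sub>R b j) = weight k * manhattan (b j)"
      using w(4) by (simp add: manhattan_scaleR)
    also have "\<dots> \<le> weight k * (h - A j)"
      using Ab[OF that] w(4) by (intro mult_left_mono) auto
    finally show ?thesis unfolding c_def using inc(2)[OF that] by linarith
  qed
  obtain u D U where u: "u \<in> borel_measurable borel" "\<forall>s. manhattan (u s) \<le> U" "finite D" "\<forall>s. s \<notin> D \<longrightarrow> isCont u s"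
    "\<forall>j<N. (LINT s|lebesgue_on {t j..t (Suc j)}. u s) = weight k *\<^sub>R b j \<and> (LINT s|lebesgue_on {t j..t (Suc j)}. manhattan (u s)) = c j"
    using piecewise_control_exists[of N t "\<lambda>j. weight k *\<^sub>R b j" c, OF inc(1) bc] by blast
  interpret cv: controlled_velocity f\<^sub>0 g f C L \<theta> T U u
    by unfold_locales (use \<theta> T_pos u(1,2) in auto)
  obtain X B where X: "continuous_on UNIV (\<lambda>z. X (fst z) (snd z))" "\<And>t x. norm (X t x - x) \<le> B"
    "\<And>t x. t \<in> {0..T} \<Longrightarrow> X t x = x + (LINT r|lebesgue_on {0..t}. cv.particle_velocity X r x)"
    using cv.flow_exists by blast
  interpret fl: flow f\<^sub>0 g f C L \<theta> T U u X B D
    by unfold_locales (use X u(3,4) in auto)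
  note ui = fl.u_integrable
  have tmono: "t i \<le> t j" if "i \<le> j" "j \<le> N" for i j
    using that
  proof (induction j rule: dec_induct)
    case (step j)
    then show ?case using inc(1)[of j] by simp
  qed simp
  have trange: "0 \<le> t j" "t j \<le> T" if "j \<le> N" for j
    using tmono[of 0 j] tmono[of j N] that t0 tN by auto
  \<comment> \<open>At grid times the control integral is an exact multiple of that of \<beta>, and
    elapsed time plus spent cost equals the reduced time.\<close>
  have "primitive u (t j) = weight k *\<^sub>R primitive \<beta> (real j * h) \<and>
    (LINT r|lebesgue_on {0..t j}. manhattan (u r)) = real j * h - t j" if "j \<le> N" for j
    using that
  proof (induction j)
    case 0
    have z: "(LINT r|lebesgue_on {0..0::real}. w r) = 0" if "integrable (lebesgue_on {0..0}) w" for w :: "real \<Rightarrow> 'z::euclidean_space"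
      using lebesgue_on_integral_eq[OF that] by simp
    have "primitive u (t 0) = weight k *\<^sub>R primitive \<beta> (real 0 * h)"
      unfolding primitive_def t0 using z[OF ui(1)] z[OF lebesgue_on_integrable_sub[OF \<beta>_integrable]] S_pos by simp
    moreover have "(LINT r|lebesgue_on {0..t 0}. manhattan (u r)) = real 0 * h - t 0"
      unfolding t0 using z[OF ui(2)] by simp
    ultimately show ?case ..
  next
    case (Suc j)
    have j: "j < N" using Suc.prems by simp
    have IH: "primitive u (t j) = weight k *\<^sub>R primitive \<beta> (real j * h)"
      "(LINT r|lebesgue_on {0..t j}. manhattan (u r)) = real j * h - t j"
      using Suc.IH j by auto
    have "primitive u (t (Suc j)) = primitive u (t j) + weight k *\<^sub>R b j"
      using lebesgue_on_integral_combine[OF ui(1)[of 0 T], of 0 "t j" "t (Suc j)"] trange[of j] trange[of "Suc j"] inc(1)[OF j] j u(5)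
      unfolding primitive_def by simp
    moreover have "primitive \<beta> (real (Suc j) * h) = primitive \<beta> (real j * h) + b j"
      using primitive_increment(1)[OF \<beta>_integrable sub(1) less_imp_le[OF sub(2)] subN[of "Suc j"]] j
      unfolding b_def by (simp add: algebra_simps)
    ultimately have 1: "primitive u (t (Suc j)) = weight k *\<^sub>R primitive \<beta> (real (Suc j) * h)"
      using IH(1) by (simp add: scaleR_add_right)
    have "(LINT r|lebesgue_on {0..t (Suc j)}. manhattan (u r)) = (LINT r|lebesgue_on {0..t j}. manhattan (u r)) + c j"
      using lebesgue_on_integral_combine[OF ui(2)[of 0 T], of 0 "t j" "t (Suc j)"] trange[of j] trange[of "Suc j"] inc(1)[OF j] j u(5) by simp
    then have "(LINT r|lebesgue_on {0..t (Suc j)}. manhattan (u r)) = real (Suc j) * h - t (Suc j)"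
      using IH(2) sub(3)[of j] unfolding c_def by simp
    with 1 show ?case ..
  qed
  then have pu: "primitive u (t j) = weight k *\<^sub>R primitive \<beta> (real j * h)"
    "(LINT r|lebesgue_on {0..t j}. manhattan (u r)) = real j * h - t j" if "j \<le> N" for j
    using that by blast+
  have "u \<in> controls T M"
    unfolding controls_def
  proof (intro CollectI conjI)
    show "u \<in> borel_measurable (restrict_space borel {0..T})" using u(1) by (rule measurable_restrict_space1)
    show "\<exists>B. AE t in lebesgue_on {0..T}. manhattan (u t) \<le> B" using u(2) by auto
    show "(LINT t|lebesgue_on {0..T}. manhattan (u t)) = M" using pu(2)[of N] tN Nh S_eq by simp
  qed
  then have cp: "control_process T M f\<^sub>0 f g \<theta> fl.law u" by (rule fl.law_control_process)
  have idr: "((\<lambda>s. s) \<longlongrightarrow> r) (at_right r)" for r :: real by (rule tendsto_ident_at)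
  have BV1: "fl.law \<in> BV_plus P1 W1 T"
    by (rule ac_curve_BV_plus[OF fl.law_ac, of T "\<lambda>t. t"]) (use T_pos idr in auto)
  have BV2: "primitive u \<in> BV_plus UNIV (\<lambda>x y. manhattan (x - y)) T"
    by (rule primitive_BV_plus[OF ui(1)[of 0 T], of T "\<lambda>t. t"]) (use idr in auto)
  \<comment> \<open>The last grid time not after r. At r = T it has to be t N, since the tracked
    point must then be S exactly.\<close>
  have block: "\<exists>j\<le>N. t j \<le> r \<and> (r - t j) + (LINT s|lebesgue_on {t j..r}. manhattan (u s)) \<le> h \<and> (r = T \<longrightarrow> j = N)"
    if r: "r \<in> {0..T}" for r
  proof (cases "r = T")
    case True
    have "(LINT s|lebesgue_on {t N..T}. manhattan (u s)) = 0"
      unfolding tN using lebesgue_on_integral_eq[OF ui(2), of T T] by simp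
    then show ?thesis using True tN h by (intro exI[of _ N]) auto
  next
    case False
    have "\<exists>j<N. (\<forall>i\<le>j. \<not> r < t i) \<and> r < t (Suc j)"
      by (rule ex_least_nat_less) (use False r tN t0 in auto)
    then obtain j where j: "j < N" "t j \<le> r" "r < t (Suc j)" by (auto simp: not_less)
    have "(LINT s|lebesgue_on {t j..t (Suc j)}. manhattan (u s)) = (LINT s|lebesgue_on {t j..r}. manhattan (u s)) + (LINT s|lebesgue_on {r..t (Suc j)}. manhattan (u s))"
      by (rule lebesgue_on_integral_combine[OF ui(2)]) (use j in auto)
    moreover have "0 \<le> (LINT s|lebesgue_on {r..t (Suc j)}. manhattan (u s))" by simp
    moreover have "(LINT s|lebesgue_on {t j..t (Suc j)}. manhattan (u s)) = h - (t (Suc j) - t j)"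
      using u(5) j(1) unfolding c_def by blast
    ultimately have "(r - t j) + (LINT s|lebesgue_on {t j..r}. manhattan (u s)) \<le> h"
      using j(3) by linarith
    then show ?thesis using j False by (intro exI[of _ j]) auto
  qed
  have main: "\<exists>s. tracks k fl.law u r s"
    if r: "r \<in> {0..T}" for r
  proof -
    obtain j where j: "j \<le> N" "t j \<le> r" "(r - t j) + (LINT s|lebesgue_on {t j..r}. manhattan (u s)) \<le> h" "r = T \<longrightarrow> j = N"
      using block[OF r] by blast
    define s where "s = real j * h"
    have s: "s \<in> {0..S}" unfolding s_def using sub(1) subN[OF j(1)] by auto
    have u0: "0 \<le> (LINT s|lebesgue_on {t j..r}. manhattan (u s))" by simp
    have 1: "\<bar>clock k s - r\<bar> \<le> mesh k"
      using j(2,3) u0 unfolding s_def t_def[symmetric] h_def[symmetric] by linarith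
    have 2: "r = T \<longrightarrow> s = S" unfolding s_def using j(4) Nh by simp
    have 3: "manhattan (primitive u r - primitive \<beta> s) \<le> mesh k + 2 * \<delta> k * S"
    proof -
      have "manhattan (primitive u r - primitive u (t j)) \<le> (LINT s|lebesgue_on {t j..r}. manhattan (u s))"
        using primitive_increment(1)[OF ui(1)[of 0 T], of "t j" r] manhattan_integral_le(2)[OF ui(1)[of "t j" r]] trange(1)[OF j(1)] j(2) r by simp
      also have "\<dots> \<le> h" using j(2,3) by linarith
      finally have 1: "manhattan (primitive u r - primitive u (t j)) \<le> h" .
      have "manhattan (primitive \<beta> s) \<le> s"
        using integral_control_bound[of 0 s] s unfolding primitive_def by simp
      then have "manhattan (primitive \<beta> s) \<le> S" using s by simp
      have "primitive u (t j) - primitive \<beta> s = (weight k - 1) *\<^sub>R primitive \<beta> s"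
        using pu(1)[OF j(1)] by (simp add: s_def algebra_simps)
      then have "manhattan (primitive u (t j) - primitive \<beta> s) = (1 - weight k) * manhattan (primitive \<beta> s)"
        using w(5) by (simp add: manhattan_scaleR)
      also have "\<dots> \<le> (2 * \<delta> k) * S"
        using w \<open>manhattan (primitive \<beta> s) \<le> S\<close> by (intro mult_mono) (auto simp: weight_def)
      finally have 2: "manhattan (primitive u (t j) - primitive \<beta> s) \<le> 2 * \<delta> k * S" .
      show ?thesis
        using manhattan_triangle[of "primitive u r" "primitive \<beta> s" "primitive u (t j)"] 1 2 unfolding h_def by linarith
    qed
    have 4: "W1 (fl.law r) (\<nu> s) \<le> error_bound (mollifier.deriv_mass \<kappa>) \<omega> \<epsilon> k"
      if m: "mollifier \<kappa> \<epsilon>" and \<epsilon>: "0 < \<epsilon>" and \<omega>: "0 \<le> \<omega>" "\<forall>r\<in>{0..S}. \<forall>q\<in>{0..S}. \<bar>r - q\<bar> \<le> mesh k \<longrightarrow> W1 (\<nu> r) (\<nu> q) \<le> \<omega>" for \<kappa> :: "real ^ 'n \<Rightarrow> real" and \<epsilon> \<omega>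
    proof -
      interpret mollifier \<kappa> \<epsilon> by (rule m)
      interpret cmp: comparison f\<^sub>0 g f C L \<theta> T U u X B D S \<alpha> \<beta> \<kappa> \<epsilon> \<nu>
        by unfold_locales (use S_pos \<epsilon> solution in auto)
      have GG: "cmp.growth = G" unfolding cmp.growth_def G_def by simp
      let ?d = "exp ((2 * L + G) * S) * (\<epsilon> + S * (cmp.modulus * \<omega> + deriv_mass * (2 * C)\<^sup>2 * h + (2 * L + G) * \<epsilon> + G * (2 * C * h) + 2 * C * (6 * \<delta> k)))"
      have "cmp.close ?d (fl.law (t j)) (\<nu> (real j * h))"
        unfolding GG[symmetric]
      proof (rule cmp.close_iterate[where N = N])
        show "(t (Suc i) - t i) + (LINT r|lebesgue_on {t i..t (Suc i)}. manhattan (u r)) \<le> h" if "i < N" for i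
          using u(5) that unfolding c_def by simp
        \<comment> \<open>The clock contributes 4 \<delta> k h by \<open>clock_increment\<close>;
          shrinking \<beta> contributes (1 - weight k) h, which is at most 2 \<delta> k h.\<close>
        show "\<bar>(t (Suc i) - t i) - (LINT r|lebesgue_on {real i * h..real (Suc i) * h}. \<alpha> r)\<bar> +
          manhattan ((LINT r|lebesgue_on {t i..t (Suc i)}. u r) - (LINT r|lebesgue_on {real i * h..real (Suc i) * h}. \<beta> r)) \<le> 6 * \<delta> k * h"
          if i: "i < N" for i
        proof -
          have "(LINT r|lebesgue_on {t i..t (Suc i)}. u r) - b i = (weight k - 1) *\<^sub>R b i"
            using u(5) i by (simp add: algebra_simps)
          then have "manhattan ((LINT r|lebesgue_on {t i..t (Suc i)}. u r) - b i) = (1 - weight k) * manhattan (b i)"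
            using w(5) by (simp add: manhattan_scaleR)
          also have "\<dots> \<le> (2 * \<delta> k) * h"
            using w Ab[OF i] by (intro mult_mono) (auto simp: weight_def)
          finally show ?thesis using inc(3)[OF i] unfolding A_def[symmetric] b_def[symmetric] by linarith
        qed
        show "W1 (\<nu> r) (\<nu> q) \<le> \<omega>" if "r \<in> {0..S}" "q \<in> {0..S}" "\<bar>r - q\<bar> \<le> h" for r q
          using \<omega>(2) that unfolding h_def by blast
        show "t i \<le> t (Suc i)" if "i < N" for i using inc(1)[OF that] by simp
      qed (use trange t0 h Nh \<omega>(1) w(1) j(1) in auto)
      then have "W1 (fl.law (t j)) (\<nu> s) \<le> CARD('n) * (?d + \<epsilon>)"
        unfolding s_def[symmetric] by (rule cmp.close_W1[OF _ fl.law_P1 cmp.\<nu>_P1[OF s]])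
      moreover have "W1 (fl.law (t j)) (fl.law r) \<le> CARD('n) * (2 * C * h)"
      proof (rule fl.law_W1)
        show tr: "0 \<le> t j" "t j \<le> r" "r \<le> T" using trange(1)[OF j(1)] j(2) r by auto
        show "norm (X r x - X (t j) x) \<le> 2 * C * h" for x
          by (rule order_trans[OF fl.X_displacement[OF tr] mult_left_mono[OF j(3)]]) (use C_nonneg in simp)
      qed
      moreover have "W1 (fl.law r) (\<nu> s) \<le> W1 (fl.law r) (fl.law (t j)) + W1 (fl.law (t j)) (\<nu> s)"
        by (rule W1_triangle[OF fl.law_P1 fl.law_P1 cmp.\<nu>_P1[OF s]])
      ultimately show ?thesis
        unfolding error_bound_def cmp.modulus_def h_def[symmetric] by (simp only: W1_commute[of "fl.law r"])
    qed
    show ?thesis unfolding tracks_def using 1 2 3 4 s by blast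
  qed
  show ?thesis using cp BV1 BV2 fl.law_initial fl.law_P1 main by blast
qed

text \<open>The order of the choices matters: first the scale \<epsilon>, then \<omega> small
  relative to the second order constant of that kernel, and only then k large, so that \<nu> varies
  by at most \<omega> over one mesh and the remaining terms disappear.\<close>

lemma error_vanishes:
  assumes "\<And>k. 0 \<le> w k"
    and w: "\<And>\<kappa> \<epsilon> \<omega> k. mollifier \<kappa> \<epsilon> \<Longrightarrow> 0 < \<epsilon> \<Longrightarrow> 0 \<le> \<omega> \<Longrightarrow>
      (\<forall>r\<in>{0..S}. \<forall>q\<in>{0..S}. \<bar>r - q\<bar> \<le> mesh k \<longrightarrow> W1 (\<nu> r) (\<nu> q) \<le> \<omega>) \<Longrightarrow>
      w k \<le> error_bound (mollifier.deriv_mass (\<kappa> :: real ^ 'n \<Rightarrow> real)) \<omega> \<epsilon> k"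
  shows "w \<longlonglongrightarrow> 0"
proof (rule order_tendstoI)
  fix e :: real assume e: "e < 0"
  then show "\<forall>\<^sub>F k in sequentially. e < w k" using assms(1) by (intro always_eventually allI) (rule less_le_trans)
next
  fix e :: real assume e: "0 < e"
  define E where "E = exp ((2 * L + G) * S)"
  \<comment> \<open>With kernel and \<omega> fixed, the error tends to at most Q \<epsilon> as k
    grows; \<epsilon> is chosen to make this e / 2.\<close>
  define Q where "Q = CARD('n) * (E * (1 + S * (1 + (2 * L + G))) + 1)"
  have G0: "0 \<le> G" unfolding G_def using L_nonneg by simp
  have Q: "0 < Q" unfolding Q_def E_def using S_pos L_nonneg G0 by (intro mult_pos_pos add_nonneg_pos) auto
  define \<epsilon> where "\<epsilon> = e / (2 * Q)"
  have \<epsilon>: "0 < \<epsilon>" unfolding \<epsilon>_def using e Q by simp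
  obtain \<kappa> :: "real ^ 'n \<Rightarrow> real" where "C_inf \<kappa>" "\<And>z. 0 \<le> \<kappa> z" "\<And>z. \<epsilon> < norm z \<Longrightarrow> \<kappa> z = 0" "integrable lborel \<kappa>" "(LINT z|lborel. \<kappa> z) = 1"
    using mollifier_exists[OF \<epsilon>] by blast
  then interpret mollifier \<kappa> \<epsilon> by unfold_locales
  define m where "m = 2 * C * deriv_mass + 2 * L + CARD('n) * L"
  have m: "0 \<le> m" unfolding m_def using C_nonneg L_nonneg deriv_mass_nonneg by simp
  \<comment> \<open>Makes the product with the kernel-dependent constant m at most \<epsilon>; the
    summand 1 covers m = 0.\<close>
  define \<omega> where "\<omega> = \<epsilon> / (m + 1)"
  have \<omega>: "0 < \<omega>" "m * \<omega> \<le> \<epsilon>" unfolding \<omega>_def using m \<epsilon> by (auto simp: divide_simps algebra_simps)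
  obtain d where d: "0 < d" "\<And>r q. r \<in> {0..S} \<Longrightarrow> q \<in> {0..S} \<Longrightarrow> \<bar>r - q\<bar> < d \<Longrightarrow> W1 (\<nu> r) (\<nu> q) < \<omega>"
    using ac_curve_uniform[OF ac _ \<omega>(1)] S_pos by (metis less_imp_le)
  have "(\<lambda>k. error_bound deriv_mass \<omega> \<epsilon> k) \<longlonglongrightarrow>
      CARD('n) * (E * (\<epsilon> + S * (m * \<omega> + deriv_mass * (2 * C)\<^sup>2 * 0 + (2 * L + G) * \<epsilon> + G * (2 * C * 0) + 2 * C * (6 * 0))) + \<epsilon>) + CARD('n) * (2 * C * 0)"
    unfolding error_bound_def m_def[symmetric] E_def[symmetric]
    by (intro tendsto_intros mesh_limit \<delta>_limit)
  then have lim: "(\<lambda>k. error_bound deriv_mass \<omega> \<epsilon> k) \<longlonglongrightarrow> CARD('n) * (E * (\<epsilon> + S * (m * \<omega> + (2 * L + G) * \<epsilon>)) + \<epsilon>)"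
    by simp
  have "CARD('n) * (E * (\<epsilon> + S * (m * \<omega> + (2 * L + G) * \<epsilon>)) + \<epsilon>) \<le> CARD('n) * (E * (\<epsilon> + S * (\<epsilon> + (2 * L + G) * \<epsilon>)) + \<epsilon>)"
    using \<omega>(2) S_pos by (intro mult_left_mono add_mono order_refl) (auto simp: E_def)
  also have "\<dots> = Q * \<epsilon>" unfolding Q_def by (simp add: algebra_simps)
  also have "\<dots> < e" unfolding \<epsilon>_def using Q e by simp
  finally have "\<forall>\<^sub>F k in sequentially. error_bound deriv_mass \<omega> \<epsilon> k < e"
    by (rule order_tendstoD(2)[OF lim])
  moreover have "\<forall>\<^sub>F k in sequentially. mesh k < d" by (rule order_tendstoD(2)[OF mesh_limit d(1)])
  ultimately show "\<forall>\<^sub>F k in sequentially. w k < e"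
  proof eventually_elim
    case (elim k)
    have "w k \<le> error_bound deriv_mass \<omega> \<epsilon> k"
    proof (rule w[OF _ \<epsilon> less_imp_le[OF \<omega>(1)]])
      show "mollifier \<kappa> \<epsilon>" by unfold_locales
      show "\<forall>r\<in>{0..S}. \<forall>q\<in>{0..S}. \<bar>r - q\<bar> \<le> mesh k \<longrightarrow> W1 (\<nu> r) (\<nu> q) \<le> \<omega>"
        using d(2) elim(2) by (auto intro: less_imp_le)
    qed
    then show ?case using elim(1) by linarith
  qed
qed

lemma approximation:
  "\<exists>\<mu>s us. (\<forall>k. control_process T M f\<^sub>0 f g \<theta> (\<mu>s k) (us k)) \<and>
    BV_converges P1 W1 T \<theta> \<mu>s (\<lambda>t. \<nu> (p t)) \<and>
    BV_converges UNIV (\<lambda>x y. manhattan (x - y)) T 0 (\<lambda>k. primitive (us k)) (\<lambda>t. primitive \<beta> (p t))"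
proof -
  have "\<forall>k. \<exists>\<mu> u. control_process T M f\<^sub>0 f g \<theta> \<mu> u \<and> \<mu> \<in> BV_plus P1 W1 T \<and>
    primitive u \<in> BV_plus UNIV (\<lambda>x y. manhattan (x - y)) T \<and> \<mu> 0 = \<theta> \<and>
    (\<forall>t\<in>{0..T}. \<mu> t \<in> P1 \<and> (\<exists>s. tracks k \<mu> u t s))"
    using approximant_exists by blast
  from choice[OF this] obtain \<mu> where "\<forall>k. \<exists>u. control_process T M f\<^sub>0 f g \<theta> (\<mu> k) u \<and> \<mu> k \<in> BV_plus P1 W1 T \<and>
    primitive u \<in> BV_plus UNIV (\<lambda>x y. manhattan (x - y)) T \<and> \<mu> k 0 = \<theta> \<and>
    (\<forall>t\<in>{0..T}. \<mu> k t \<in> P1 \<and> (\<exists>s. tracks k (\<mu> k) u t s))" ..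
  from choice[OF this] obtain u where "\<forall>k. control_process T M f\<^sub>0 f g \<theta> (\<mu> k) (u k) \<and> \<mu> k \<in> BV_plus P1 W1 T \<and>
    primitive (u k) \<in> BV_plus UNIV (\<lambda>x y. manhattan (x - y)) T \<and> \<mu> k 0 = \<theta> \<and>
    (\<forall>t\<in>{0..T}. \<mu> k t \<in> P1 \<and> (\<exists>s. tracks k (\<mu> k) (u k) t s))" ..
  then have \<mu>: "control_process T M f\<^sub>0 f g \<theta> (\<mu> k) (u k)" "\<mu> k \<in> BV_plus P1 W1 T"
    "primitive (u k) \<in> BV_plus UNIV (\<lambda>x y. manhattan (x - y)) T" "\<mu> k 0 = \<theta>"
    "t \<in> {0..T} \<Longrightarrow> \<mu> k t \<in> P1" "t \<in> {0..T} \<Longrightarrow> \<exists>s. tracks k (\<mu> k) (u k) t s" for k t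
    by blast+
  have p_mem: "t \<in> {0..T} \<Longrightarrow> p t \<in> {0..S}" for t by (rule p_range)
  have S0: "0 \<le> S" using S_pos by simp
  have BV1: "(\<lambda>t. \<nu> (p t)) \<in> BV_plus P1 W1 T"
    by (rule ac_curve_BV_plus[OF ac S0 p_range p_mono p_right_continuous])
  have BV2: "(\<lambda>t. primitive \<beta> (p t)) \<in> BV_plus UNIV (\<lambda>x y. manhattan (x - y)) T"
    by (rule primitive_BV_plus[OF \<beta>_integrable p_range p_mono p_right_continuous])
  \<comment> \<open>Convergence holds at every t in (0, T], including jumps of p, because the
    tracked points converge to p t itself. Continuity of the limit matters only at t = 0.\<close>
  have conv: "(\<lambda>k. W1 (\<mu> k t) (\<nu> (p t))) \<longlonglongrightarrow> 0"
    "(\<lambda>k. manhattan (primitive (u k) t - primitive \<beta> (p t))) \<longlonglongrightarrow> 0" if t: "0 < t" "t \<le> T" for t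
  proof -
    have tT: "t \<in> {0..T}" using t by simp
    have "\<forall>k. \<exists>s. tracks k (\<mu> k) (u k) t s" using \<mu>(6)[OF tT] by blast
    from choice[OF this] obtain s where "\<forall>k. tracks k (\<mu> k) (u k) t (s k)" ..
    then have s: "s k \<in> {0..S}" "\<bar>clock k (s k) - t\<bar> \<le> mesh k" "t = T \<Longrightarrow> s k = S"
      "manhattan (primitive (u k) t - primitive \<beta> (s k)) \<le> mesh k + 2 * \<delta> k * S"
      "mollifier \<kappa> \<epsilon> \<Longrightarrow> 0 < \<epsilon> \<Longrightarrow> 0 \<le> \<omega> \<Longrightarrow>
        (\<forall>r\<in>{0..S}. \<forall>q\<in>{0..S}. \<bar>r - q\<bar> \<le> mesh k \<longrightarrow> W1 (\<nu> r) (\<nu> q) \<le> \<omega>) \<Longrightarrow>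
        W1 (\<mu> k t) (\<nu> (s k)) \<le> error_bound (mollifier.deriv_mass \<kappa>) \<omega> \<epsilon> k" for k and \<kappa> :: "real ^ 'n \<Rightarrow> real" and \<epsilon> \<omega>
      unfolding tracks_def by blast+
    have sp: "s \<longlonglongrightarrow> p t"
    proof (cases "t = T")
      case True
      then have "s = (\<lambda>k. p t)" using s(3) p_T by auto
      then show ?thesis by simp
    next
      case False
      show ?thesis by (rule clock_inverse_limit[OF _ _ s(1,2)]) (use t False in auto)
    qed
    have P: "\<nu> (s k) \<in> P1" "\<nu> (p t) \<in> P1" for k using ac_curve_P1[OF ac s(1)] ac_curve_P1[OF ac p_mem[OF tT]] by auto
    have 1: "(\<lambda>k. W1 (\<mu> k t) (\<nu> (s k))) \<longlonglongrightarrow> 0"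
      by (rule error_vanishes[OF W1_nonneg[OF \<mu>(5)[OF tT] P(1)] s(5)])
    obtain H where H: "continuous_on {0..S} H"
      "\<And>r q. 0 \<le> r \<Longrightarrow> r \<le> q \<Longrightarrow> q \<le> S \<Longrightarrow> W1 (\<nu> r) (\<nu> q) \<le> H q - H r"
      using ac_curve_modulus[OF ac S0] by blast
    have Hb: "W1 (\<nu> r) (\<nu> q) \<le> \<bar>H r - H q\<bar>" if "r \<in> {0..S}" "q \<in> {0..S}" for r q
      using H(2)[of r q] H(2)[of q r] that W1_commute[of "\<nu> r" "\<nu> q"] by (cases "r \<le> q") auto
    have "(\<lambda>k. H (s k)) \<longlonglongrightarrow> H (p t)"
      by (rule continuous_on_tendsto_compose[OF H(1) sp p_mem[OF tT]]) (use s(1) in auto)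
    then have "(\<lambda>k. \<bar>H (s k) - H (p t)\<bar>) \<longlonglongrightarrow> \<bar>H (p t) - H (p t)\<bar>" by (intro tendsto_intros)
    then have 2: "(\<lambda>k. W1 (\<mu> k t) (\<nu> (s k)) + \<bar>H (s k) - H (p t)\<bar>) \<longlonglongrightarrow> 0" using tendsto_add[OF 1] by simp
    show "(\<lambda>k. W1 (\<mu> k t) (\<nu> (p t))) \<longlonglongrightarrow> 0"
    proof (rule tendsto_sandwich[OF _ _ tendsto_const 2])
      show "\<forall>\<^sub>F k in sequentially. 0 \<le> W1 (\<mu> k t) (\<nu> (p t))"
        by (intro always_eventually allI W1_nonneg \<mu>(5)[OF tT] P(2))
      show "\<forall>\<^sub>F k in sequentially. W1 (\<mu> k t) (\<nu> (p t)) \<le> W1 (\<mu> k t) (\<nu> (s k)) + \<bar>H (s k) - H (p t)\<bar>"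
      proof (intro always_eventually allI)
        fix k
        have "W1 (\<nu> (s k)) (\<nu> (p t)) \<le> \<bar>H (s k) - H (p t)\<bar>" by (intro Hb s(1) p_mem[OF tT])
        then show "W1 (\<mu> k t) (\<nu> (p t)) \<le> W1 (\<mu> k t) (\<nu> (s k)) + \<bar>H (s k) - H (p t)\<bar>"
          using W1_triangle[OF \<mu>(5)[OF tT, of k] P(1)[of k] P(2)] by linarith
      qed
    qed
    have "continuous_on {0..S} (primitive \<beta>)"
      unfolding primitive_def[abs_def] by (rule continuous_on_lebesgue_primitive[OF \<beta>_integrable])
    then have "(\<lambda>k. primitive \<beta> (s k)) \<longlonglongrightarrow> primitive \<beta> (p t)"
      by (rule continuous_on_tendsto_compose[OF _ sp p_mem[OF tT]]) (use s(1) in auto)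
    then have "(\<lambda>k. CARD('m) * norm (primitive \<beta> (s k) - primitive \<beta> (p t))) \<longlonglongrightarrow> CARD('m) * norm (primitive \<beta> (p t) - primitive \<beta> (p t))"
      by (intro tendsto_intros)
    moreover have "(\<lambda>k. mesh k + 2 * \<delta> k * S) \<longlonglongrightarrow> 0 + 2 * 0 * S" by (intro tendsto_intros mesh_limit \<delta>_limit)
    ultimately have 3: "(\<lambda>k. (mesh k + 2 * \<delta> k * S) + CARD('m) * norm (primitive \<beta> (s k) - primitive \<beta> (p t))) \<longlonglongrightarrow> 0"
      using tendsto_add by fastforce
    show "(\<lambda>k. manhattan (primitive (u k) t - primitive \<beta> (p t))) \<longlonglongrightarrow> 0"
    proof (rule tendsto_sandwich[OF _ _ tendsto_const 3])
      show "\<forall>\<^sub>F k in sequentially. manhattan (primitive (u k) t - primitive \<beta> (p t))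
          \<le> (mesh k + 2 * \<delta> k * S) + CARD('m) * norm (primitive \<beta> (s k) - primitive \<beta> (p t))"
      proof (intro always_eventually allI)
        fix k
        show "manhattan (primitive (u k) t - primitive \<beta> (p t))
          \<le> (mesh k + 2 * \<delta> k * S) + CARD('m) * norm (primitive \<beta> (s k) - primitive \<beta> (p t))"
          using s(4)[of k] manhattan_triangle[of "primitive (u k) t" "primitive \<beta> (p t)" "primitive \<beta> (s k)"]
            manhattan_le_norm[of "primitive \<beta> (s k) - primitive \<beta> (p t)"] by linarith
      qed
    qed simp
  qed
  have "BV_converges P1 W1 T \<theta> \<mu> (\<lambda>t. \<nu> (p t))"
    unfolding BV_converges_def
  proof (intro conjI allI \<mu>(2) BV1 ballI impI)
    fix t assume t: "t \<in> {0..T}" "continuity_point W1 T \<theta> (\<lambda>t. \<nu> (p t)) t \<or> t = T"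
    show "(\<lambda>k. W1 (\<mu> k t) (\<nu> (p t))) \<longlonglongrightarrow> 0"
    proof (cases "t = 0")
      case True
      \<comment> \<open>At time 0 a continuity point means that the limit has not left the initial
        datum, and every approximating curve starts there.\<close>
      then have "\<nu> (p t) = \<theta>" using t T_pos by (auto simp: continuity_point_def)
      then show ?thesis using True \<mu>(4) W1_refl[OF \<theta>] by simp
    next
      case False
      then show ?thesis using t(1) by (intro conv(1)) auto
    qed
  qed
  moreover have "BV_converges UNIV (\<lambda>x y. manhattan (x - y)) T 0 (\<lambda>k. primitive (u k)) (\<lambda>t. primitive \<beta> (p t))"
    unfolding BV_converges_def
  proof (intro conjI allI \<mu>(3) BV2 ballI impI)
    fix t assume t: "t \<in> {0..T}" "continuity_point (\<lambda>x y. manhattan (x - y)) T 0 (\<lambda>t. primitive \<beta> (p t)) t \<or> t = T"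
    show "(\<lambda>k. manhattan (primitive (u k) t - primitive \<beta> (p t))) \<longlonglongrightarrow> 0"
    proof (cases "t = 0")
      case True
      then have "primitive \<beta> (p t) = 0" using t T_pos by (auto simp: continuity_point_def)
      moreover have "primitive (u k) 0 = 0" for k
      proof -
        have "AE r in lebesgue_on {0..0::real}. u k r = 0"
          by (rule AE_I'[of "{0}"]) (auto simp: null_sets_restrict_space)
        then show ?thesis unfolding primitive_def by (rule integral_eq_zero_AE)
      qed
      ultimately show ?thesis using True by simp
    next
      case False
      then show ?thesis using t(1) by (intro conv(2)) auto
    qed
  qed
  ultimately show ?thesis using \<mu>(1) by blast
qed

end

theorem theorem3p8:
  fixes f\<^sub>0 g :: "real ^ 'n \<Rightarrow> real ^ 'n"
    and f :: "'m::finite \<Rightarrow> real ^ 'n \<Rightarrow> real ^ 'n"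
    and T M :: real
    and \<theta> :: "(real ^ 'n) measure"
    and \<nu> :: "real \<Rightarrow> (real ^ 'n) measure"
    and \<alpha> :: "real \<Rightarrow> real"
    and \<beta> :: "real \<Rightarrow> real ^ 'm"
  assumes "T > 0" and "M > 0"
    and "assumption_A1 f\<^sub>0 f g"
    and "\<theta> \<in> P1"
    and "reduced_control_process T M f\<^sub>0 f g \<theta> \<nu> \<alpha> \<beta>"
  shows "\<exists>(\<mu>s :: nat \<Rightarrow> real \<Rightarrow> (real ^ 'n) measure) (us :: nat \<Rightarrow> real \<Rightarrow> real ^ 'm).
    (\<forall>k. control_process T M f\<^sub>0 f g \<theta> (\<mu>s k) (us k)) \<and>
    BV_converges P1 W1 T \<theta> \<mu>s
      (\<lambda>t. \<nu> (pseudo_inverse T (T + M) (primitive \<alpha>) t)) \<and>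
    BV_converges UNIV (\<lambda>x y. manhattan (x - y)) T 0 (\<lambda>k. primitive (us k))
      (\<lambda>t. primitive \<beta> (pseudo_inverse T (T + M) (primitive \<alpha>) t))"
proof -
  obtain C L where CL: "0 < C" "0 < L"
    "\<And>x. manhattan (f\<^sub>0 x) + (\<Sum>i\<in>UNIV. manhattan (f i x)) + manhattan (g x) \<le> C"
    "\<And>x y. manhattan (f\<^sub>0 x - f\<^sub>0 y) + (\<Sum>i\<in>UNIV. manhattan (f i x - f i y)) + manhattan (g x - g y) \<le> L * manhattan (x - y)"
    using assms(3) unfolding assumption_A1_def by blast
  have bound: "norm a \<le> c" "norm (b i) \<le> c" "norm d \<le> c"
    if "manhattan a + (\<Sum>i\<in>UNIV. manhattan (b i)) + manhattan d \<le> c" for a d :: "real ^ 'n" and b :: "'m \<Rightarrow> real ^ 'n" and c i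
  proof -
    have "manhattan (b i) \<le> (\<Sum>i\<in>UNIV. manhattan (b i))" "0 \<le> (\<Sum>i\<in>UNIV. manhattan (b i))"
      by (auto intro: member_le_sum sum_nonneg)
    moreover have "0 \<le> manhattan a" "0 \<le> manhattan d" by auto
    ultimately show "norm a \<le> c" "norm (b i) \<le> c" "norm d \<le> c"
      using that norm_le_manhattan[of a] norm_le_manhattan[of "b i"] norm_le_manhattan[of d] by linarith+
  qed
  \<comment> \<open>The Lipschitz bound is relative to the Manhattan distance; expressed through the
    Euclidean one it takes a dimension factor, which is absorbed into the constant.\<close>
  have le: "L * manhattan z \<le> (L * CARD('n)) * norm z" for z :: "real ^ 'n"
    using mult_left_mono[OF manhattan_le_norm[of z], of L] CL(2) by (simp add: mult.assoc)
  interpret velocity_data f\<^sub>0 g f C "L * CARD('n)"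
  proof
    show "norm (f\<^sub>0 x) \<le> C" "norm (f i x) \<le> C" "norm (g x) \<le> C" for i x
      by (rule bound[OF CL(3)])+
    show "norm (f\<^sub>0 x - f\<^sub>0 y) \<le> (L * CARD('n)) * norm (x - y)" "norm (f i x - f i y) \<le> (L * CARD('n)) * norm (x - y)"
      "norm (g x - g y) \<le> (L * CARD('n)) * norm (x - y)" for i x y
      by (rule bound[OF order_trans[OF CL(4) le]])+
  qed (use CL in auto)
  interpret reduced_process f\<^sub>0 g f C "L * CARD('n)" "T + M" \<alpha> \<beta> T M \<theta> \<nu>
    by unfold_locales
       (use assms in \<open>auto simp: reduced_control_process_def reduced_controls_def velocity_def\<close>)
  show ?thesis using approximation unfolding p_def \<xi>_def .
qed

end
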